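(* Let $n\ge2$, $1<p<n$, $r>0$, $p'=\frac p{p-1}$, $m=\frac{p-n}{p-1}<0$, $B_r^c=\mathbb{R}^n\setminus\bar B_r$, and $\gamma=2^{1/|m|}r$. For every $u\in M(r,\infty)$, $$\int_{B_r^c}\left|\frac{\langle x,\nabla u\rangle}{|x|}\right|^pdx\ \ge\ \left(\frac1p\right)^p\sum_{j=1}^2\frac{\left[K_{0j}(u)+(p-1)K_{1j}(u)\right]^p}{\left(K_{1j}(u)\right)^{p-1}}.$$ Moreover, this inequality becomes an equality for the function $$u_\beta(x)=\begin{cases}(r^m-|x|^m)^\beta, & x\in B_\gamma\setminus B_r,\\ |x|^{m\beta}, & x\in B_\gamma^c,\end{cases}$$ for every $\beta>1/p'$ with $u_\beta\in M(r,\infty)$.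
   Context: $B_\rho\subset\mathbb{R}^n$ is the open ball of radius $\rho$ centered at $0$, $B_\rho^c=\mathbb{R}^n\setminus\bar B_\rho$; $\langle\cdot,\cdot\rangle$ is the Euclidean scalar product; $d\sigma$ is surface measure, and values on spheres are taken in the sense of traces. $M(r,\infty)$ is the set of $u\in W^{1,p}_0(B_r^c)$ such that $$\left(\frac{\hat r^m-r^m}{m}\right)^{1-p}\int_{\partial B_{\hat r}}|u|^p\,d\sigma\to0\ \text{ as }\hat r\to r+0,\qquad R^{1-p}\int_{\partial B_R}|u|^p\,d\sigma\to0\ \text{ as }R\to\infty.$$ Define $$K_{11}(u)=|m|^p\int_{B_\gamma\setminus B_r}\frac{|u|^p}{|x|^{(n-1)p'}\,\left||x|^m-r^m\right|^p}dx,\qquad K_{12}(u)=|m|^p\int_{B_\gamma^c}\frac{|u|^p}{|x|^p}dx,$$ $$K_{01}(u)=K_{02}(u)=|m|^{p-1}\gamma^{1-p}\int_{\partial B_\gamma}|u|^p\,d\sigma.$$ If $K_{1j}(u)=0$ for some $j$ (so $u=0$ a.e. on the corresponding region and $K_{0j}(u)=0$), the $j$-th summand on the right-hand side is understood as $0$. *)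

theory Defs
  imports "HOL-Analysis.Analysis"
begin

fun C_k :: "nat \<Rightarrow> ('a::euclidean_space \<Rightarrow> real) \<Rightarrow> bool" where
  "C_k 0 f \<longleftrightarrow> continuous_on UNIV f"
| "C_k (Suc k) f \<longleftrightarrow>
     f differentiable_on UNIV \<and> (\<forall>i\<in>Basis. C_k k (\<lambda>x. frechet_derivative f (at x) i))"

definition test_functions :: "'a::euclidean_space set \<Rightarrow> ('a \<Rightarrow> real) set" where
  "test_functions \<Omega> =
     {\<phi>. (\<forall>k. C_k k \<phi>) \<and> (\<exists>K. compact K \<and> K \<subseteq> \<Omega> \<and> (\<forall>x. x \<notin> K \<longrightarrow> \<phi> x = 0))}"

text \<open>Functions on an open set are represented by total functions whose values outside
  the set are irrelevant.\<close>

definition L_p :: "'a::euclidean_space set \<Rightarrow> real \<Rightarrow> ('a \<Rightarrow> 'b::euclidean_space) set" where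
  "L_p \<Omega> p = {f. set_borel_measurable lebesgue \<Omega> f \<and>
                 set_integrable lebesgue \<Omega> (\<lambda>x. norm (f x) powr p)}"

definition locally_integrable_on ::
    "('a::euclidean_space \<Rightarrow> 'b::euclidean_space) \<Rightarrow> 'a set \<Rightarrow> bool" where
  "locally_integrable_on f \<Omega> \<longleftrightarrow>
     (\<forall>K. compact K \<and> K \<subseteq> \<Omega> \<longrightarrow> f absolutely_integrable_on K)"

definition is_weak_gradient ::
    "'a::euclidean_space set \<Rightarrow> ('a \<Rightarrow> real) \<Rightarrow> ('a \<Rightarrow> 'a) \<Rightarrow> bool" where
  "is_weak_gradient \<Omega> u g \<longleftrightarrow>
     locally_integrable_on u \<Omega> \<and> locally_integrable_on g \<Omega> \<and>
     (\<forall>\<phi>\<in>test_functions \<Omega>. \<forall>i\<in>Basis.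
        (LINT x:\<Omega>|lebesgue. u x * frechet_derivative \<phi> (at x) i) =
        - (LINT x:\<Omega>|lebesgue. (g x \<bullet> i) * \<phi> x))"

text \<open>A weak gradient is unique up to a null set when it exists; the choice of a
  representative does not affect any of the integrals below.\<close>

definition weak_gradient ::
    "'a::euclidean_space set \<Rightarrow> ('a \<Rightarrow> real) \<Rightarrow> 'a \<Rightarrow> 'a" where
  "weak_gradient \<Omega> u = (SOME g. is_weak_gradient \<Omega> u g)"

definition W1p :: "'a::euclidean_space set \<Rightarrow> real \<Rightarrow> ('a \<Rightarrow> real) set" where
  "W1p \<Omega> p = {u. u \<in> L_p \<Omega> p \<and> (\<exists>g. is_weak_gradient \<Omega> u g \<and> g \<in> L_p \<Omega> p)}"

definition W1p_norm :: "'a::euclidean_space set \<Rightarrow> real \<Rightarrow> ('a \<Rightarrow> real) \<Rightarrow> real" where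
  "W1p_norm \<Omega> p u =
     ((LINT x:\<Omega>|lebesgue. \<bar>u x\<bar> powr p) +
      (LINT x:\<Omega>|lebesgue. norm (weak_gradient \<Omega> u x) powr p)) powr (1 / p)"

definition W1p_0 :: "'a::euclidean_space set \<Rightarrow> real \<Rightarrow> ('a \<Rightarrow> real) set" where
  "W1p_0 \<Omega> p = {u \<in> W1p \<Omega> p.
     \<exists>\<phi>. (\<forall>k. \<phi> k \<in> test_functions \<Omega>) \<and>
         (\<lambda>k. W1p_norm \<Omega> p (\<lambda>x. u x - \<phi> k x)) \<longlonglongrightarrow> 0}"

text \<open>The surface measure \<open>d\<sigma>\<close> of the sphere of radius \<open>\<rho>\<close> about the origin, as a Borel
  measure on the whole space concentrated on that sphere: the measure of a Borel subset of
  the sphere is \<open>n / \<rho>\<close> times the volume of the cone over it with apex \<open>0\<close>.\<close>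

definition sphere_measure :: "real \<Rightarrow> 'a::euclidean_space measure" where
  "sphere_measure \<rho> = scale_measure (ennreal (real DIM('a) / \<rho>))
     (distr (restrict_space lborel (ball 0 \<rho>)) borel (\<lambda>x. (\<rho> / norm x) *\<^sub>R x))"

text \<open>Trace on the sphere of radius \<open>\<rho>\<close>, which has to lie inside \<open>\<Omega>\<close>, of a function in
  \<open>W1p_0 \<Omega> p\<close>: the continuous extension, into \<open>L\<^sup>p\<close> of the sphere, of the restriction map
  on test functions. It is unique up to a null set of the sphere.\<close>

definition is_sphere_trace ::
    "'a::euclidean_space set \<Rightarrow> real \<Rightarrow> real \<Rightarrow> ('a \<Rightarrow> real) \<Rightarrow> ('a \<Rightarrow> real) \<Rightarrow> bool" where
  "is_sphere_trace \<Omega> p \<rho> u g \<longleftrightarrow>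
     g \<in> borel_measurable borel \<and>
     integrable (sphere_measure \<rho>) (\<lambda>x. \<bar>g x\<bar> powr p) \<and>
     (\<exists>\<phi>. (\<forall>k. \<phi> k \<in> test_functions \<Omega>) \<and>
          (\<lambda>k. W1p_norm \<Omega> p (\<lambda>x. u x - \<phi> k x)) \<longlonglongrightarrow> 0 \<and>
          (\<lambda>k. LINT x|sphere_measure \<rho>. \<bar>g x - \<phi> k x\<bar> powr p) \<longlonglongrightarrow> 0)"

definition sphere_trace ::
    "'a::euclidean_space set \<Rightarrow> real \<Rightarrow> real \<Rightarrow> ('a \<Rightarrow> real) \<Rightarrow> 'a \<Rightarrow> real" where
  "sphere_trace \<Omega> p \<rho> u = (SOME g. is_sphere_trace \<Omega> p \<rho> u g)"

definition exterior :: "real \<Rightarrow> 'a::euclidean_space set" where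
  "exterior r = UNIV - cball 0 r"

definition sphere_integral ::
    "real \<Rightarrow> real \<Rightarrow> real \<Rightarrow> ('a::euclidean_space \<Rightarrow> real) \<Rightarrow> real" where
  "sphere_integral p r \<rho> u =
     (LINT x|sphere_measure \<rho>. \<bar>sphere_trace (exterior r) p \<rho> u x\<bar> powr p)"

definition M_space :: "real \<Rightarrow> real \<Rightarrow> real \<Rightarrow> ('a::euclidean_space \<Rightarrow> real) set" where
  "M_space p m r = {u \<in> W1p_0 (exterior r) p.
     ((\<lambda>\<rho>. ((\<rho> powr m - r powr m) / m) powr (1 - p) * sphere_integral p r \<rho> u)
        \<longlongrightarrow> 0) (at_right r) \<and>
     ((\<lambda>R. R powr (1 - p) * sphere_integral p r R u) \<longlongrightarrow> 0) at_top}"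

definition K11_integrand ::
    "real \<Rightarrow> real \<Rightarrow> real \<Rightarrow> ('a::euclidean_space \<Rightarrow> real) \<Rightarrow> 'a \<Rightarrow> real" where
  "K11_integrand p m r u x =
     \<bar>u x\<bar> powr p /
       (norm x powr ((real DIM('a) - 1) * (p / (p - 1))) *
        \<bar>norm x powr m - r powr m\<bar> powr p)"

definition K12_integrand ::
    "real \<Rightarrow> ('a::euclidean_space \<Rightarrow> real) \<Rightarrow> 'a \<Rightarrow> real" where
  "K12_integrand p u x = \<bar>u x\<bar> powr p / norm x powr p"

definition K11 ::
    "real \<Rightarrow> real \<Rightarrow> real \<Rightarrow> real \<Rightarrow> ('a::euclidean_space \<Rightarrow> real) \<Rightarrow> real" where
  "K11 p m r \<gamma> u =
     \<bar>m\<bar> powr p * (LINT x:ball 0 \<gamma> - ball 0 r|lebesgue. K11_integrand p m r u x)"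

definition K12 :: "real \<Rightarrow> real \<Rightarrow> real \<Rightarrow> ('a::euclidean_space \<Rightarrow> real) \<Rightarrow> real" where
  "K12 p m \<gamma> u = \<bar>m\<bar> powr p * (LINT x:exterior \<gamma>|lebesgue. K12_integrand p u x)"

text \<open>This is both \<open>K\<^sub>0\<^sub>1\<close> and \<open>K\<^sub>0\<^sub>2\<close>.\<close>

definition K0 ::
    "real \<Rightarrow> real \<Rightarrow> real \<Rightarrow> real \<Rightarrow> ('a::euclidean_space \<Rightarrow> real) \<Rightarrow> real" where
  "K0 p m r \<gamma> u =
     \<bar>m\<bar> powr (p - 1) * \<gamma> powr (1 - p) * sphere_integral p r \<gamma> u"

definition hardy_summand :: "real \<Rightarrow> real \<Rightarrow> real \<Rightarrow> real" where
  "hardy_summand p k0 k1 =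
     (if k1 = 0 then 0 else (k0 + (p - 1) * k1) powr p / k1 powr (p - 1))"

definition hardy_lhs ::
    "real \<Rightarrow> real \<Rightarrow> ('a::euclidean_space \<Rightarrow> real) \<Rightarrow> real" where
  "hardy_lhs p r u =
     (LINT x:exterior r|lebesgue.
        \<bar>(x \<bullet> weak_gradient (exterior r) u x) / norm x\<bar> powr p)"

definition hardy_rhs ::
    "real \<Rightarrow> real \<Rightarrow> real \<Rightarrow> real \<Rightarrow> ('a::euclidean_space \<Rightarrow> real) \<Rightarrow> real" where
  "hardy_rhs p m r \<gamma> u =
     (1 / p) powr p *
       (hardy_summand p (K0 p m r \<gamma> u) (K11 p m r \<gamma> u) +
        hardy_summand p (K0 p m r \<gamma> u) (K12 p m \<gamma> u))"

text \<open>The values of \<open>u_beta\<close> in \<open>ball 0 r\<close>, which the second branch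
  supplies, are irrelevant; on \<open>sphere 0 \<gamma>\<close> both formulas agree for the value of \<open>\<gamma>\<close> used.\<close>

definition u_beta ::
    "real \<Rightarrow> real \<Rightarrow> real \<Rightarrow> real \<Rightarrow> 'a::euclidean_space \<Rightarrow> real" where
  "u_beta m r \<gamma> \<beta> x =
     (if x \<in> ball 0 \<gamma> - ball 0 r then (r powr m - norm x powr m) powr \<beta>
      else norm x powr (m * \<beta>))"

end

theory Submission
  imports Defs
begin

text \<open>
  Along a ray \<open>s \<omega>\<close> the radial integral \<open>\<integral> |v'|\<^sup>p s\<^bsup>n-1\<^esup> ds\<close> loses its weight in the variable \<open>\<tau>\<close>
  with \<open>|\<tau>'| = s\<^bsup>m-1\<^esup>\<close>, because \<open>(m - 1)(1 - p) = n - 1\<close>. The ray \<open>s > r\<close> becomes an interval of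
  length \<open>r\<^sup>m / |m|\<close>, whose midpoint corresponds to \<open>s = \<gamma>\<close>, and the two regions are its two halves, with
  \<open>\<tau>\<close> the distance to the nearer end point: \<open>(r\<^sup>m - s\<^sup>m) / |m|\<close> for \<open>s < \<gamma>\<close> and \<open>s\<^sup>m / |m|\<close> for
  \<open>s > \<gamma>\<close>. On each half the claim is the one-dimensional Hardy inequality with its boundary term: integrating
  the derivative of \<open>|v|\<^sup>p \<tau>\<^bsup>1-p\<^esup>\<close> and applying Young's inequality with a parameter \<open>c\<close> gives
  \<open>K\<^sub>0 + (p - 1) K\<^sub>1 \<le> c\<^bsup>1-p\<^esup> A + (p - 1) c K\<^sub>1\<close>, where \<open>A\<close> is the part of the left-hand side
  over that region (\<open>hardy_annulus\<close>, \<open>hardy_exterior\<close>, by way of the polar coordinates \<open>nn_integral_polar\<close>).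
  The best \<open>c\<close> turns this into \<open>(K\<^sub>0 + (p - 1) K\<^sub>1)\<^sup>p \<le> p\<^sup>p A K\<^sub>1\<^bsup>p-1\<^esup>\<close> (\<open>hardy_summand_le\<close>).

  The estimate, being linear in the three quantities, passes from test functions to their limits
  (\<open>hardy_limit\<close>). This needs control of three objects that the definitions only choose.
  Weak gradients are unique almost everywhere (\<open>is_weak_gradient_unique\<close>), so the Sobolev norm of
  \<open>u - \<phi>\<close> bounds the difference of the actual gradients. Traces exist and are unique, because the trace of
  \<open>u\<close> is minus the integral of its radial derivative along the outward ray
  (\<open>is_sphere_trace_ray_trace\<close>, \<open>sphere_trace_AE_eq_ray_trace\<close>). Finally the chosen trace comes with an
  approximating sequence of its own, along which the limit is taken.

  For \<open>u\<^sub>\<beta>\<close> the weak gradient is the classical one, since \<open>u\<^sub>\<beta>\<close> is locally Lipschitz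
  (\<open>is_weak_gradient_of_locally_lipschitz\<close>). In the variable \<open>\<tau>\<close> it is a multiple of \<open>\<tau>\<^sup>\<beta>\<close> on both halves;
  hence \<open>A = \<beta>\<^sup>p K\<^sub>1\<close> pointwise and \<open>K\<^sub>0 = (\<beta> p - p + 1) K\<^sub>1\<close>, and the two sides agree.
\<close>

section \<open>Smooth functions\<close>

lemma C_k_Suc_imp: "C_k (Suc k) f \<Longrightarrow> C_k k f"
proof (induction k arbitrary: f)
  case 0
  then show ?case by (simp add: differentiable_imp_continuous_on)
next
  case (Suc k)
  then show ?case by (metis C_k.simps(2))
qed

lemma C_k_zero: "C_k k (\<lambda>x::'a::euclidean_space. 0)"
  by (induction k) auto

lemma C_k_add: "C_k k f \<Longrightarrow> C_k k g \<Longrightarrow> C_k k (\<lambda>x. f x + g x)"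
proof (induction k arbitrary: f g)
  case 0
  then show ?case by (auto intro: continuous_intros)
next
  case (Suc k)
  then have d: "f differentiable (at x)" "g differentiable (at x)" for x
    by (auto simp: differentiable_on_def)
  have "frechet_derivative (\<lambda>x. f x + g x) (at x) i
      = frechet_derivative f (at x) i + frechet_derivative g (at x) i" for x i
    using frechet_derivative_at[OF has_derivative_add[OF d[THEN iffD1[OF frechet_derivative_works]]]]
    by metis
  with Suc show ?case by (auto intro: differentiable_on_add)
qed

lemma C_k_mult: "C_k k f \<Longrightarrow> C_k k g \<Longrightarrow> C_k k (\<lambda>x. f x * g x)"
proof (induction k arbitrary: f g)
  case 0
  then show ?case by (auto intro: continuous_intros)
next
  case (Suc k)
  then have d: "f differentiable (at x)" "g differentiable (at x)" for x
    by (auto simp: differentiable_on_def)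
  have fd: "frechet_derivative (\<lambda>x. f x * g x) (at x) i
      = f x * frechet_derivative g (at x) i + frechet_derivative f (at x) i * g x" for x i
    using frechet_derivative_at[OF has_derivative_mult[OF d[THEN iffD1[OF frechet_derivative_works]]]]
    by metis
  have "C_k k f" "C_k k g" using Suc.prems C_k_Suc_imp by blast+
  with Suc show ?case by (auto intro!: differentiable_on_mult C_k_add simp: fd)
qed

lemma C_k_const: "C_k k (\<lambda>x::'a::euclidean_space. c)"
  by (cases k) (auto simp: frechet_derivative_const C_k_zero)

lemma C_k_diff: "C_k k f \<Longrightarrow> C_k k g \<Longrightarrow> C_k k (\<lambda>x. f x - g x)"
  using C_k_add[of k f "\<lambda>x. -1 * g x"] C_k_mult[OF C_k_const[of k "-1"], of g] by simp

lemma C_k_prod: "finite I \<Longrightarrow> (\<And>i. i \<in> I \<Longrightarrow> C_k k (f i)) \<Longrightarrow> C_k k (\<lambda>x. \<Prod>i\<in>I. f i x)"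
  by (induction rule: finite_induct) (auto intro: C_k_const C_k_mult)

text \<open>The span of these functions is closed under differentiation, so that the smoothness of
  \<open>flat_exp 0\<close>, the standard flat function, needs no formula for its higher derivatives.\<close>

definition flat_exp :: "nat \<Rightarrow> real \<Rightarrow> real" where
  "flat_exp k t = (if t > 0 then (1 / t) ^ k * exp (- (1 / t)) else 0)"

lemma flat_exp_tendsto_0: "(flat_exp k \<longlongrightarrow> 0) (at 0)"
proof -
  have "((\<lambda>t. (inverse t) ^ k / exp (inverse t)) \<longlongrightarrow> (0::real)) (at_right 0)"
    by (rule filterlim_compose[OF tendsto_power_div_exp_0 filterlim_inverse_at_top_right])
  then have "(flat_exp k \<longlongrightarrow> 0) (at_right 0)"
    by (rule Lim_transform_eventually)
      (auto simp: flat_exp_def eventually_at_filter exp_minus field_simps)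
  moreover have "(flat_exp k \<longlongrightarrow> 0) (at_left 0)"
    by (rule Lim_transform_eventually[OF tendsto_const])
      (auto simp: flat_exp_def eventually_at_filter)
  ultimately show ?thesis using filterlim_at_split by blast
qed

lemma flat_exp_has_derivative:
  "(flat_exp k has_real_derivative (flat_exp (k + 2) t - k * flat_exp (k + 1) t)) (at t)"
proof -
  consider "t > 0" | "t = 0" | "t < 0" by linarith
  then show ?thesis
  proof cases
    case 1
    have "((\<lambda>t. (1 / t) ^ k * exp (- (1 / t))) has_real_derivative
        (flat_exp (k + 2) t - k * flat_exp (k + 1) t)) (at t)"
      using 1 by (auto intro!: derivative_eq_intros simp: flat_exp_def)
        (cases k; simp add: field_simps power2_eq_square)
    then show ?thesis
      by (rule DERIV_cong_ev[THEN iffD1, rotated -1, OF _ refl _ refl])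
        (use 1 in \<open>auto intro!: eventually_mono[OF eventually_gt_at_top] eventually_nhds_in_open[of "{0<..}", THEN eventually_mono] simp: flat_exp_def\<close>)
  next
    case 2
    have "((\<lambda>h. flat_exp (k + 1) h) \<longlongrightarrow> 0) (at 0)"
      by (rule flat_exp_tendsto_0)
    then have "((\<lambda>h. (flat_exp k (0 + h) - flat_exp k 0) / h) \<longlongrightarrow> 0) (at 0)"
      by (rule Lim_transform_eventually) (auto simp: flat_exp_def eventually_at_filter)
    then show ?thesis using 2 by (simp add: DERIV_def flat_exp_def)
  next
    case 3
    have "((\<lambda>t. 0) has_real_derivative (flat_exp (k + 2) t - k * flat_exp (k + 1) t)) (at t)"
      using 3 by (auto simp: flat_exp_def)
    then show ?thesis
      by (rule DERIV_cong_ev[THEN iffD1, rotated -1, OF _ refl _ refl])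
        (use 3 in \<open>auto intro!: eventually_nhds_in_open[of "{..<0}", THEN eventually_mono] simp: flat_exp_def\<close>)
  qed
qed

lemma C_k_flat_exp:
  fixes i :: "'a::euclidean_space"
  shows "C_k j (\<lambda>x. flat_exp k (c * (x \<bullet> i) + d))"
proof (induction j arbitrary: k)
  case 0
  have "isCont (flat_exp k) t" for t using flat_exp_has_derivative DERIV_isCont by blast
  then have "continuous_on UNIV (flat_exp k)" by (simp add: continuous_at_imp_continuous_on)
  then have "continuous_on UNIV (flat_exp k \<circ> (\<lambda>x::'a. c * (x \<bullet> i) + d))"
    by (intro continuous_on_compose) (auto intro!: continuous_intros intro: continuous_on_subset)
  then show ?case by (simp add: o_def)
next
  case (Suc j)
  have D: "((\<lambda>x::'a. flat_exp k (c * (x \<bullet> i) + d)) has_derivative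
      (\<lambda>h. (c * (h \<bullet> i)) * (flat_exp (k + 2) (c * (x \<bullet> i) + d) - k * flat_exp (k + 1) (c * (x \<bullet> i) + d)))) (at x)"
    for x :: 'a
  proof -
    have "((\<lambda>x::'a. c * (x \<bullet> i) + d) has_derivative (\<lambda>h. c * (h \<bullet> i))) (at x)"
      by (auto intro!: derivative_eq_intros)
    from DERIV_compose_FDERIV[OF flat_exp_has_derivative this] show ?thesis .
  qed
  have "frechet_derivative (\<lambda>x::'a. flat_exp k (c * (x \<bullet> i) + d)) (at x) h
      = (c * (h \<bullet> i)) * (flat_exp (k + 2) (c * (x \<bullet> i) + d) - k * flat_exp (k + 1) (c * (x \<bullet> i) + d))" for x h
    using frechet_derivative_at[OF D] by metis
  then show ?case
    using D Suc by (auto simp: differentiable_on_def differentiable_def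
        intro!: C_k_mult C_k_diff C_k_const)
qed

section \<open>Test functions\<close>

definition grad :: "('a::euclidean_space \<Rightarrow> real) \<Rightarrow> 'a \<Rightarrow> 'a" where
  "grad \<phi> x = (\<Sum>i\<in>Basis. frechet_derivative \<phi> (at x) i *\<^sub>R i)"

lemma test_functions_C_k: "\<phi> \<in> test_functions \<Omega> \<Longrightarrow> C_k k \<phi>"
  by (simp add: test_functions_def)

lemma test_functions_has_derivative:
  assumes "\<phi> \<in> test_functions \<Omega>"
  shows "(\<phi> has_derivative (\<lambda>h. grad \<phi> x \<bullet> h)) (at x)"
proof -
  have "\<phi> differentiable (at x)"
    using test_functions_C_k[OF assms, of 1] by (simp add: differentiable_on_def)
  then have D: "(\<phi> has_derivative frechet_derivative \<phi> (at x)) (at x)"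
    by (simp add: frechet_derivative_works)
  interpret linear "frechet_derivative \<phi> (at x)"
    using D has_derivative_linear by blast
  have "frechet_derivative \<phi> (at x) h = grad \<phi> x \<bullet> h" for h
  proof -
    have "frechet_derivative \<phi> (at x) h = frechet_derivative \<phi> (at x) (\<Sum>i\<in>Basis. (h \<bullet> i) *\<^sub>R i)"
      by (simp add: euclidean_representation)
    also have "\<dots> = grad \<phi> x \<bullet> h"
      by (simp add: sum scale grad_def inner_sum_left inner_commute[of h] mult.commute)
    finally show ?thesis .
  qed
  then have "frechet_derivative \<phi> (at x) = (\<lambda>h. grad \<phi> x \<bullet> h)" by auto
  with D show ?thesis by simp
qed

lemma test_functions_frechet_derivative:
  assumes "\<phi> \<in> test_functions \<Omega>"
  shows "frechet_derivative \<phi> (at x) h = grad \<phi> x \<bullet> h"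
  using frechet_derivative_at[OF test_functions_has_derivative[OF assms]] by metis

lemma test_functions_continuous: "\<phi> \<in> test_functions \<Omega> \<Longrightarrow> continuous_on UNIV \<phi>"
  using test_functions_C_k[of \<phi> \<Omega> 0] by simp

lemma test_functions_continuous_grad:
  assumes "\<phi> \<in> test_functions \<Omega>"
  shows "continuous_on UNIV (grad \<phi>)"
proof -
  have "C_k (Suc 0) \<phi>" by (rule test_functions_C_k[OF assms])
  then show ?thesis unfolding grad_def by (auto intro!: continuous_intros)
qed

lemma test_functions_measurable[measurable_dest]:
  "\<phi> \<in> test_functions \<Omega> \<Longrightarrow> \<phi> \<in> borel_measurable borel"
  "\<phi> \<in> test_functions \<Omega> \<Longrightarrow> grad \<phi> \<in> borel_measurable borel"
  by (rule borel_measurable_continuous_onI, erule test_functions_continuous test_functions_continuous_grad)+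

lemma test_functions_support:
  assumes "\<phi> \<in> test_functions \<Omega>"
  obtains K where "compact K" "K \<subseteq> \<Omega>" "\<And>x. x \<notin> K \<Longrightarrow> \<phi> x = 0" "\<And>x. x \<notin> K \<Longrightarrow> grad \<phi> x = 0"
proof -
  from assms obtain K where K: "compact K" "K \<subseteq> \<Omega>" "\<And>x. x \<notin> K \<Longrightarrow> \<phi> x = 0"
    by (auto simp: test_functions_def)
  have "grad \<phi> x = 0" if x: "x \<notin> K" for x
  proof -
    have "open (- K)" using K(1) by (simp add: compact_imp_closed open_Compl)
    then have "((\<lambda>x. 0) has_derivative (\<lambda>h. grad \<phi> x \<bullet> h)) (at x)"
      using has_derivative_transform_within_open[OF test_functions_has_derivative[OF assms, of x]] x K(3)
      by (metis ComplD ComplI)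
    then have "(\<lambda>h. grad \<phi> x \<bullet> h) = (\<lambda>h. 0)"
      using has_derivative_unique has_derivative_const by blast
    then show ?thesis by (metis inner_eq_zero_iff)
  qed
  with K that show ?thesis by blast
qed

lemma test_functions_diff:
  assumes "\<phi> \<in> test_functions \<Omega>" "\<psi> \<in> test_functions \<Omega>"
  shows "(\<lambda>x. \<phi> x - \<psi> x) \<in> test_functions \<Omega>" "grad (\<lambda>x. \<phi> x - \<psi> x) x = grad \<phi> x - grad \<psi> x"
proof -
  obtain K L where K: "compact K" "K \<subseteq> \<Omega>" "\<And>x. x \<notin> K \<Longrightarrow> \<phi> x = 0"
    and L: "compact L" "L \<subseteq> \<Omega>" "\<And>x. x \<notin> L \<Longrightarrow> \<psi> x = 0"
    using assms by (auto simp: test_functions_def)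
  have "compact (K \<union> L)" "K \<union> L \<subseteq> \<Omega>" "\<forall>x. x \<notin> K \<union> L \<longrightarrow> \<phi> x - \<psi> x = 0"
    using K L by auto
  moreover have "C_k k (\<lambda>x. \<phi> x - \<psi> x)" for k
    using assms[THEN test_functions_C_k] by (rule C_k_diff)
  ultimately show "(\<lambda>x. \<phi> x - \<psi> x) \<in> test_functions \<Omega>"
    unfolding test_functions_def by blast
  have "((\<lambda>x. \<phi> x - \<psi> x) has_derivative (\<lambda>h. grad \<phi> x \<bullet> h - grad \<psi> x \<bullet> h)) (at x)"
    using assms[THEN test_functions_has_derivative] by (rule has_derivative_diff)
  then have "frechet_derivative (\<lambda>x. \<phi> x - \<psi> x) (at x) = (\<lambda>h. grad \<phi> x \<bullet> h - grad \<psi> x \<bullet> h)"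
    by (rule frechet_derivative_at[symmetric])
  then show "grad (\<lambda>x. \<phi> x - \<psi> x) x = grad \<phi> x - grad \<psi> x"
    unfolding grad_def[of "\<lambda>x. \<phi> x - \<psi> x"]
    by (simp add: euclidean_representation flip: inner_diff_left)
qed

lemma bounded_on_compact:
  fixes f :: "'a::metric_space \<Rightarrow> 'b::real_normed_vector"
  assumes "continuous_on K f" "compact K"
  obtains B where "B \<ge> 0" "\<And>x. x \<in> K \<Longrightarrow> norm (f x) \<le> B"
proof -
  have "bounded (f ` K)" using assms compact_continuous_image compact_imp_bounded by blast
  then obtain B where "B > 0" "\<forall>y\<in>f ` K. norm y \<le> B" using bounded_pos by blast
  then show ?thesis using that[of B] by auto
qed

lemma test_functions_bounded:
  assumes "\<phi> \<in> test_functions \<Omega>"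
  obtains B where "B \<ge> 0" "\<And>x. \<bar>\<phi> x\<bar> \<le> B" "\<And>x. norm (grad \<phi> x) \<le> B"
proof -
  obtain K where K: "compact K" "\<And>x. x \<notin> K \<Longrightarrow> \<phi> x = 0" "\<And>x. x \<notin> K \<Longrightarrow> grad \<phi> x = 0"
    using test_functions_support[OF assms] by metis
  obtain B1 where B1: "B1 \<ge> 0" "\<And>x. x \<in> K \<Longrightarrow> norm (\<phi> x) \<le> B1"
    using bounded_on_compact[OF _ K(1), of \<phi>] test_functions_continuous[OF assms]
    by (metis continuous_on_subset subset_UNIV)
  obtain B2 where B2: "B2 \<ge> 0" "\<And>x. x \<in> K \<Longrightarrow> norm (grad \<phi> x) \<le> B2"
    using bounded_on_compact[OF _ K(1), of "grad \<phi>"] test_functions_continuous_grad[OF assms]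
    by (metis continuous_on_subset subset_UNIV)
  have "norm (\<phi> x) \<le> max B1 B2" "norm (grad \<phi> x) \<le> max B1 B2" for x
    by (cases "x \<in> K"; use B1 B2 K in \<open>force simp: max_def\<close>)+
  then show ?thesis using that[of "max B1 B2"] B1 by auto
qed

lemma test_functions_lipschitz:
  assumes "\<phi> \<in> test_functions \<Omega>"
  obtains L where "L-lipschitz_on UNIV \<phi>"
proof -
  obtain B where B: "B \<ge> 0" "\<And>x. norm (grad \<phi> x) \<le> B"
    using test_functions_bounded[OF assms] by metis
  have "B-lipschitz_on UNIV \<phi>"
  proof (rule bounded_derivative_imp_lipschitz)
    show "(\<phi> has_derivative (\<lambda>h. grad \<phi> x \<bullet> h)) (at x within UNIV)" for x
      using test_functions_has_derivative[OF assms] .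
    show "onorm (\<lambda>h. grad \<phi> x \<bullet> h) \<le> B" for x
    proof (rule onorm_le)
      fix h :: 'a
      have "\<bar>grad \<phi> x \<bullet> h\<bar> \<le> norm (grad \<phi> x) * norm h" by (rule Cauchy_Schwarz_ineq2)
      also have "\<dots> \<le> B * norm h" by (intro mult_right_mono B) auto
      finally show "norm (grad \<phi> x \<bullet> h) \<le> B * norm h" by simp
    qed
  qed (use B in auto)
  with that show ?thesis by blast
qed

text \<open>Increasing \<open>k\<close> makes these products converge boundedly to the indicator of the box.\<close>

definition box_bump :: "nat \<Rightarrow> 'a::euclidean_space \<Rightarrow> 'a \<Rightarrow> 'a \<Rightarrow> real" where
  "box_bump k a b x = (\<Prod>i\<in>Basis. flat_exp 0 (real k * (x \<bullet> i) + - (real k * (a \<bullet> i)))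
     * flat_exp 0 (- real k * (x \<bullet> i) + real k * (b \<bullet> i)))"

lemma flat_exp_0_bounds: "0 \<le> flat_exp 0 t" "flat_exp 0 t \<le> 1"
  by (auto simp: flat_exp_def)

lemma box_bump_bounds: "0 \<le> box_bump k a b x" "box_bump k a b x \<le> 1"
  unfolding box_bump_def
  by (auto intro!: prod_nonneg mult_nonneg_nonneg prod_le_1 mult_le_one flat_exp_0_bounds)

lemma box_bump_outside: "x \<notin> box a b \<Longrightarrow> box_bump k a b x = 0"
proof -
  assume "x \<notin> box a b"
  then obtain i where i: "i \<in> Basis" "x \<bullet> i \<le> a \<bullet> i \<or> b \<bullet> i \<le> x \<bullet> i"
    by (auto simp: mem_box not_less)
  then have "real k * (x \<bullet> i) \<le> real k * (a \<bullet> i) \<or> real k * (b \<bullet> i) \<le> real k * (x \<bullet> i)"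
    by (auto intro: mult_left_mono)
  then have "flat_exp 0 (real k * (x \<bullet> i) + - (real k * (a \<bullet> i)))
     * flat_exp 0 (- real k * (x \<bullet> i) + real k * (b \<bullet> i)) = 0"
    by (auto simp: flat_exp_def)
  with i show ?thesis unfolding box_bump_def by (auto intro!: prod_zero)
qed

lemma box_bump_tendsto: "(\<lambda>k. box_bump k a b x) \<longlonglongrightarrow> indicator (box a b) x"
proof (cases "x \<in> box a b")
  case True
  have *: "(\<lambda>k. flat_exp 0 (real k * t)) \<longlonglongrightarrow> 1" if "t > 0" for t
  proof -
    have "(\<lambda>k. exp (- (inverse t * inverse (real k)))) \<longlonglongrightarrow> exp (- (inverse t * 0))"
      by (intro tendsto_intros LIMSEQ_inverse_real_of_nat lim_inverse_n)
    then have "(\<lambda>k. exp (- (inverse t * inverse (real k)))) \<longlonglongrightarrow> 1" by simp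
    then show ?thesis
      by (rule Lim_transform_eventually)
        (use that in \<open>auto intro!: eventually_mono[OF eventually_gt_at_top[of 0]] simp: flat_exp_def field_simps\<close>)
  qed
  have "(\<lambda>k. box_bump k a b x) \<longlonglongrightarrow> (\<Prod>i\<in>(Basis::'a set). 1 * 1)"
    unfolding box_bump_def
  proof (intro tendsto_prod tendsto_mult)
    fix i :: 'a assume i: "i \<in> Basis"
    with True have "0 < x \<bullet> i - a \<bullet> i" "0 < b \<bullet> i - x \<bullet> i" by (auto simp: mem_box)
    from this[THEN *] show "(\<lambda>k. flat_exp 0 (real k * (x \<bullet> i) + - (real k * (a \<bullet> i)))) \<longlonglongrightarrow> 1"
      "(\<lambda>k. flat_exp 0 (- real k * (x \<bullet> i) + real k * (b \<bullet> i))) \<longlonglongrightarrow> 1"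
      by (simp_all add: algebra_simps)
  qed
  with True show ?thesis by simp
qed (simp add: box_bump_outside)

lemma box_bump_test_function:
  assumes "cbox a b \<subseteq> \<Omega>"
  shows "box_bump k a b \<in> test_functions \<Omega>"
proof -
  have "C_k j (box_bump k a b)" for j
    unfolding box_bump_def[abs_def] by (intro C_k_prod C_k_mult C_k_flat_exp finite_Basis)
  moreover have "box_bump k a b x = 0" if "x \<notin> cbox a b" for x
    using that box_subset_cbox box_bump_outside by blast
  ultimately show ?thesis
    using assms unfolding test_functions_def by (intro CollectI conjI allI exI[of _ "cbox a b"]) auto
qed

section \<open>Uniqueness of the weak gradient\<close>

text \<open>The positive and the negative part of \<open>f\<close> are the densities of two finite measures that agree on
  boxes, and boxes form an intersection-stable generator of the Borel sets.\<close>

lemma AE_zero_if_box_integrals_zero: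
  fixes f :: "'a::euclidean_space \<Rightarrow> real"
  assumes f: "integrable lborel f" and box: "\<And>c d. (LINT x:box c d|lborel. f x) = 0"
  shows "AE x in lborel. f x = 0"
proof -
  have [measurable]: "f \<in> borel_measurable borel" using f by auto
  let ?E = "range (\<lambda>(a, b). box a b::'a set)"
  have enn2real_inj: "a = b" if "enn2real a = enn2real b" "a \<noteq> \<infinity>" "b \<noteq> \<infinity>" for a b
    using that by (cases a; cases b) (auto simp: enn2real_ennreal)
  have fin: "(\<integral>\<^sup>+x. ennreal (g x) \<partial>lborel) \<noteq> \<infinity>" if "integrable lborel g" for g :: "'a \<Rightarrow> real"
  proof -
    have "(\<integral>\<^sup>+x. ennreal (g x) \<partial>lborel) \<le> (\<integral>\<^sup>+x. ennreal (norm (g x)) \<partial>lborel)"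
      by (intro nn_integral_mono ennreal_leI) auto
    with that show ?thesis by (auto simp: integrable_iff_bounded top_unique)
  qed
  have eq: "emeasure (density lborel f) (box c d) = emeasure (density lborel (\<lambda>x. - f x)) (box c d)"
    and fin': "emeasure (density lborel f) (box c d) \<noteq> \<infinity>" for c d
  proof -
    let ?g = "\<lambda>x. indicator (box c d) x * f x"
    have g: "integrable lborel ?g" "integrable lborel (\<lambda>x. - ?g x)"
      using integrable_mult_indicator[OF _ f, of "box c d"] by auto
    have "integral\<^sup>L lborel ?g = 0"
      using box[of c d] by (simp add: set_lebesgue_integral_def)
    then have "enn2real (\<integral>\<^sup>+x. ennreal (?g x) \<partial>lborel) = enn2real (\<integral>\<^sup>+x. ennreal (- ?g x) \<partial>lborel)"
      using real_lebesgue_integral_def[OF g(1)] by simp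
    then have "(\<integral>\<^sup>+x. ennreal (?g x) \<partial>lborel) = (\<integral>\<^sup>+x. ennreal (- ?g x) \<partial>lborel)"
      using fin[OF g(1)] fin[OF g(2)] by (intro enn2real_inj) auto
    moreover have "(\<lambda>x. ennreal (?g x)) = (\<lambda>x. ennreal (f x) * indicator (box c d) x)"
      "(\<lambda>x. ennreal (- ?g x)) = (\<lambda>x. ennreal (- f x) * indicator (box c d) x)"
      by (auto simp: indicator_def)
    ultimately show "emeasure (density lborel f) (box c d) = emeasure (density lborel (\<lambda>x. - f x)) (box c d)"
      "emeasure (density lborel f) (box c d) \<noteq> \<infinity>"
      using fin[OF g(1)] by (simp_all add: emeasure_density)
  qed
  \<comment> \<open>\<open>ennreal\<close> sends negative numbers to \<open>0\<close>, so these densities are the positive and the negative part\<close>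
  have "density lborel f = density lborel (\<lambda>x. - f x)"
  proof (rule measure_eqI_generator_eq[where E = ?E and \<Omega> = UNIV
        and A = "\<lambda>n::nat. box (- (real n *\<^sub>R One)) (real n *\<^sub>R One)"])
    show "Int_stable ?E" by (auto simp: Int_stable_def box_Int_box)
    show "?E \<subseteq> Pow UNIV" "sets (density lborel f) = sigma_sets UNIV ?E"
      "sets (density lborel (\<lambda>x. - f x)) = sigma_sets UNIV ?E"
      by (simp_all add: borel_eq_box)
  qed (use eq fin' UN_box_eq_UNIV in auto)
  then have "AE x in lborel. ennreal (f x) = ennreal (- f x)"
    by (intro sigma_finite_lborel[THEN sigma_finite_measure.density_unique]) auto
  then show ?thesis
  proof eventually_elim
    case (elim x)
    show ?case
    proof (cases "f x \<ge> 0")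
      case True
      with elim have "ennreal (f x) = 0" by (simp add: ennreal_neg)
      with True show ?thesis by (simp add: ennreal_eq_0_iff)
    next
      case False
      with elim have "ennreal (- f x) = 0" by (simp add: ennreal_neg)
      with False show ?thesis by (simp add: ennreal_eq_0_iff)
    qed
  qed
qed

lemma indicator_lebesgue_measurable:
  "S \<in> sets borel \<Longrightarrow> indicat_real S \<in> borel_measurable lebesgue"
  by (rule measurable_completion) simp

lemma locally_integrable_times_test:
  fixes f :: "'a::euclidean_space \<Rightarrow> real"
  assumes f: "locally_integrable_on f \<Omega>" and \<psi>: "\<psi> \<in> borel_measurable borel" "\<And>x. \<bar>\<psi> x\<bar> \<le> B"
    and K: "compact K" "K \<subseteq> \<Omega>" "\<And>x. x \<notin> K \<Longrightarrow> \<psi> x = 0"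
  shows "set_integrable lebesgue \<Omega> (\<lambda>x. f x * \<psi> x)"
proof -
  have i: "integrable lebesgue (\<lambda>x. indicator K x *\<^sub>R f x)"
    using f K unfolding locally_integrable_on_def set_integrable_def by auto
  have [measurable]: "\<psi> \<in> borel_measurable lebesgue" using \<psi>(1) by (simp add: measurable_completion)
  have eq: "(\<lambda>x. indicator \<Omega> x *\<^sub>R (f x * \<psi> x)) = (\<lambda>x. (indicator K x *\<^sub>R f x) * \<psi> x)"
    using K by (auto simp: indicator_def fun_eq_iff)
  have [measurable]: "(\<lambda>x. indicator K x *\<^sub>R f x) \<in> borel_measurable lebesgue" using i by auto
  have "integrable lebesgue (\<lambda>x. (indicator K x *\<^sub>R f x) * \<psi> x)"
  proof (rule Bochner_Integration.integrable_bound)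
    show "integrable lebesgue (\<lambda>x. B * (indicator K x *\<^sub>R f x))"
      using i by (rule integrable_mult_right)
    show "(\<lambda>x. (indicator K x *\<^sub>R f x) * \<psi> x) \<in> borel_measurable lebesgue" by measurable
    show "AE x in lebesgue. norm (indicator K x *\<^sub>R f x * \<psi> x) \<le> norm (B * indicator K x *\<^sub>R f x)"
    proof (intro AE_I2)
      fix x
      have "\<bar>\<psi> x\<bar> \<le> \<bar>B\<bar>" using \<psi>(2)[of x] by linarith
      then show "norm (indicator K x *\<^sub>R f x * \<psi> x) \<le> norm (B * indicator K x *\<^sub>R f x)"
        by (auto simp: abs_mult indicator_def mult.commute[of "\<bar>f x\<bar>"] intro!: mult_right_mono)
    qed
  qed
  then show ?thesis unfolding set_integrable_def eq .
qed

lemma box_integral_zero_of_test: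
  fixes h :: "'a::euclidean_space \<Rightarrow> real"
  assumes h: "locally_integrable_on h \<Omega>"
    and 0: "\<And>\<psi>. \<psi> \<in> test_functions \<Omega> \<Longrightarrow> (LINT x:\<Omega>|lebesgue. h x * \<psi> x) = 0"
    and c: "cbox a b \<subseteq> \<Omega>"
  shows "(LINT x:box a b|lebesgue. h x) = 0"
proof -
  have i: "integrable lebesgue (\<lambda>x. indicator (cbox a b) x *\<^sub>R h x)"
    using h c unfolding locally_integrable_on_def set_integrable_def by auto
  have bm[measurable]: "box_bump k a b \<in> borel_measurable lebesgue" for k
    using test_functions_measurable(1)[OF box_bump_test_function[OF c]] by (simp add: measurable_completion)
  have [measurable]: "(\<lambda>x. indicator (cbox a b) x *\<^sub>R h x) \<in> borel_measurable lebesgue" using i by auto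
  have "(\<lambda>k. LINT x|lebesgue. (indicator (cbox a b) x *\<^sub>R h x) * box_bump k a b x)
      \<longlonglongrightarrow> (LINT x|lebesgue. (indicator (cbox a b) x *\<^sub>R h x) * indicator (box a b) x)"
  proof (rule integral_dominated_convergence)
    show "integrable lebesgue (\<lambda>x. norm (indicator (cbox a b) x *\<^sub>R h x))"
      using i by (rule integrable_norm)
    show "AE x in lebesgue. (\<lambda>k. (indicator (cbox a b) x *\<^sub>R h x) * box_bump k a b x)
      \<longlonglongrightarrow> (indicator (cbox a b) x *\<^sub>R h x) * indicator (box a b) x"
      by (intro AE_I2 tendsto_intros box_bump_tendsto)
    show "AE x in lebesgue. norm ((indicator (cbox a b) x *\<^sub>R h x) * box_bump k a b x)
      \<le> norm (indicator (cbox a b) x *\<^sub>R h x)" for k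
      using box_bump_bounds[of k a b] by (intro AE_I2) (auto simp: abs_mult intro!: mult_left_le)
    have "indicat_real (box a b) \<in> borel_measurable lebesgue" by (rule indicator_lebesgue_measurable) simp
    then show "(\<lambda>x. (indicator (cbox a b) x *\<^sub>R h x) * indicator (box a b) x) \<in> borel_measurable lebesgue"
      by (intro borel_measurable_times borel_measurable_integrable[OF i])
    show "(\<lambda>x. (indicator (cbox a b) x *\<^sub>R h x) * box_bump k a b x) \<in> borel_measurable lebesgue" for k
      using bm by (intro borel_measurable_times borel_measurable_integrable[OF i])
  qed
  moreover have "(LINT x|lebesgue. (indicator (cbox a b) x *\<^sub>R h x) * box_bump k a b x) = 0" for k
  proof -
    have "(\<lambda>x. (indicator (cbox a b) x *\<^sub>R h x) * box_bump k a b x)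
      = (\<lambda>x. indicator \<Omega> x *\<^sub>R (h x * box_bump k a b x))"
      using c box_bump_outside[of _ a b k] box_subset_cbox[of a b] by (fastforce simp: indicator_def)
    then show ?thesis
      using 0[OF box_bump_test_function[OF c, of k]] by (simp add: set_lebesgue_integral_def)
  qed
  ultimately have "(LINT x|lebesgue. (indicator (cbox a b) x *\<^sub>R h x) * indicator (box a b) x) = 0"
    by (simp add: LIMSEQ_const_iff)
  moreover have "(\<lambda>x. (indicator (cbox a b) x *\<^sub>R h x) * indicator (box a b) x) = (\<lambda>x. indicator (box a b) x *\<^sub>R h x)"
    using box_subset_cbox[of a b] by (auto simp: indicator_def fun_eq_iff)
  ultimately show ?thesis by (simp add: set_lebesgue_integral_def)
qed

text \<open>The fundamental lemma of the calculus of variations: by \<open>box_integral_zero_of_test\<close> the function has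
  integral zero over all boxes inside \<open>\<Omega>\<close>, and countably many boxes cover \<open>\<Omega>\<close>.\<close>

lemma AE_zero_if_test_integrals_zero:
  fixes h :: "'a::euclidean_space \<Rightarrow> real"
  assumes \<Omega>: "open \<Omega>" and h: "locally_integrable_on h \<Omega>"
    and 0: "\<And>\<psi>. \<psi> \<in> test_functions \<Omega> \<Longrightarrow> (LINT x:\<Omega>|lebesgue. h x * \<psi> x) = 0"
  shows "AE x in lebesgue. x \<in> \<Omega> \<longrightarrow> h x = 0"
proof -
  have *: "AE x in lebesgue. x \<in> cbox a b \<longrightarrow> h x = 0" if c: "cbox a b \<subseteq> \<Omega>" for a b
  proof -
    let ?k = "\<lambda>x. indicator (box a b) x *\<^sub>R h x"
    have "set_integrable lebesgue (cbox a b) h"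
      using h c unfolding locally_integrable_on_def by auto
    then have k: "integrable lebesgue ?k"
      using set_integrable_subset[of lebesgue "cbox a b" h "box a b"] box_subset_cbox[of a b]
      unfolding set_integrable_def by auto
    then have "?k \<in> borel_measurable lebesgue" by auto
    then obtain k' where k'[measurable]: "k' \<in> borel_measurable lborel" "AE x in lborel. ?k x = k' x"
      using completion_ex_borel_measurable_real by blast
    then have ae: "AE x in lebesgue. ?k x = k' x" by (simp add: AE_completion)
    have k'l[measurable]: "k' \<in> borel_measurable lebesgue" using k'(1) by (simp add: measurable_completion)
    have "integrable lebesgue k'"
      using k integrable_cong_AE[OF borel_measurable_integrable[OF k] k'l ae] by blast
    then have k'i: "integrable lborel k'" using k'(1) by (simp add: integrable_completion)
    have "AE x in lborel. k' x = 0"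
    proof (rule AE_zero_if_box_integrals_zero[OF k'i])
      fix c d :: 'a
      obtain e f where ef: "box c d \<inter> box a b = box e f" by (auto simp: box_Int_box)
      have "(LINT x:box c d|lborel. k' x) = (LINT x|lebesgue. indicator (box c d) x *\<^sub>R k' x)"
        unfolding set_lebesgue_integral_def by (rule integral_completion[symmetric]) measurable
      also have "\<dots> = (LINT x|lebesgue. indicator (box c d) x *\<^sub>R ?k x)"
        using ae k k'l
        by (intro integral_cong_AE borel_measurable_scaleR indicator_lebesgue_measurable borel_measurable_integrable[OF k]) auto
      also have "\<dots> = (LINT x:box e f|lebesgue. h x)"
        unfolding set_lebesgue_integral_def ef[symmetric]
        by (intro Bochner_Integration.integral_cong) (auto simp: indicator_def)
      also have "\<dots> = 0"
      proof (cases "box e f = {}")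
        case False
        then have "cbox e f = closure (box e f)" by simp
        also have "\<dots> \<subseteq> cbox a b"
          using ef box_subset_cbox[of a b] by (intro closure_minimal) auto
        finally show ?thesis using box_integral_zero_of_test[OF h 0] c by blast
      qed (simp add: set_lebesgue_integral_def)
      finally show "(LINT x:box c d|lborel. k' x) = 0" .
    qed
    then have "AE x in lebesgue. k' x = 0" by (rule AE_completion)
    moreover have "AE x in lebesgue. x \<notin> cbox a b - box a b"
      using negligible_frontier_interval[of a b] by (intro AE_not_in) (simp add: negligible_iff_null_sets)
    ultimately show ?thesis using ae by eventually_elim (auto simp: indicator_def)
  qed
  obtain \<D> where D: "countable \<D>" "\<D> \<subseteq> Pow \<Omega>" "\<And>X. X \<in> \<D> \<Longrightarrow> \<exists>a b. X = cbox a b" "\<Union>\<D> = \<Omega>"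
    using open_countable_Union_open_cbox[OF \<Omega>] by blast
  have "AE x in lebesgue. \<forall>X\<in>\<D>. x \<in> X \<longrightarrow> h x = 0"
  proof (subst AE_ball_countable[OF D(1)], intro ballI)
    fix X assume "X \<in> \<D>"
    with D obtain a b where "X = cbox a b" "cbox a b \<subseteq> \<Omega>" by blast
    with * show "AE x in lebesgue. x \<in> X \<longrightarrow> h x = 0" by simp
  qed
  then show ?thesis by eventually_elim (use D(4) in blast)
qed

lemma locally_integrable_inner:
  assumes "locally_integrable_on g \<Omega>"
  shows "locally_integrable_on (\<lambda>x. g x \<bullet> i) \<Omega>"
  unfolding locally_integrable_on_def
proof (intro allI impI)
  fix K assume "compact K \<and> K \<subseteq> \<Omega>"
  then have "integrable lebesgue (\<lambda>x. indicator K x *\<^sub>R g x)"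
    using assms by (auto simp: locally_integrable_on_def set_integrable_def)
  from integrable_inner_left[OF this, of i]
  show "(\<lambda>x. g x \<bullet> i) absolutely_integrable_on K" by (auto simp: set_integrable_def)
qed

lemma locally_integrable_diff:
  "locally_integrable_on f \<Omega> \<Longrightarrow> locally_integrable_on g \<Omega> \<Longrightarrow> locally_integrable_on (\<lambda>x. f x - g x) \<Omega>"
  unfolding locally_integrable_on_def by (auto intro: set_integral_diff(1))

lemma set_integrable_weak_gradient_times_test:
  assumes "locally_integrable_on f \<Omega>" "locally_integrable_on g \<Omega>" "\<phi> \<in> test_functions \<Omega>" "i \<in> Basis"
  shows "set_integrable lebesgue \<Omega> (\<lambda>x. f x * (grad \<phi> x \<bullet> i))"
    "set_integrable lebesgue \<Omega> (\<lambda>x. (g x \<bullet> i) * \<phi> x)"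
proof -
  obtain K where K: "compact K" "K \<subseteq> \<Omega>" "\<And>x. x \<notin> K \<Longrightarrow> \<phi> x = 0" "\<And>x. x \<notin> K \<Longrightarrow> grad \<phi> x = 0"
    using test_functions_support[OF assms(3)] by metis
  obtain B where B: "\<And>x. \<bar>\<phi> x\<bar> \<le> B" "\<And>x. norm (grad \<phi> x) \<le> B"
    using test_functions_bounded[OF assms(3)] by metis
  have [measurable]: "\<phi> \<in> borel_measurable borel" "grad \<phi> \<in> borel_measurable borel"
    using test_functions_measurable[OF assms(3)] by auto
  have "\<bar>grad \<phi> x \<bullet> i\<bar> \<le> B" for x
    using B(2)[of x] Basis_le_norm[OF assms(4), of "grad \<phi> x"] by linarith
  then show "set_integrable lebesgue \<Omega> (\<lambda>x. f x * (grad \<phi> x \<bullet> i))"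
    using K by (intro locally_integrable_times_test[OF assms(1) _ _ K(1)]) auto
  show "set_integrable lebesgue \<Omega> (\<lambda>x. (g x \<bullet> i) * \<phi> x)"
    using K B by (intro locally_integrable_times_test[OF locally_integrable_inner[OF assms(2)] _ _ K(1)]) auto
qed

lemma is_weak_gradient_unique:
  fixes g h :: "'a::euclidean_space \<Rightarrow> 'a"
  assumes \<Omega>: "open \<Omega>" and g: "is_weak_gradient \<Omega> u g" and h: "is_weak_gradient \<Omega> u h"
  shows "AE x in lebesgue. x \<in> \<Omega> \<longrightarrow> g x = h x"
proof -
  have "AE x in lebesgue. x \<in> \<Omega> \<longrightarrow> (g x - h x) \<bullet> i = 0" if i: "i \<in> Basis" for i
  proof (rule AE_zero_if_test_integrals_zero[OF \<Omega>])
    have l: "locally_integrable_on u \<Omega>" "locally_integrable_on g \<Omega>" "locally_integrable_on h \<Omega>"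
      using g h by (auto simp: is_weak_gradient_def)
    show "locally_integrable_on (\<lambda>x. (g x - h x) \<bullet> i) \<Omega>"
      by (intro locally_integrable_inner locally_integrable_diff l)
    fix \<psi> assume \<psi>: "\<psi> \<in> test_functions \<Omega>"
    have "(LINT x:\<Omega>|lebesgue. (g x - h x) \<bullet> i * \<psi> x)
      = (LINT x:\<Omega>|lebesgue. (g x \<bullet> i) * \<psi> x) - (LINT x:\<Omega>|lebesgue. (h x \<bullet> i) * \<psi> x)"
      using set_integrable_weak_gradient_times_test[OF l(1) l(2) \<psi> i] set_integrable_weak_gradient_times_test[OF l(1) l(3) \<psi> i]
      by (simp add: inner_diff_left left_diff_distrib set_integral_diff)
    also have "\<dots> = 0"
    proof -
      have "(LINT x:\<Omega>|lebesgue. u x * frechet_derivative \<psi> (at x) i) = - (LINT x:\<Omega>|lebesgue. (g x \<bullet> i) * \<psi> x)"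
        "(LINT x:\<Omega>|lebesgue. u x * frechet_derivative \<psi> (at x) i) = - (LINT x:\<Omega>|lebesgue. (h x \<bullet> i) * \<psi> x)"
        using g h \<psi> i by (auto simp: is_weak_gradient_def)
      then show ?thesis by linarith
    qed
    finally show "(LINT x:\<Omega>|lebesgue. (g x - h x) \<bullet> i * \<psi> x) = 0" .
  qed
  then have "AE x in lebesgue. \<forall>i\<in>Basis. x \<in> \<Omega> \<longrightarrow> (g x - h x) \<bullet> i = 0"
    by (subst AE_ball_countable) (auto intro: countable_finite)
  then show ?thesis
    by eventually_elim (metis euclidean_all_zero_iff eq_iff_diff_eq_0)
qed

text \<open>This lemma gives access to \<open>weak_gradient\<close>, hence to \<open>W1p_norm\<close> and to \<open>hardy_lhs\<close>: any weak
  gradient that can be written down computes them.\<close>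

lemma weak_gradient_AE_eq:
  assumes "open \<Omega>" "is_weak_gradient \<Omega> u g"
  shows "AE x in lebesgue. x \<in> \<Omega> \<longrightarrow> weak_gradient \<Omega> u x = g x"
  by (rule is_weak_gradient_unique[OF assms(1) _ assms(2)])
    (unfold weak_gradient_def, rule someI[of _ g], rule assms)

lemma is_weak_gradient_diff:
  assumes u: "is_weak_gradient \<Omega> u g" and v: "is_weak_gradient \<Omega> v h"
  shows "is_weak_gradient \<Omega> (\<lambda>x. u x - v x) (\<lambda>x. g x - h x)"
  unfolding is_weak_gradient_def
proof (intro conjI ballI)
  have l: "locally_integrable_on u \<Omega>" "locally_integrable_on g \<Omega>" "locally_integrable_on v \<Omega>" "locally_integrable_on h \<Omega>"
    using u v by (auto simp: is_weak_gradient_def)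
  then show "locally_integrable_on (\<lambda>x. u x - v x) \<Omega>" "locally_integrable_on (\<lambda>x. g x - h x) \<Omega>"
    by (auto intro: locally_integrable_diff)
  fix \<psi> :: "'a \<Rightarrow> real" and i :: 'a assume \<psi>: "\<psi> \<in> test_functions \<Omega>" and i: "i \<in> Basis"
  have "(LINT x:\<Omega>|lebesgue. u x * frechet_derivative \<psi> (at x) i) = - (LINT x:\<Omega>|lebesgue. (g x \<bullet> i) * \<psi> x)"
    "(LINT x:\<Omega>|lebesgue. v x * frechet_derivative \<psi> (at x) i) = - (LINT x:\<Omega>|lebesgue. (h x \<bullet> i) * \<psi> x)"
    using u v \<psi> i by (auto simp: is_weak_gradient_def)
  then show "(LINT x:\<Omega>|lebesgue. (u x - v x) * frechet_derivative \<psi> (at x) i) =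
        - (LINT x:\<Omega>|lebesgue. ((g x - h x) \<bullet> i) * \<psi> x)"
    using set_integrable_weak_gradient_times_test[OF l(1,2) \<psi> i] set_integrable_weak_gradient_times_test[OF l(3,4) \<psi> i]
    by (simp add: test_functions_frechet_derivative[OF \<psi>] left_diff_distrib inner_diff_left set_integral_diff)
qed

section \<open>Weak gradients of locally Lipschitz functions\<close>

lemma integrable_on_compact_support:
  fixes f :: "'a::euclidean_space \<Rightarrow> 'b::euclidean_space"
  assumes "compact K" "f \<in> borel_measurable borel" "\<And>x. x \<notin> K \<Longrightarrow> f x = 0" "\<And>x. x \<in> K \<Longrightarrow> norm (f x) \<le> B"
  shows "integrable lborel f"
  using assms
  by (intro integrableI_bounded_set[of K _ _ B] emeasure_compact_finite) (auto simp: compact_imp_closed)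

text \<open>The difference quotients of \<open>F\<close> have integral zero by translation invariance, and they
  converge boundedly to the directional derivative.\<close>

lemma integral_directional_derivative_zero:
  fixes F :: "'a::euclidean_space \<Rightarrow> real"
  assumes \<Omega>: "open \<Omega>" and K: "compact K" "K \<subseteq> \<Omega>" "\<And>x. x \<notin> K \<Longrightarrow> F x = 0" "\<And>x. x \<notin> K \<Longrightarrow> g x = 0"
    and lip: "\<And>C. compact C \<Longrightarrow> C \<subseteq> \<Omega> \<Longrightarrow> \<exists>L. L-lipschitz_on C F"
    and g: "g \<in> borel_measurable borel"
    and D: "AE x in lborel. x \<in> \<Omega> \<longrightarrow> (F has_derivative (\<lambda>h. g x \<bullet> h)) (at x)"
    and i: "norm i = 1"
  shows "(LINT x|lborel. g x \<bullet> i) = 0"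
proof -
  obtain e where e: "e > 0" "(\<Union>x\<in>K. cball x e) \<subseteq> \<Omega>"
    using compact_subset_open_imp_cball_epsilon_subset[OF K(1) \<Omega> K(2)] by blast
  define C where "C = (\<Union>x\<in>K. cball x e)"
  have C: "compact C" "K \<subseteq> C" "C \<subseteq> \<Omega>"
    using compact_minkowski_sum_cball[OF K(1)] e by (auto simp: C_def)
  then obtain L where L: "L-lipschitz_on C F" using lip by blast
  have L0: "L \<ge> 0" using L lipschitz_on_nonneg by blast
  have cont: "continuous_on C F" using L by (rule lipschitz_on_continuous_on)
  have F[measurable]: "F \<in> borel_measurable borel"
  proof -
    have "(\<lambda>x. indicator C x *\<^sub>R F x) \<in> borel_measurable borel"
      using cont C by (intro borel_measurable_continuous_on_indicator) (auto simp: compact_imp_closed)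
    moreover have "(\<lambda>x. indicator C x *\<^sub>R F x) = F" using K C by (auto simp: indicator_def fun_eq_iff)
    ultimately show ?thesis by simp
  qed
  obtain B where B: "\<And>x. x \<in> C \<Longrightarrow> norm (F x) \<le> B" using bounded_on_compact[OF cont C(1)] by blast
  have intF: "integrable lborel F"
    by (rule integrable_on_compact_support[OF C(1) F _ B]) (use K C in auto)
  \<comment> \<open>steps small enough that a translate of a point of \<open>K\<close> stays in \<open>C\<close>\<close>
  define h where "h k = e / real (Suc k)" for k
  have h: "h k > 0" "h k \<le> e" for k using e by (auto simp: h_def field_simps)
  have h0: "h \<longlonglongrightarrow> 0"
    unfolding h_def using LIMSEQ_inverse_real_of_nat[THEN tendsto_mult_left, of e] by (simp add: field_simps)
  define Q where "Q k x = (F (x + h k *\<^sub>R i) - F x) / h k" for k x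
  have C1: "x \<in> C" "x + h k *\<^sub>R i \<in> C" if "Q k x \<noteq> 0" for k x
  proof -
    have "dist x (x + h k *\<^sub>R i) \<le> e" using h[of k] i by (simp add: dist_norm)
    moreover have "F (x + h k *\<^sub>R i) \<noteq> 0 \<or> F x \<noteq> 0" using that by (auto simp: Q_def)
    then have "x \<in> K \<or> x + h k *\<^sub>R i \<in> K" using K(3) by blast
    ultimately show "x \<in> C" "x + h k *\<^sub>R i \<in> C"
      using \<open>e > 0\<close> by (auto simp: C_def dist_commute intro: bexI[of _ x] bexI[of _ "x + h k *\<^sub>R i"])
  qed
  have "(\<lambda>k. LINT x|lborel. Q k x) \<longlonglongrightarrow> (LINT x|lborel. g x \<bullet> i)"
  proof (rule integral_dominated_convergence)
    show "(\<lambda>x. g x \<bullet> i) \<in> borel_measurable lborel" using g by simp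
    show "Q k \<in> borel_measurable lborel" for k unfolding Q_def by measurable
    show "integrable lborel (\<lambda>x. indicator C x * L)"
      using C(1) by (intro integrable_mult_left integrable_real_indicator emeasure_compact_finite)
        (auto simp: compact_imp_closed)
    show "AE x in lborel. norm (Q k x) \<le> indicator C x * L" for k
    proof (intro AE_I2)
      fix x
      show "norm (Q k x) \<le> indicator C x * L"
      proof (cases "Q k x = 0")
        case False
        then have "dist (F (x + h k *\<^sub>R i)) (F x) \<le> L * dist (x + h k *\<^sub>R i) x"
          by (intro lipschitz_onD[OF L] C1)
        then have "\<bar>F (x + h k *\<^sub>R i) - F x\<bar> \<le> L * h k"
          using h[of k] i by (simp add: dist_norm)
        then have "norm (Q k x) \<le> L" using h[of k] by (simp add: Q_def field_simps)
        with C1[OF False] show ?thesis by simp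
      qed (use L0 in auto)
    qed
    show "AE x in lborel. (\<lambda>k. Q k x) \<longlonglongrightarrow> g x \<bullet> i"
      using D
    proof eventually_elim
      case (elim x)
      show ?case
      proof (cases "x \<in> \<Omega>")
        case True
        with elim have "(F has_derivative (\<lambda>h. g x \<bullet> h)) (at (x + 0 *\<^sub>R i))" by simp
        moreover have "((\<lambda>t. x + t *\<^sub>R i) has_derivative (\<lambda>t. t *\<^sub>R i)) (at 0)"
          by (auto intro!: derivative_eq_intros)
        ultimately have "((F \<circ> (\<lambda>t. x + t *\<^sub>R i)) has_derivative ((\<lambda>h. g x \<bullet> h) \<circ> (\<lambda>t. t *\<^sub>R i))) (at 0)"
          by (intro diff_chain_at) auto
        moreover have "(F \<circ> (\<lambda>t. x + t *\<^sub>R i)) = (\<lambda>t. F (x + t *\<^sub>R i))"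
          "((\<lambda>h. g x \<bullet> h) \<circ> (\<lambda>t. t *\<^sub>R i)) = (*) (g x \<bullet> i)"
          by (auto simp: fun_eq_iff)
        ultimately have "((\<lambda>t. F (x + t *\<^sub>R i)) has_real_derivative (g x \<bullet> i)) (at 0)"
          by (simp only: has_field_derivative_def)
        then have "(\<lambda>t. (F (x + t *\<^sub>R i) - F x) / t) \<midarrow>0\<rightarrow> g x \<bullet> i"
          by (simp add: DERIV_def)
        moreover have "filterlim h (at 0) sequentially"
          using h0 h by (auto simp: filterlim_at intro!: always_eventually) (metis less_irrefl)
        ultimately show ?thesis unfolding Q_def by (rule filterlim_compose)
      next
        case False
        then have "Q k x = 0" for k using C1[of k x] C by blast
        moreover have "g x = 0" using False K by blast
        ultimately show ?thesis by simp
      qed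
    qed
  qed
  moreover have "(LINT x|lborel. Q k x) = 0" for k
  proof -
    have int: "integrable lborel (\<lambda>x. F (h k *\<^sub>R i + x))" "(LINT x|lborel. F (h k *\<^sub>R i + x)) = (LINT x|lborel. F x)"
      using intF integrable_distr_eq[of "(+) (h k *\<^sub>R i)" lborel borel F] integral_distr[of "(+) (h k *\<^sub>R i)" lborel borel F]
      by (simp_all add: lborel_distr_plus)
    then show ?thesis using intF by (simp add: Q_def add.commute[of _ "h k *\<^sub>R i"])
  qed
  ultimately show ?thesis by (simp add: LIMSEQ_const_iff)
qed

text \<open>The product of \<open>u\<close> with a test function is Lipschitz near its compact support, so that
  \<open>integral_directional_derivative_zero\<close> is the integration by parts. Asking for derivatives only almost everywhere
  admits the functions \<open>u\<^sub>\<beta>\<close>, which have a kink on the sphere of radius \<open>\<gamma>\<close>.\<close>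

lemma is_weak_gradient_of_locally_lipschitz:
  fixes u :: "'a::euclidean_space \<Rightarrow> real"
  assumes \<Omega>: "open \<Omega>"
    and lip: "\<And>C. compact C \<Longrightarrow> C \<subseteq> \<Omega> \<Longrightarrow> \<exists>L. L-lipschitz_on C u"
    and g[measurable]: "g \<in> borel_measurable borel"
    and gb: "\<And>C. compact C \<Longrightarrow> C \<subseteq> \<Omega> \<Longrightarrow> \<exists>B. \<forall>x\<in>C. norm (g x) \<le> B"
    and D: "AE x in lborel. x \<in> \<Omega> \<longrightarrow> (u has_derivative (\<lambda>h. g x \<bullet> h)) (at x)"
  shows "is_weak_gradient \<Omega> u g"
proof -
  have cont: "continuous_on C u" if "compact C" "C \<subseteq> \<Omega>" for C
    using lip[OF that] lipschitz_on_continuous_on by blast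
  have um: "(\<lambda>x. indicator C x * u x) \<in> borel_measurable borel" if "compact C" "C \<subseteq> \<Omega>" for C
    using borel_measurable_continuous_on_indicator[OF _ cont[OF that]] that by (simp add: compact_imp_closed)
  have "locally_integrable_on u \<Omega>"
    unfolding locally_integrable_on_def set_integrable_def
  proof (intro allI impI)
    fix C assume C: "compact C \<and> C \<subseteq> \<Omega>"
    obtain B where "\<And>x. x \<in> C \<Longrightarrow> norm (u x) \<le> B"
      using bounded_on_compact[OF cont[of C]] C by metis
    then have "integrable lborel (\<lambda>x. indicator C x * u x)"
      using C by (intro integrable_on_compact_support[of C _ B] um) auto
    then show "integrable lebesgue (\<lambda>x. indicator C x *\<^sub>R u x)"
      using um C by (simp add: integrable_completion)
  qed
  moreover have "locally_integrable_on g \<Omega>"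
    unfolding locally_integrable_on_def set_integrable_def
  proof (intro allI impI)
    fix C assume C: "compact C \<and> C \<subseteq> \<Omega>"
    then obtain B where B: "\<forall>x\<in>C. norm (g x) \<le> B" using gb[of C] by auto
    have [measurable]: "C \<in> sets borel" using C by (simp add: compact_imp_closed)
    have m: "(\<lambda>x. indicator C x *\<^sub>R g x) \<in> borel_measurable borel" by measurable
    have "integrable lborel (\<lambda>x. indicator C x *\<^sub>R g x)"
    proof (rule integrable_on_compact_support[of C _ B])
      show "norm (indicator C x *\<^sub>R g x) \<le> B" if "x \<in> C" for x using B that by simp
    qed (use C m in auto)
    then show "integrable lebesgue (\<lambda>x. indicator C x *\<^sub>R g x)"
      using m by (simp add: integrable_completion)
  qed
  moreover have "(LINT x:\<Omega>|lebesgue. u x * frechet_derivative \<psi> (at x) i) =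
        - (LINT x:\<Omega>|lebesgue. (g x \<bullet> i) * \<psi> x)"
    if \<psi>: "\<psi> \<in> test_functions \<Omega>" and i: "i \<in> Basis" for \<psi> i
  proof -
    obtain K where K: "compact K" "K \<subseteq> \<Omega>" "\<And>x. x \<notin> K \<Longrightarrow> \<psi> x = 0" "\<And>x. x \<notin> K \<Longrightarrow> grad \<psi> x = 0"
      using test_functions_support[OF \<psi>] by metis
    obtain P where P: "\<And>x. \<bar>\<psi> x\<bar> \<le> P" "\<And>x. norm (grad \<psi> x) \<le> P"
      using test_functions_bounded[OF \<psi>] by metis
    have [measurable]: "\<psi> \<in> borel_measurable borel" "grad \<psi> \<in> borel_measurable borel"
      using test_functions_measurable[OF \<psi>] by auto
    note [measurable] = um[OF K(1,2)]
    define G where "G x = (indicator K x * u x) *\<^sub>R grad \<psi> x + \<psi> x *\<^sub>R g x" for x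
    have G: "(LINT x|lborel. G x \<bullet> i) = 0"
    proof (rule integral_directional_derivative_zero[OF \<Omega> K(1,2), of "\<lambda>x. u x * \<psi> x"])
      show "G \<in> borel_measurable borel" unfolding G_def by measurable
      show "norm i = 1" using i by simp
      show "\<exists>L. L-lipschitz_on C (\<lambda>x. u x * \<psi> x)" if C: "compact C" "C \<subseteq> \<Omega>" for C
      proof -
        obtain B where B: "B \<ge> 0" "\<And>x. x \<in> C \<Longrightarrow> norm (u x) \<le> B"
          using bounded_on_compact[OF cont[OF C] C(1)] by metis
        obtain L where L: "L-lipschitz_on C u" using lip C by blast
        obtain M where M: "M-lipschitz_on UNIV \<psi>" using test_functions_lipschitz[OF \<psi>] by blast
        have P0: "P \<ge> 0" using P(1)[of 0] by linarith
        have "(B * M + P * L)-lipschitz_on C (\<lambda>x. u x * \<psi> x)"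
        proof (rule lipschitz_onI)
          fix x y assume xy: "x \<in> C" "y \<in> C"
          have "\<bar>u x - u y\<bar> \<le> L * dist x y" "\<bar>\<psi> x - \<psi> y\<bar> \<le> M * dist x y"
            using lipschitz_onD[OF L xy] lipschitz_onD[OF M, of x y] by (auto simp: dist_real_def)
          then have "\<bar>u x\<bar> * \<bar>\<psi> x - \<psi> y\<bar> \<le> B * (M * dist x y)" "\<bar>\<psi> y\<bar> * \<bar>u x - u y\<bar> \<le> P * (L * dist x y)"
            using B(2)[OF xy(1)] P(1)[of y] B(1) P0 by (intro mult_mono; simp)+
          moreover have "\<bar>u x * \<psi> x - u y * \<psi> y\<bar> \<le> \<bar>u x\<bar> * \<bar>\<psi> x - \<psi> y\<bar> + \<bar>\<psi> y\<bar> * \<bar>u x - u y\<bar>"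
          proof -
            have "u x * \<psi> x - u y * \<psi> y = u x * (\<psi> x - \<psi> y) + \<psi> y * (u x - u y)" by algebra
            then show ?thesis by (metis abs_mult abs_triangle_ineq)
          qed
          ultimately show "dist (u x * \<psi> x) (u y * \<psi> y) \<le> (B * M + P * L) * dist x y"
            by (simp add: dist_real_def algebra_simps)
        qed (use B P0 lipschitz_on_nonneg[OF L] lipschitz_on_nonneg[OF M] in auto)
        then show ?thesis by blast
      qed
      show "AE x in lborel. x \<in> \<Omega> \<longrightarrow> ((\<lambda>x. u x * \<psi> x) has_derivative (\<lambda>h. G x \<bullet> h)) (at x)"
        using D
      proof eventually_elim
        case (elim x)
        show ?case
        proof
          assume "x \<in> \<Omega>"
          with elim have "((\<lambda>x. u x * \<psi> x) has_derivative (\<lambda>h. u x * (grad \<psi> x \<bullet> h) + (g x \<bullet> h) * \<psi> x)) (at x)"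
            by (intro has_derivative_mult test_functions_has_derivative[OF \<psi>]) auto
          moreover have "(\<lambda>h. u x * (grad \<psi> x \<bullet> h) + (g x \<bullet> h) * \<psi> x) = (\<lambda>h. G x \<bullet> h)"
            using K by (auto simp: G_def inner_add_left indicator_def)
          ultimately show "((\<lambda>x. u x * \<psi> x) has_derivative (\<lambda>h. G x \<bullet> h)) (at x)" by simp
        qed
      qed
    qed (use K in \<open>auto simp: G_def\<close>)
    obtain B where B: "B \<ge> 0" "\<And>x. x \<in> K \<Longrightarrow> norm (u x) \<le> B"
      using bounded_on_compact[OF cont[OF K(1,2)] K(1)] by metis
    obtain B' where B': "\<And>x. x \<in> K \<Longrightarrow> norm (g x) \<le> B'" using gb[OF K(1,2)] by auto
    have 1: "integrable lborel (\<lambda>x. indicator K x * u x * (grad \<psi> x \<bullet> i))"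
    proof (rule integrable_on_compact_support[OF K(1), where B = "B * P"])
      fix x assume x: "x \<in> K"
      have "\<bar>grad \<psi> x \<bullet> i\<bar> \<le> P" using Basis_le_norm[OF i, of "grad \<psi> x"] P(2)[of x] by linarith
      then show "norm (indicator K x * u x * (grad \<psi> x \<bullet> i)) \<le> B * P"
        using B(2)[OF x] B(1) x by (auto simp: abs_mult intro!: mult_mono)
    qed (use K in auto)
    have 2: "integrable lborel (\<lambda>x. (g x \<bullet> i) * \<psi> x)"
    proof (rule integrable_on_compact_support[OF K(1), where B = "B' * P"])
      fix x assume x: "x \<in> K"
      have "\<bar>g x \<bullet> i\<bar> \<le> B'" using Basis_le_norm[OF i, of "g x"] B'[OF x] by linarith
      then show "norm ((g x \<bullet> i) * \<psi> x) \<le> B' * P"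
        using P(1)[of x] by (auto simp: abs_mult intro!: mult_mono)
    qed (use K in auto)
    have "(LINT x:\<Omega>|lebesgue. u x * frechet_derivative \<psi> (at x) i) = (LINT x|lebesgue. indicator K x * u x * (grad \<psi> x \<bullet> i))"
      unfolding set_lebesgue_integral_def test_functions_frechet_derivative[OF \<psi>]
      using K by (intro Bochner_Integration.integral_cong) (auto simp: indicator_def)
    also have "\<dots> = (LINT x|lborel. indicator K x * u x * (grad \<psi> x \<bullet> i))"
      by (rule integral_completion) simp
    also have "\<dots> = (LINT x|lborel. G x \<bullet> i) - (LINT x|lborel. (g x \<bullet> i) * \<psi> x)"
      using 1 2 by (simp add: G_def inner_add_left mult.commute)
    also have "\<dots> = - (LINT x|lebesgue. (g x \<bullet> i) * \<psi> x)"
      using G by (simp add: integral_completion)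
    also have "(LINT x|lebesgue. (g x \<bullet> i) * \<psi> x) = (LINT x:\<Omega>|lebesgue. (g x \<bullet> i) * \<psi> x)"
      unfolding set_lebesgue_integral_def
      using K by (intro Bochner_Integration.integral_cong) (auto simp: indicator_def)
    finally show ?thesis .
  qed
  ultimately show ?thesis unfolding is_weak_gradient_def by blast
qed

lemma is_weak_gradient_test_function:
  assumes "open \<Omega>" "\<phi> \<in> test_functions \<Omega>"
  shows "is_weak_gradient \<Omega> \<phi> (grad \<phi>)"
proof (rule is_weak_gradient_of_locally_lipschitz[OF assms(1)])
  show "\<exists>L. L-lipschitz_on C \<phi>" for C
    using test_functions_lipschitz[OF assms(2)] lipschitz_on_subset by (metis top_greatest)
  show "\<exists>B. \<forall>x\<in>C. norm (grad \<phi> x) \<le> B" for C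
    using test_functions_bounded[OF assms(2)] by metis
  show "AE x in lborel. x \<in> \<Omega> \<longrightarrow> (\<phi> has_derivative (\<lambda>h. grad \<phi> x \<bullet> h)) (at x)"
    by (intro AE_I2 impI test_functions_has_derivative[OF assms(2)])
qed (rule test_functions_measurable(2)[OF assms(2)])

section \<open>Polar coordinates\<close>

lemma nn_integral_lborel_scaleR:
  fixes f :: "'a::euclidean_space \<Rightarrow> ennreal"
  assumes [measurable]: "f \<in> borel_measurable borel" and c: "c > 0"
  shows "(\<integral>\<^sup>+x. f x \<partial>lborel) = ennreal (c ^ DIM('a)) * (\<integral>\<^sup>+x. f (c *\<^sub>R x) \<partial>lborel)"
  using c by (subst lborel_affine[of c 0])
    (simp_all add: nn_integral_density nn_integral_distr nn_integral_cmult)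

lemma sets_sphere_measure[simp, measurable_cong]: "sets (sphere_measure \<rho>) = sets borel"
  by (simp add: sphere_measure_def)

lemma space_sphere_measure[simp]: "space (sphere_measure \<rho>) = UNIV"
  using sets_eq_imp_space_eq[OF sets_sphere_measure] by (metis space_borel)

lemma nn_integral_sphere_measure:
  fixes h :: "'a::euclidean_space \<Rightarrow> ennreal"
  assumes [measurable]: "h \<in> borel_measurable borel"
  shows "(\<integral>\<^sup>+x. h x \<partial>sphere_measure \<rho>)
    = ennreal (real DIM('a) / \<rho>) * (\<integral>\<^sup>+x. h ((\<rho> / norm x) *\<^sub>R x) * indicator (ball 0 \<rho>) x \<partial>lborel)"
  unfolding sphere_measure_def
  by (simp add: nn_integral_scale_measure nn_integral_distr nn_integral_restrict_space measurable_restrict_space1)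

lemma nn_integral_sphere_measure_unit:
  fixes h :: "'a::euclidean_space \<Rightarrow> ennreal"
  assumes h[measurable]: "h \<in> borel_measurable borel" and \<rho>: "\<rho> > 0"
  shows "(\<integral>\<^sup>+x. h x \<partial>sphere_measure \<rho>)
    = ennreal (\<rho> ^ (DIM('a) - 1)) * (\<integral>\<^sup>+\<omega>. h (\<rho> *\<^sub>R \<omega>) \<partial>sphere_measure 1)"
proof -
  let ?n = "DIM('a)"
  have [measurable]: "ball (0::'a) \<rho> \<in> sets borel" by simp
  have "(\<integral>\<^sup>+x. h ((\<rho> / norm x) *\<^sub>R x) * indicator (ball 0 \<rho>) x \<partial>lborel)
      = ennreal (\<rho> ^ ?n) * (\<integral>\<^sup>+x. h ((\<rho> / norm (\<rho> *\<^sub>R x)) *\<^sub>R (\<rho> *\<^sub>R x)) * indicator (ball 0 \<rho>) (\<rho> *\<^sub>R x) \<partial>lborel)"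
    by (rule nn_integral_lborel_scaleR[OF _ \<rho>]) measurable
  also have "(\<lambda>x. h ((\<rho> / norm (\<rho> *\<^sub>R x)) *\<^sub>R (\<rho> *\<^sub>R x)) * indicator (ball 0 \<rho>) (\<rho> *\<^sub>R x))
      = (\<lambda>x::'a. h (\<rho> *\<^sub>R ((1 / norm x) *\<^sub>R x)) * indicator (ball 0 1) x)"
    using \<rho> by (auto simp: fun_eq_iff indicator_def)
  finally have 1: "(\<integral>\<^sup>+x. h x \<partial>sphere_measure \<rho>) = ennreal (real ?n / \<rho>) * (ennreal (\<rho> ^ ?n)
      * (\<integral>\<^sup>+x. h (\<rho> *\<^sub>R ((1 / norm x) *\<^sub>R x)) * indicator (ball 0 1) x \<partial>lborel))"
    by (simp add: nn_integral_sphere_measure)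
  have 2: "(\<integral>\<^sup>+\<omega>. h (\<rho> *\<^sub>R \<omega>) \<partial>sphere_measure 1) = ennreal (real ?n)
      * (\<integral>\<^sup>+x. h (\<rho> *\<^sub>R ((1 / norm x) *\<^sub>R x)) * indicator (ball 0 1) x \<partial>lborel)"
    by (subst nn_integral_sphere_measure) simp_all
  have "?n = Suc (?n - 1)" using DIM_positive[where 'a = 'a] by simp
  then have "\<rho> ^ ?n = \<rho> * \<rho> ^ (?n - 1)" by (metis power_Suc)
  then have "real ?n / \<rho> * \<rho> ^ ?n = \<rho> ^ (?n - 1) * real ?n" using \<rho> by simp
  then have "ennreal (real ?n / \<rho>) * ennreal (\<rho> ^ ?n) = ennreal (\<rho> ^ (?n - 1)) * ennreal (real ?n)"
    using \<rho> by (simp flip: ennreal_mult)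
  then show ?thesis unfolding 1 2 by (simp flip: mult.assoc)
qed

lemma AE_lborel_nonzero: "AE x::'a::euclidean_space in lborel. x \<noteq> 0"
  by (rule AE_lborel_singleton)

lemma AE_sphere_measure_norm: "\<rho> > 0 \<Longrightarrow> AE x in sphere_measure \<rho>. norm (x::'a::euclidean_space) = \<rho>"
proof -
  assume \<rho>: "\<rho> > 0"
  have [measurable]: "{x::'a. norm x \<noteq> \<rho>} \<in> sets borel" by measurable
  \<comment> \<open>the projection to the sphere sends the origin to itself, as \<open>\<rho> / 0 = 0\<close>\<close>
  have "(\<integral>\<^sup>+x. indicator {x::'a. norm x \<noteq> \<rho>} x \<partial>sphere_measure \<rho>) = 0"
  proof (subst nn_integral_sphere_measure)
    have "(\<integral>\<^sup>+x. indicator {x::'a. norm x \<noteq> \<rho>} ((\<rho> / norm x) *\<^sub>R x) * indicator (ball 0 \<rho>) x \<partial>lborel)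
      = (\<integral>\<^sup>+x. 0 \<partial>(lborel :: 'a measure))"
      using AE_lborel_nonzero \<rho> by (intro nn_integral_cong_AE) (auto elim!: eventually_mono simp: indicator_def)
    then show "ennreal (real DIM('a) / \<rho>) * (\<integral>\<^sup>+x. indicator {x::'a. norm x \<noteq> \<rho>} ((\<rho> / norm x) *\<^sub>R x) * indicator (ball 0 \<rho>) x \<partial>lborel) = 0"
      by simp
  qed simp
  then have "{x::'a. norm x \<noteq> \<rho>} \<in> null_sets (sphere_measure \<rho>)" by (auto simp: null_sets_def)
  from AE_not_in[OF this] show ?thesis by simp
qed

lemma emeasure_sphere_measure_finite: "emeasure (sphere_measure \<rho> :: 'a::euclidean_space measure) UNIV < \<infinity>"
proof -
  have "emeasure (sphere_measure \<rho> :: 'a measure) UNIV = (\<integral>\<^sup>+x. 1 \<partial>(sphere_measure \<rho> :: 'a measure))"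
    by simp
  also have "\<dots> = ennreal (real DIM('a) / \<rho>) * emeasure lborel (ball (0::'a) \<rho>)"
    by (subst nn_integral_sphere_measure) simp_all
  also have "\<dots> < \<infinity>"
    using emeasure_bounded_finite[of "ball (0::'a) \<rho>"] by (simp add: ennreal_mult_less_top)
  finally show ?thesis .
qed

lemma finite_measure_sphere_measure: "finite_measure (sphere_measure \<rho> :: 'a::euclidean_space measure)"
  using emeasure_sphere_measure_finite[of \<rho>, where 'a = 'a] by (intro finite_measureI) auto

lemma nn_integral_inverse_power:
  assumes a: "a > 0" and n: "n > 0"
  shows "(\<integral>\<^sup>+t. ennreal (real n * inverse t ^ (n + 1)) * indicator {a<..} t \<partial>lborel) = ennreal (inverse a ^ n)"
proof -
  have "(\<integral>\<^sup>+t. ennreal (real n * inverse t ^ (n + 1)) * indicator {a<..} t \<partial>lborel)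
    = (\<integral>\<^sup>+t. ennreal (real n * inverse t ^ (n + 1)) * indicator {a..} t \<partial>lborel)"
    using AE_lborel_singleton[of a] by (intro nn_integral_cong_AE) (auto elim!: eventually_mono simp: indicator_def)
  also have "\<dots> = ennreal (0 - (- (inverse a ^ n)))"
  proof (rule nn_integral_FTC_atLeast)
    fix t :: real assume t: "a \<le> t"
    have "n = Suc (n - 1)" using n by simp
    then have "inverse t ^ n = inverse t * inverse t ^ (n - 1)" by (metis power_Suc)
    with t a show "((\<lambda>t. - (inverse t ^ n)) has_real_derivative real n * inverse t ^ (n + 1)) (at t)"
      by (auto intro!: derivative_eq_intros)
    show "0 \<le> real n * inverse t ^ (n + 1)" using t a by simp
  next
    have "((\<lambda>t::real. - (inverse t ^ n)) \<longlongrightarrow> - (0 ^ n)) at_top"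
      by (intro tendsto_intros tendsto_inverse_0_at_top filterlim_ident)
    then show "((\<lambda>t::real. - (inverse t ^ n)) \<longlongrightarrow> 0) at_top" using n by (simp add: zero_power)
  qed measurable
  finally show ?thesis by simp
qed

lemma measurable_indicator_greaterThan[measurable (raw)]:
  fixes f g :: "'b \<Rightarrow> real"
  assumes [measurable]: "f \<in> borel_measurable M" "g \<in> borel_measurable M"
  shows "(\<lambda>x. indicator {f x<..} (g x) :: ennreal) \<in> borel_measurable M"
proof -
  have "(\<lambda>x. indicator {f x<..} (g x) :: ennreal) = (\<lambda>x. if f x < g x then 1 else 0)"
    by (auto simp: indicator_def)
  then show ?thesis by simp
qed

text \<open>The sphere measure is an integral over the unit ball. Substituting \<open>s = |x| t\<close> in the inner integral,
  exchanging the order, and substituting \<open>y = t x\<close> turns the right-hand side into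
  \<open>\<integral> |y|\<^sup>n f(y) (\<integral>\<^bsub>t > |y|\<^esub> n t\<^bsup>-n-1\<^esup> dt) dy\<close>, where the inner integral is \<open>|y|\<^bsup>-n\<^esup>\<close>.\<close>

lemma nn_integral_polar:
  fixes f :: "'a::euclidean_space \<Rightarrow> ennreal"
  assumes f[measurable]: "f \<in> borel_measurable borel"
  shows "(\<integral>\<^sup>+x. f x \<partial>lborel)
    = (\<integral>\<^sup>+\<omega>. (\<integral>\<^sup>+s. ennreal (s ^ (DIM('a) - 1)) * f (s *\<^sub>R \<omega>) * indicator {0<..} s \<partial>lborel) \<partial>sphere_measure 1)"
proof -
  let ?n = "DIM('a)"
  let ?k = "?n - 1"
  have n: "?n > 0" "?n = Suc ?k" using DIM_positive[where 'a = 'a] by simp_all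
  have [measurable]: "ball (0::'a) 1 \<in> sets borel" by simp
  have P: "pair_sigma_finite (lborel :: 'a measure) (lborel :: real measure)"
    and L: "pair_sigma_finite (lborel :: real measure) (lborel :: 'a measure)"
    by (simp_all add: pair_sigma_finite_def lborel.sigma_finite_measure_axioms)
  have "(\<integral>\<^sup>+\<omega>. (\<integral>\<^sup>+s. ennreal (s ^ ?k) * f (s *\<^sub>R \<omega>) * indicator {0<..} s \<partial>lborel) \<partial>sphere_measure 1)
    = ennreal (real ?n) * (\<integral>\<^sup>+x. (\<integral>\<^sup>+s. ennreal (s ^ ?k) * f (s *\<^sub>R ((1 / norm x) *\<^sub>R x)) * indicator {0<..} s \<partial>lborel) * indicator (ball 0 1) x \<partial>lborel)"
    by (subst nn_integral_sphere_measure) simp_all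
  also have "(\<integral>\<^sup>+x. (\<integral>\<^sup>+s. ennreal (s ^ ?k) * f (s *\<^sub>R ((1 / norm x) *\<^sub>R x)) * indicator {0<..} s \<partial>lborel) * indicator (ball 0 1) x \<partial>lborel)
    = (\<integral>\<^sup>+x. \<integral>\<^sup>+t. ennreal (norm x ^ ?n) * ennreal (t ^ ?k) * f (t *\<^sub>R x) * indicator {0<..} t * indicator (ball 0 1) x \<partial>lborel \<partial>lborel)"
    using AE_lborel_nonzero[where 'a = 'a]
  proof (intro nn_integral_cong_AE, eventually_elim)
    case (elim x)
    have "(\<integral>\<^sup>+s. ennreal (s ^ ?k) * f (s *\<^sub>R ((1 / norm x) *\<^sub>R x)) * indicator {0<..} s \<partial>lborel)
      = ennreal \<bar>norm x\<bar> * (\<integral>\<^sup>+t. ennreal ((0 + norm x * t) ^ ?k) * f ((0 + norm x * t) *\<^sub>R ((1 / norm x) *\<^sub>R x)) * indicator {0<..} (0 + norm x * t) \<partial>lborel)"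
      using elim by (intro nn_integral_real_affine) simp_all
    also have "\<dots> = (\<integral>\<^sup>+t. ennreal (norm x) * (ennreal ((0 + norm x * t) ^ ?k) * f ((0 + norm x * t) *\<^sub>R ((1 / norm x) *\<^sub>R x)) * indicator {0<..} (0 + norm x * t)) \<partial>lborel)"
      by (subst nn_integral_cmult) simp_all
    also have "\<dots> = (\<integral>\<^sup>+t. ennreal (norm x ^ ?n) * ennreal (t ^ ?k) * f (t *\<^sub>R x) * indicator {0<..} t \<partial>lborel)"
    proof (intro nn_integral_cong)
      fix t :: real
      show "ennreal (norm x) * (ennreal ((0 + norm x * t) ^ ?k) * f ((0 + norm x * t) *\<^sub>R ((1 / norm x) *\<^sub>R x)) * indicator {0<..} (0 + norm x * t))
        = ennreal (norm x ^ ?n) * ennreal (t ^ ?k) * f (t *\<^sub>R x) * indicator {0<..} t"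
      proof (cases "t > 0")
        case True
        have "norm x ^ ?n = norm x * norm x ^ ?k" using n(2) by (metis power_Suc)
        with True elim show ?thesis
          by (simp add: power_mult_distrib ennreal_mult zero_less_mult_iff mult.assoc)
      next
        case False
        then have "\<not> 0 < norm x * t" using elim by (simp add: zero_less_mult_iff)
        with False show ?thesis by simp
      qed
    qed
    finally show ?case by (simp add: nn_integral_multc)
  qed
  also have "\<dots> = (\<integral>\<^sup>+t. \<integral>\<^sup>+x. ennreal (norm x ^ ?n) * ennreal (t ^ ?k) * f (t *\<^sub>R x) * indicator {0<..} t * indicator (ball 0 1) x \<partial>lborel \<partial>lborel)"
    by (intro pair_sigma_finite.Fubini'[OF L]) measurable
  also have "ennreal (real ?n) * \<dots> = (\<integral>\<^sup>+t. ennreal (real ?n) * (\<integral>\<^sup>+x. ennreal (norm x ^ ?n) * ennreal (t ^ ?k) * f (t *\<^sub>R x) * indicator {0<..} t * indicator (ball 0 1) x \<partial>lborel) \<partial>lborel)"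
    by (subst nn_integral_cmult) simp_all
  also have "\<dots> = (\<integral>\<^sup>+t. \<integral>\<^sup>+y. (ennreal (norm y ^ ?n) * f y) * (ennreal (real ?n * inverse t ^ (?n + 1)) * indicator {norm y<..} t) \<partial>lborel \<partial>lborel)"
  proof (intro nn_integral_cong)
    fix t :: real
    show "ennreal (real ?n) * (\<integral>\<^sup>+x. ennreal (norm x ^ ?n) * ennreal (t ^ ?k) * f (t *\<^sub>R x) * indicator {0<..} t * indicator (ball 0 1) x \<partial>lborel)
      = (\<integral>\<^sup>+y. (ennreal (norm y ^ ?n) * f y) * (ennreal (real ?n * inverse t ^ (?n + 1)) * indicator {norm y<..} t) \<partial>lborel)"
    proof (cases "t > 0")
      case True
      have "(\<integral>\<^sup>+y. (ennreal (norm y ^ ?n) * f y) * (ennreal (real ?n * inverse t ^ (?n + 1)) * indicator {norm y<..} t) \<partial>lborel)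
        = ennreal (t ^ ?n) * (\<integral>\<^sup>+x. (ennreal (norm (t *\<^sub>R x) ^ ?n) * f (t *\<^sub>R x)) * (ennreal (real ?n * inverse t ^ (?n + 1)) * indicator {norm (t *\<^sub>R x)<..} t) \<partial>lborel)"
        using True by (intro nn_integral_lborel_scaleR) simp_all
      also have "\<dots> = (\<integral>\<^sup>+x. ennreal (t ^ ?n) * ((ennreal (norm (t *\<^sub>R x) ^ ?n) * f (t *\<^sub>R x)) * (ennreal (real ?n * inverse t ^ (?n + 1)) * indicator {norm (t *\<^sub>R x)<..} t)) \<partial>lborel)"
        by (subst nn_integral_cmult) simp_all
      also have "\<dots> = (\<integral>\<^sup>+x. ennreal (real ?n) * (ennreal (norm x ^ ?n) * ennreal (t ^ ?k) * f (t *\<^sub>R x) * indicator {0<..} t * indicator (ball 0 1) x) \<partial>lborel)"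
      proof (intro nn_integral_cong)
        fix x :: 'a
        have ind: "(indicator {norm (t *\<^sub>R x)<..} t :: ennreal) = indicator {0<..} t * indicator (ball 0 1) x"
          using True by (auto simp: indicator_def)
        have "t ^ ?n * (norm (t *\<^sub>R x) ^ ?n * (real ?n * inverse t ^ (?n + 1))) = real ?n * (norm x ^ ?n * t ^ ?k)"
        proof -
          have "t ^ ?n = t * t ^ ?k" using n(2) by (metis power_Suc)
          then have 1: "inverse t * t ^ ?n = t ^ ?k" using True by simp
          have 2: "t ^ ?n * inverse t ^ ?n = 1" using True by (simp flip: power_mult_distrib)
          have "norm (t *\<^sub>R x) ^ ?n = t ^ ?n * norm x ^ ?n" using True by (simp add: power_mult_distrib)
          then have "t ^ ?n * (norm (t *\<^sub>R x) ^ ?n * (real ?n * inverse t ^ (?n + 1)))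
            = (t ^ ?n * inverse t ^ ?n) * (real ?n * (norm x ^ ?n * (inverse t * t ^ ?n)))"
            by (simp add: mult_ac)
          then show ?thesis unfolding 1 2 by simp
        qed
        note eq = this
        have e3: "ennreal (a * (b * c)) = ennreal a * (ennreal b * ennreal c)" if "a \<ge> 0" "b \<ge> 0" "c \<ge> 0" for a b c
          using that by (simp add: ennreal_mult)
        have "ennreal (t ^ ?n) * (ennreal (norm (t *\<^sub>R x) ^ ?n) * ennreal (real ?n * inverse t ^ (?n + 1)))
          = ennreal (t ^ ?n * (norm (t *\<^sub>R x) ^ ?n * (real ?n * inverse t ^ (?n + 1))))"
          using True by (intro e3[symmetric]) simp_all
        also have "\<dots> = ennreal (real ?n * (norm x ^ ?n * t ^ ?k))" unfolding eq ..
        also have "\<dots> = ennreal (real ?n) * (ennreal (norm x ^ ?n) * ennreal (t ^ ?k))"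
          using True by (intro e3) simp_all
        finally have fin: "ennreal (t ^ ?n) * (ennreal (norm (t *\<^sub>R x) ^ ?n) * ennreal (real ?n * inverse t ^ (?n + 1)))
          = ennreal (real ?n) * (ennreal (norm x ^ ?n) * ennreal (t ^ ?k))" .
        have "ennreal (t ^ ?n) * ((ennreal (norm (t *\<^sub>R x) ^ ?n) * f (t *\<^sub>R x)) * (ennreal (real ?n * inverse t ^ (?n + 1)) * indicator {norm (t *\<^sub>R x)<..} t))
          = (ennreal (t ^ ?n) * (ennreal (norm (t *\<^sub>R x) ^ ?n) * ennreal (real ?n * inverse t ^ (?n + 1)))) * (f (t *\<^sub>R x) * indicator {norm (t *\<^sub>R x)<..} t)"
          by (simp only: mult_ac)
        also have "\<dots> = ennreal (real ?n) * (ennreal (norm x ^ ?n) * ennreal (t ^ ?k) * f (t *\<^sub>R x) * indicator {0<..} t * indicator (ball 0 1) x)"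
          unfolding fin ind by (simp only: mult_ac)
        finally show "ennreal (t ^ ?n) * ((ennreal (norm (t *\<^sub>R x) ^ ?n) * f (t *\<^sub>R x)) * (ennreal (real ?n * inverse t ^ (?n + 1)) * indicator {norm (t *\<^sub>R x)<..} t))
          = ennreal (real ?n) * (ennreal (norm x ^ ?n) * ennreal (t ^ ?k) * f (t *\<^sub>R x) * indicator {0<..} t * indicator (ball 0 1) x)"
          .
      qed
      also have "\<dots> = ennreal (real ?n) * (\<integral>\<^sup>+x. ennreal (norm x ^ ?n) * ennreal (t ^ ?k) * f (t *\<^sub>R x) * indicator {0<..} t * indicator (ball 0 1) x \<partial>lborel)"
        by (subst nn_integral_cmult) simp_all
      finally show ?thesis by simp
    next
      case False
      then have "\<not> norm y < t" for y :: 'a using norm_ge_zero[of y] by linarith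
      with False show ?thesis by simp
    qed
  qed
  also have "\<dots> = (\<integral>\<^sup>+y. \<integral>\<^sup>+t. (ennreal (norm y ^ ?n) * f y) * (ennreal (real ?n * inverse t ^ (?n + 1)) * indicator {norm y<..} t) \<partial>lborel \<partial>lborel)"
    by (intro pair_sigma_finite.Fubini'[OF P]) measurable
  also have "\<dots> = (\<integral>\<^sup>+y. f y \<partial>lborel)"
    using AE_lborel_nonzero[where 'a = 'a]
  proof (intro nn_integral_cong_AE, eventually_elim)
    case (elim y)
    have "(\<integral>\<^sup>+t. (ennreal (norm y ^ ?n) * f y) * (ennreal (real ?n * inverse t ^ (?n + 1)) * indicator {norm y<..} t) \<partial>lborel)
      = (ennreal (norm y ^ ?n) * f y) * (\<integral>\<^sup>+t. ennreal (real ?n * inverse t ^ (?n + 1)) * indicator {norm y<..} t \<partial>lborel)"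
      by (subst nn_integral_cmult) simp_all
    also have "\<dots> = f y * (ennreal (norm y ^ ?n) * ennreal (inverse (norm y) ^ ?n))"
      using elim n(1) by (subst nn_integral_inverse_power) (auto simp: mult_ac)
    also have "ennreal (norm y ^ ?n) * ennreal (inverse (norm y) ^ ?n) = 1"
      using elim by (simp flip: ennreal_mult power_mult_distrib)
    finally show ?case by simp
  qed
  finally show ?thesis by simp
qed

definition ray_integral :: "real set \<Rightarrow> ('a::euclidean_space \<Rightarrow> real) \<Rightarrow> 'a \<Rightarrow> ennreal" where
  "ray_integral I f \<omega> = (\<integral>\<^sup>+s. ennreal (s ^ (DIM('a) - 1)) * ennreal (f (s *\<^sub>R \<omega>)) * indicator I s \<partial>lborel)"

lemma ray_integral_measurable[measurable]:
  assumes [measurable]: "f \<in> borel_measurable borel" "I \<in> sets borel"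
  shows "ray_integral I f \<in> borel_measurable borel"
  unfolding ray_integral_def[abs_def] by measurable

lemma nn_integral_polar_radial_set:
  fixes f :: "'a::euclidean_space \<Rightarrow> real"
  assumes [measurable]: "f \<in> borel_measurable borel" "I \<in> sets borel" and I: "I \<subseteq> {0<..}"
  shows "(\<integral>\<^sup>+x. ennreal (f x) * indicator {x. norm x \<in> I} x \<partial>lborel) = (\<integral>\<^sup>+\<omega>. ray_integral I f \<omega> \<partial>sphere_measure 1)"
proof -
  have [measurable]: "{x::'a. norm x \<in> I} \<in> sets borel" by measurable
  have "(\<integral>\<^sup>+x. ennreal (f x) * indicator {x. norm x \<in> I} x \<partial>lborel)
    = (\<integral>\<^sup>+\<omega>. (\<integral>\<^sup>+s. ennreal (s ^ (DIM('a) - 1)) * (ennreal (f (s *\<^sub>R \<omega>)) * indicator {x. norm x \<in> I} (s *\<^sub>R \<omega>)) * indicator {0<..} s \<partial>lborel) \<partial>sphere_measure 1)"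
    by (rule nn_integral_polar) measurable
  also have "\<dots> = (\<integral>\<^sup>+\<omega>. ray_integral I f \<omega> \<partial>sphere_measure 1)"
    unfolding ray_integral_def using AE_sphere_measure_norm[of 1, where 'a = 'a, OF zero_less_one]
  proof (intro nn_integral_cong_AE, eventually_elim)
    case (elim \<omega>)
    then show ?case using I by (intro nn_integral_cong) (auto simp: indicator_def)
  qed
  finally show ?thesis .
qed

section \<open>The Hardy inequality for test functions\<close>

text \<open>The parameter \<open>c\<close> keeps the inequality linear in \<open>a\<^sup>p\<close> and \<open>b\<^sup>p\<close>, so that it can be integrated over
  a ray and then over the sphere; choosing \<open>c\<close> at the very end has the effect of Hoelder's inequality.
  Equality holds for \<open>a = c b\<close>.\<close>

lemma young_weighted:
  fixes a b c p :: real
  assumes "a \<ge> 0" "b \<ge> 0" "c > 0" "p > 1"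
  shows "p * a * b powr (p - 1) \<le> c powr (1 - p) * a powr p + (p - 1) * c * b powr p"
proof -
  define q where "q = p / (p - 1)"
  define l where "l = c powr ((p - 1) / p)"
  have q: "q > 1" "1 / p + 1 / q = 1" "(p - 1) * q = p" "(p - 1) / p * q = 1" "p / q = p - 1"
    using assms by (auto simp: q_def field_simps)
  have l: "l > 0" "l powr p = c powr (p - 1)" "l powr q = c"
    using assms q by (auto simp: l_def powr_powr)
  have "(a / l) * (b powr (p - 1) * l) \<le> (a / l) powr p / p + (b powr (p - 1) * l) powr q / q"
    using assms q l by (intro Youngs_inequality) auto
  also have "(a / l) powr p = c powr (1 - p) * a powr p"
    using assms l by (simp add: powr_divide powr_diff field_simps powr_minus)
  also have "(b powr (p - 1) * l) powr q = b powr p * c"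
    using assms l q by (simp add: powr_mult powr_powr)
  also have "(a / l) * (b powr (p - 1) * l) = a * b powr (p - 1)" using l by simp
  finally have "p * (a * b powr (p - 1)) \<le> p * (c powr (1 - p) * a powr p / p + b powr p * c / q)"
    using assms by (intro mult_left_mono) auto
  also have "\<dots> = c powr (1 - p) * a powr p + (p / q) * c * b powr p"
    using assms by (simp add: field_simps)
  finally show ?thesis unfolding q by (simp add: mult.assoc)
qed

lemma abs_powr_tendsto_0: "q > 0 \<Longrightarrow> ((\<lambda>h::real. \<bar>h\<bar> powr q) \<longlongrightarrow> 0) (at 0)"
proof -
  assume q: "q > 0"
  have "((\<lambda>h::real. \<bar>h\<bar> powr q) \<longlongrightarrow> \<bar>0\<bar> powr q) (at 0)"
    by (rule tendsto_powr') (use q in \<open>auto intro!: tendsto_rabs_zero tendsto_ident_at\<close>)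
  then show ?thesis by simp
qed

lemma DERIV_abs_powr:
  fixes p x :: real
  assumes p: "p > 1"
  shows "((\<lambda>x. \<bar>x\<bar> powr p) has_real_derivative p * \<bar>x\<bar> powr (p - 1) * sgn x) (at x)"
proof -
  consider "x > 0" | "x = 0" | "x < 0" by linarith
  then show ?thesis
  proof cases
    case 1
    have "((\<lambda>x. x powr p) has_real_derivative p * \<bar>x\<bar> powr (p - 1) * sgn x) (at x)"
      using 1 by (auto intro!: derivative_eq_intros)
    then show ?thesis
      by (rule DERIV_cong_ev[THEN iffD1, rotated -1, OF _ refl _ refl])
        (use 1 in \<open>auto intro!: eventually_nhds_in_open[of "{0<..}", THEN eventually_mono]\<close>)
  next
    case 2
    have "((\<lambda>h. \<bar>h\<bar> powr p / h) \<longlongrightarrow> 0) (at (0::real))"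
    proof (rule tendsto_rabs_zero_cancel, rule Lim_transform_eventually[OF abs_powr_tendsto_0])
      show "\<forall>\<^sub>F h in at (0::real). \<bar>h\<bar> powr (p - 1) = \<bar>\<bar>h\<bar> powr p / h\<bar>"
        by (auto simp: eventually_at_filter powr_diff)
    qed (use p in simp)
    then show ?thesis using 2 by (simp add: DERIV_def)
  next
    case 3
    have "((\<lambda>x. (- x) powr p) has_real_derivative p * \<bar>x\<bar> powr (p - 1) * sgn x) (at x)"
      using 3 by (auto intro!: derivative_eq_intros)
    then show ?thesis
      by (rule DERIV_cong_ev[THEN iffD1, rotated -1, OF _ refl _ refl])
        (use 3 in \<open>auto intro!: eventually_nhds_in_open[of "{..<0}", THEN eventually_mono]\<close>)
  qed
qed

text \<open>The pointwise form of the inequality: Young's inequality bounds the derivative of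
  \<open>|v|\<^sup>p \<tau>\<^bsup>1-p\<^esup>\<close> by the difference of the two sides.\<close>

lemma hardy_on_interval:
  fixes v v' \<tau> w :: "real \<Rightarrow> real"
  assumes p: "p > 1" and c: "c > 0" and ab: "a \<le> b" and \<sigma>: "\<sigma> = 1 \<or> \<sigma> = -1"
    and v: "\<And>s. s \<in> {a..b} \<Longrightarrow> (v has_real_derivative v' s) (at s)" "continuous_on {a..b} v'"
    and \<tau>: "\<And>s. s \<in> {a..b} \<Longrightarrow> (\<tau> has_real_derivative \<sigma> * w s) (at s)" "\<And>s. s \<in> {a..b} \<Longrightarrow> \<tau> s > 0"
    and w: "\<And>s. s \<in> {a..b} \<Longrightarrow> w s > 0" "continuous_on {a..b} w"
  defines "q \<equiv> \<lambda>s. \<bar>v s\<bar> powr p * (\<tau> s powr (- p) * w s)"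
    and "d \<equiv> \<lambda>s. \<bar>v' s\<bar> powr p * w s powr (1 - p)"
  shows "\<sigma> * (\<bar>v b\<bar> powr p * \<tau> b powr (1 - p) - \<bar>v a\<bar> powr p * \<tau> a powr (1 - p))
      + (p - 1) * (LINT s:{a..b}|lborel. q s)
    \<le> c powr (1 - p) * (LINT s:{a..b}|lborel. d s) + (p - 1) * c * (LINT s:{a..b}|lborel. q s)"
    "set_integrable lborel {a..b} q" "set_integrable lborel {a..b} d"
proof -
  have cv: "continuous_on {a..b} v" and ct: "continuous_on {a..b} \<tau>"
    using v(1)[THEN DERIV_isCont] \<tau>(1)[THEN DERIV_isCont] by (simp_all add: continuous_at_imp_continuous_on)
  have cq: "continuous_on {a..b} q" and cd: "continuous_on {a..b} d"
  proof -
    have [continuous_intros]: "continuous_on {a..b} (\<lambda>s. \<bar>v s\<bar> powr p)" "continuous_on {a..b} (\<lambda>s. \<bar>v' s\<bar> powr p)"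
      using p by (auto intro!: continuous_on_powr' continuous_on_rabs cv v(2) continuous_on_const)
    have "\<forall>s\<in>{a..b}. \<tau> s \<noteq> 0" "\<forall>s\<in>{a..b}. w s \<noteq> 0" using \<tau>(2) w(1) by (metis less_irrefl)+
    then have [continuous_intros]: "continuous_on {a..b} (\<lambda>s. \<tau> s powr (- p))" "continuous_on {a..b} (\<lambda>s. w s powr (1 - p))"
      by (auto intro!: continuous_on_powr ct w(2) continuous_on_const)
    show "continuous_on {a..b} q" "continuous_on {a..b} d"
      unfolding q_def d_def by (intro continuous_intros w(2))+
  qed
  then show iq: "set_integrable lborel {a..b} q" and id: "set_integrable lborel {a..b} d"
    by (auto intro: borel_integrable_atLeastAtMost')
  define F where "F s = \<sigma> * (\<bar>v s\<bar> powr p * \<tau> s powr (1 - p))" for s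
  define f where "f s = \<sigma> * (p * \<bar>v s\<bar> powr (p - 1) * sgn (v s) * v' s * \<tau> s powr (1 - p)) - (p - 1) * q s" for s
  have \<sigma>2: "\<sigma> * \<sigma> = 1" using \<sigma> by auto
  have DF: "(F has_real_derivative f s) (at s)" if s: "s \<in> {a..b}" for s
  proof -
    have 1: "((\<lambda>s. \<bar>v s\<bar> powr p) has_real_derivative p * \<bar>v s\<bar> powr (p - 1) * sgn (v s) * v' s) (at s)"
      using DERIV_chain2[OF DERIV_abs_powr[OF p] v(1)[OF s]] .
    have 2: "((\<lambda>s. \<tau> s powr (1 - p)) has_real_derivative (1 - p) * \<tau> s powr (- p) * (\<sigma> * w s)) (at s)"
      using DERIV_chain2[OF has_real_derivative_powr \<tau>(1)[OF s], of "1 - p"] \<tau>(2)[OF s] by simp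
    have "(F has_real_derivative \<sigma> * (p * \<bar>v s\<bar> powr (p - 1) * sgn (v s) * v' s * \<tau> s powr (1 - p)
        + (1 - p) * \<tau> s powr (- p) * (\<sigma> * w s) * \<bar>v s\<bar> powr p)) (at s)"
      unfolding F_def by (intro DERIV_cmult DERIV_mult 1 2)
    also have "\<sigma> * (p * \<bar>v s\<bar> powr (p - 1) * sgn (v s) * v' s * \<tau> s powr (1 - p)
        + (1 - p) * \<tau> s powr (- p) * (\<sigma> * w s) * \<bar>v s\<bar> powr p)
      = \<sigma> * (p * \<bar>v s\<bar> powr (p - 1) * sgn (v s) * v' s * \<tau> s powr (1 - p)) + (\<sigma> * \<sigma>) * ((1 - p) * q s)"
      unfolding q_def by (simp add: algebra_simps)
    also have "\<dots> = f s" unfolding \<sigma>2 f_def by (simp add: left_diff_distrib)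
    finally show ?thesis .
  qed
  have cf: "continuous_on {a..b} f"
  proof -
    have "continuous_on UNIV (\<lambda>x::real. sgn x * \<bar>x\<bar> powr (p - 1))"
    proof (intro continuous_at_imp_continuous_on ballI)
      fix x :: real
      show "isCont (\<lambda>x. sgn x * \<bar>x\<bar> powr (p - 1)) x"
      proof (cases "x = 0")
        case True
        have "((\<lambda>h. sgn h * \<bar>h\<bar> powr (p - 1)) \<longlongrightarrow> 0) (at (0::real))"
        proof (rule tendsto_rabs_zero_cancel, rule Lim_transform_eventually[OF abs_powr_tendsto_0])
          show "\<forall>\<^sub>F h in at (0::real). \<bar>h\<bar> powr (p - 1) = \<bar>sgn h * \<bar>h\<bar> powr (p - 1)\<bar>"
            by (auto simp: eventually_at_filter abs_mult)
        qed (use p in simp)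
        then show ?thesis using True by (simp add: isCont_def)
      next
        case False
        then show ?thesis by (intro continuous_intros) auto
      qed
    qed
    then have c1: "continuous_on {a..b} (\<lambda>s. sgn (v s) * \<bar>v s\<bar> powr (p - 1))"
      by (rule continuous_on_compose2[OF _ cv]) auto
    have c2: "continuous_on {a..b} (\<lambda>s. \<tau> s powr (1 - p))"
    proof (intro continuous_on_powr ct continuous_on_const ballI)
      show "\<tau> s \<noteq> 0" if "s \<in> {a..b}" for s using \<tau>(2)[OF that] by simp
    qed
    have "continuous_on {a..b} (\<lambda>s. \<sigma> * (p * (sgn (v s) * \<bar>v s\<bar> powr (p - 1)) * v' s * \<tau> s powr (1 - p)) - (p - 1) * q s)"
      by (rule continuous_on_diff[OF continuous_on_mult[OF continuous_on_const continuous_on_mult[OF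
          continuous_on_mult[OF continuous_on_mult[OF continuous_on_const c1] v(2)] c2]] continuous_on_mult[OF continuous_on_const cq]])
    then show ?thesis unfolding f_def by (simp add: mult_ac)
  qed
  have "F b - F a = (LINT s:{a..b}|lborel. f s)"
    unfolding set_lebesgue_integral_def
    using DF by (intro integral_FTC_atLeastAtMost[symmetric] ab cf)
      (auto simp: has_real_derivative_iff_has_vector_derivative[symmetric] intro: has_field_derivative_at_within)
  also have "\<dots> \<le> (LINT s:{a..b}|lborel. c powr (1 - p) * d s + (p - 1) * c * q s - (p - 1) * q s)"
  proof (rule set_integral_mono)
    show "set_integrable lborel {a..b} f" using cf by (rule borel_integrable_atLeastAtMost')
    show "set_integrable lborel {a..b} (\<lambda>s. c powr (1 - p) * d s + (p - 1) * c * q s - (p - 1) * q s)"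
      by (intro borel_integrable_atLeastAtMost' continuous_intros cd cq)
    fix s assume s: "s \<in> {a..b}"
    note pos = \<tau>(2)[OF s] w(1)[OF s]
    have "\<sigma> * (p * \<bar>v s\<bar> powr (p - 1) * sgn (v s) * v' s * \<tau> s powr (1 - p)) \<le> p * \<bar>v s\<bar> powr (p - 1) * \<bar>v' s\<bar> * \<tau> s powr (1 - p)"
    proof -
      have "\<bar>\<sigma> * (p * \<bar>v s\<bar> powr (p - 1) * sgn (v s) * v' s * \<tau> s powr (1 - p))\<bar> \<le> p * \<bar>v s\<bar> powr (p - 1) * \<bar>v' s\<bar> * \<tau> s powr (1 - p)"
        using \<sigma> p by (cases "v s = 0") (auto simp: abs_mult)
      then show ?thesis by linarith
    qed
    also have "\<dots> = w s * (p * (\<bar>v' s\<bar> / w s) * (\<bar>v s\<bar> / \<tau> s) powr (p - 1))"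
      using pos by (simp add: powr_divide powr_diff field_simps)
    also have "\<dots> \<le> w s * (c powr (1 - p) * (\<bar>v' s\<bar> / w s) powr p + (p - 1) * c * (\<bar>v s\<bar> / \<tau> s) powr p)"
      using pos p c by (intro mult_left_mono young_weighted) auto
    also have "\<dots> = c powr (1 - p) * d s + (p - 1) * c * q s"
      using pos by (simp add: d_def q_def powr_divide powr_diff powr_minus field_simps)
    finally show "f s \<le> c powr (1 - p) * d s + (p - 1) * c * q s - (p - 1) * q s"
      by (simp add: f_def)
  qed
  also have "\<dots> = c powr (1 - p) * (LINT s:{a..b}|lborel. d s) + (p - 1) * c * (LINT s:{a..b}|lborel. q s) - (p - 1) * (LINT s:{a..b}|lborel. q s)"
    using iq id by (simp add: set_integral_diff set_integral_add)
  finally show "\<sigma> * (\<bar>v b\<bar> powr p * \<tau> b powr (1 - p) - \<bar>v a\<bar> powr p * \<tau> a powr (1 - p))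
      + (p - 1) * (LINT s:{a..b}|lborel. q s)
    \<le> c powr (1 - p) * (LINT s:{a..b}|lborel. d s) + (p - 1) * c * (LINT s:{a..b}|lborel. q s)"
    by (simp add: F_def algebra_simps)
qed

definition radial_derivative :: "('a::euclidean_space \<Rightarrow> real) \<Rightarrow> 'a \<Rightarrow> real" where
  "radial_derivative \<phi> x = (x \<bullet> grad \<phi> x) / norm x"

lemma radial_derivative_measurable[measurable_dest]:
  assumes "\<phi> \<in> test_functions \<Omega>"
  shows "radial_derivative \<phi> \<in> borel_measurable borel"
proof -
  have [measurable]: "grad \<phi> \<in> borel_measurable borel" using test_functions_measurable[OF assms] by auto
  show ?thesis unfolding radial_derivative_def[abs_def] by measurable
qed

lemma abs_radial_derivative_le: "\<bar>radial_derivative \<phi> x\<bar> \<le> norm (grad \<phi> x)"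
  using Cauchy_Schwarz_ineq2[of x "grad \<phi> x"]
  by (cases "x = 0") (auto simp: radial_derivative_def field_simps)

lemma radial_derivative_scaleR:
  "norm \<omega> = 1 \<Longrightarrow> s > 0 \<Longrightarrow> radial_derivative \<phi> (s *\<^sub>R \<omega>) = grad \<phi> (s *\<^sub>R \<omega>) \<bullet> \<omega>"
  by (simp add: radial_derivative_def inner_commute)

lemma DERIV_test_function_ray:
  assumes "\<phi> \<in> test_functions \<Omega>"
  shows "((\<lambda>s. \<phi> (s *\<^sub>R \<omega>)) has_real_derivative (grad \<phi> (s *\<^sub>R \<omega>) \<bullet> \<omega>)) (at s)"
proof -
  have "((\<lambda>s. s *\<^sub>R \<omega>) has_derivative (\<lambda>t. t *\<^sub>R \<omega>)) (at s)"
    by (auto intro!: derivative_eq_intros)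
  from diff_chain_at[OF this test_functions_has_derivative[OF assms]]
  have "((\<phi> \<circ> (\<lambda>s. s *\<^sub>R \<omega>)) has_derivative ((\<lambda>h. grad \<phi> (s *\<^sub>R \<omega>) \<bullet> h) \<circ> (\<lambda>t. t *\<^sub>R \<omega>))) (at s)" .
  moreover have "\<phi> \<circ> (\<lambda>s. s *\<^sub>R \<omega>) = (\<lambda>s. \<phi> (s *\<^sub>R \<omega>))"
    "((\<lambda>h. grad \<phi> (s *\<^sub>R \<omega>) \<bullet> h) \<circ> (\<lambda>t. t *\<^sub>R \<omega>)) = (*) (grad \<phi> (s *\<^sub>R \<omega>) \<bullet> \<omega>)"
    by (auto simp: fun_eq_iff)
  ultimately show ?thesis by (simp only: has_field_derivative_def)
qed

lemma continuous_on_test_function_ray: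
  assumes "\<phi> \<in> test_functions \<Omega>"
  shows "continuous_on S (\<lambda>s. grad \<phi> (s *\<^sub>R \<omega>) \<bullet> \<omega>)"
  by (intro continuous_intros continuous_on_compose2[OF test_functions_continuous_grad[OF assms]]) auto

lemma set_nn_integral_eq_LINT:
  fixes f :: "real \<Rightarrow> real"
  assumes "set_integrable lborel S f" "\<And>s. s \<in> S \<Longrightarrow> 0 \<le> f s"
  shows "(\<integral>\<^sup>+s. ennreal (f s) * indicator S s \<partial>lborel) = ennreal (LINT s:S|lborel. f s)"
proof -
  have "(\<integral>\<^sup>+s. ennreal (f s) * indicator S s \<partial>lborel) = (\<integral>\<^sup>+s. ennreal (indicator S s *\<^sub>R f s) \<partial>lborel)"
    by (intro nn_integral_cong) (auto simp: indicator_def)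
  also have "\<dots> = ennreal (LINT s:S|lborel. f s)"
    using assms unfolding set_integrable_def set_lebesgue_integral_def
    by (intro nn_integral_eq_integral) (auto simp: indicator_def)
  finally show ?thesis .
qed

text \<open>The substitution \<open>|\<tau>'| = s\<^bsup>m-1\<^esup>\<close> of \<open>hardy_on_interval\<close> produces exactly the weights of polar coordinates,
  since \<open>s\<^bsup>(m-1)(1-p)\<^esup> = s\<^bsup>n-1\<^esup>\<close>. The interval \<open>{a..b}\<close> is the part of \<open>I\<close> where \<open>\<phi>\<close> may differ from
  \<open>0\<close>, which keeps \<open>a\<close> away from the end points where \<open>\<tau>\<close> vanishes.\<close>

lemma hardy_on_ray:
  fixes \<phi> :: "'a::euclidean_space \<Rightarrow> real"
  assumes p: "p > 1" and c: "c > 0" and \<phi>: "\<phi> \<in> test_functions \<Omega>" and \<omega>: "norm \<omega> = 1"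
    and ab: "0 < a" "a \<le> b" and \<sigma>: "\<sigma> = 1 \<or> \<sigma> = -1" and m: "m * (p - 1) = p - real DIM('a)"
    and \<tau>: "\<And>s. s \<in> {a..b} \<Longrightarrow> (\<tau> has_real_derivative \<sigma> * s powr (m - 1)) (at s)" "\<And>s. s \<in> {a..b} \<Longrightarrow> \<tau> s > 0"
    and W: "\<And>s. s \<in> {a..b} \<Longrightarrow> s ^ (DIM('a) - 1) * W (s *\<^sub>R \<omega>) = \<tau> s powr (- p) * s powr (m - 1)"
    and I: "AE s in lborel. s \<in> {a..b} \<longrightarrow> s \<in> I"
      "\<And>s. s \<in> I \<Longrightarrow> s \<notin> {a..b} \<Longrightarrow> \<phi> (s *\<^sub>R \<omega>) = 0 \<and> grad \<phi> (s *\<^sub>R \<omega>) = 0"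
    and X: "0 \<le> X" "X \<le> \<sigma> * (\<bar>\<phi> (b *\<^sub>R \<omega>)\<bar> powr p * \<tau> b powr (1 - p) - \<bar>\<phi> (a *\<^sub>R \<omega>)\<bar> powr p * \<tau> a powr (1 - p))"
  defines "Q \<equiv> ray_integral I (\<lambda>x. \<bar>\<phi> x\<bar> powr p * W x) \<omega>"
    and "D \<equiv> ray_integral I (\<lambda>x. \<bar>radial_derivative \<phi> x\<bar> powr p) \<omega>"
  shows "ennreal X + ennreal (p - 1) * Q \<le> ennreal (c powr (1 - p)) * D + ennreal ((p - 1) * c) * Q"
proof -
  let ?v = "\<lambda>s. \<phi> (s *\<^sub>R \<omega>)" and ?v' = "\<lambda>s. grad \<phi> (s *\<^sub>R \<omega>) \<bullet> \<omega>" and ?w = "\<lambda>s. s powr (m - 1)"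
  let ?q = "\<lambda>s. \<bar>?v s\<bar> powr p * (\<tau> s powr (- p) * ?w s)" and ?d = "\<lambda>s. \<bar>?v' s\<bar> powr p * ?w s powr (1 - p)"
  have wpos: "?w s > 0" if "s \<in> {a..b}" for s using that ab by simp
  have cw: "continuous_on {a..b} ?w" using ab by (auto intro!: continuous_intros)
  note H = hardy_on_interval[OF p c ab(2) \<sigma> DERIV_test_function_ray[OF \<phi>, of \<omega>]
    continuous_on_test_function_ray[OF \<phi>, of _ \<omega>] \<tau>(1,2) wpos cw]
  have pos: "?q s \<ge> 0" "?d s \<ge> 0" if "s \<in> {a..b}" for s using wpos[OF that] by simp_all
  have n: "DIM('a) > 0" by simp
  have Q: "Q = ennreal (LINT s:{a..b}|lborel. ?q s)"
  proof -
    have "(\<integral>\<^sup>+s. ennreal (s ^ (DIM('a) - 1)) * ennreal (\<bar>\<phi> (s *\<^sub>R \<omega>)\<bar> powr p * W (s *\<^sub>R \<omega>)) * indicator I s \<partial>lborel)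
      = (\<integral>\<^sup>+s. ennreal (?q s) * indicator {a..b} s \<partial>lborel)"
      using I(1)
    proof (intro nn_integral_cong_AE, eventually_elim)
      case (elim s)
      show ?case
      proof (cases "s \<in> {a..b}")
        case True
        with ab have "0 \<le> s ^ (DIM('a) - 1)" by simp
        then have "ennreal (s ^ (DIM('a) - 1)) * ennreal (\<bar>\<phi> (s *\<^sub>R \<omega>)\<bar> powr p * W (s *\<^sub>R \<omega>)) = ennreal (s ^ (DIM('a) - 1) * (\<bar>\<phi> (s *\<^sub>R \<omega>)\<bar> powr p * W (s *\<^sub>R \<omega>)))"
          by (simp add: ennreal_mult')
        also have "s ^ (DIM('a) - 1) * (\<bar>\<phi> (s *\<^sub>R \<omega>)\<bar> powr p * W (s *\<^sub>R \<omega>)) = \<bar>\<phi> (s *\<^sub>R \<omega>)\<bar> powr p * (s ^ (DIM('a) - 1) * W (s *\<^sub>R \<omega>))"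
          by (simp only: mult_ac)
        finally show ?thesis using True elim W[OF True] by simp
      next
        case False
        then show ?thesis using I(2)[of s] p by (cases "s \<in> I") auto
      qed
    qed
    also have "\<dots> = ennreal (LINT s:{a..b}|lborel. ?q s)"
      by (rule set_nn_integral_eq_LINT[OF H(2)]) (use pos in auto)
    finally show ?thesis unfolding Q_def ray_integral_def .
  qed
  have D: "D = ennreal (LINT s:{a..b}|lborel. ?d s)"
  proof -
    have "(\<integral>\<^sup>+s. ennreal (s ^ (DIM('a) - 1)) * ennreal (\<bar>radial_derivative \<phi> (s *\<^sub>R \<omega>)\<bar> powr p) * indicator I s \<partial>lborel)
      = (\<integral>\<^sup>+s. ennreal (?d s) * indicator {a..b} s \<partial>lborel)"
      using I(1)
    proof (intro nn_integral_cong_AE, eventually_elim)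
      case (elim s)
      show ?case
      proof (cases "s \<in> {a..b}")
        case True
        with ab have s: "s > 0" by simp
        have "(m - 1) * (1 - p) = real (DIM('a) - 1)" using m n by (simp add: algebra_simps of_nat_diff)
        then have "?w s powr (1 - p) = s ^ (DIM('a) - 1)"
          unfolding powr_powr by (simp only: powr_realpow[OF s])
        then show ?thesis using True elim s
          by (simp add: radial_derivative_scaleR[OF \<omega>] ennreal_mult mult.commute)
      next
        case False
        then show ?thesis using I(2)[of s] p by (cases "s \<in> I") (auto simp: radial_derivative_def)
      qed
    qed
    also have "\<dots> = ennreal (LINT s:{a..b}|lborel. ?d s)"
      by (rule set_nn_integral_eq_LINT[OF H(3)]) (use pos in auto)
    finally show ?thesis unfolding D_def ray_integral_def .
  qed
  have nn: "0 \<le> (LINT s:{a..b}|lborel. ?q s)" "0 \<le> (LINT s:{a..b}|lborel. ?d s)"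
    using pos unfolding set_lebesgue_integral_def by (auto intro!: Bochner_Integration.integral_nonneg simp: indicator_def)
  have "X + (p - 1) * (LINT s:{a..b}|lborel. ?q s)
    \<le> c powr (1 - p) * (LINT s:{a..b}|lborel. ?d s) + (p - 1) * c * (LINT s:{a..b}|lborel. ?q s)"
    using H(1) X(2) by simp
  then have "ennreal (X + (p - 1) * (LINT s:{a..b}|lborel. ?q s))
    \<le> ennreal (c powr (1 - p) * (LINT s:{a..b}|lborel. ?d s) + (p - 1) * c * (LINT s:{a..b}|lborel. ?q s))"
    by (rule ennreal_leI)
  then show ?thesis unfolding Q D using X(1) p c nn by (simp add: ennreal_plus ennreal_mult)
qed


lemma hardy_exponents:
  fixes n p m r \<gamma> :: real
  assumes "1 < p" "p < n" "0 < r" "m = (p - n) / (p - 1)" "\<gamma> = 2 powr (1 / \<bar>m\<bar>) * r"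
  shows "m < 0" "m * (p - 1) = p - n" "r < \<gamma>" "\<gamma> powr m = r powr m / 2" "0 < \<gamma>"
proof -
  show m: "m < 0" "m * (p - 1) = p - n" using assms by (auto simp: divide_neg_pos)
  have "1 < 2 powr (1 / \<bar>m\<bar>)" using m by simp
  then show "r < \<gamma>" using assms(3) by (simp add: assms(5))
  then show "0 < \<gamma>" using assms(3) by simp
  have "1 / \<bar>m\<bar> * m = -1" using m by simp
  then have "(2 powr (1 / \<bar>m\<bar>)) powr m = (2::real) powr (-1)" by (simp add: powr_powr)
  then show "\<gamma> powr m = r powr m / 2" using assms(3) by (simp add: assms(5) powr_mult powr_minus)
qed

text \<open>The Hardy inequality on the region \<open>A\<close>, in the form in which it is proved for test functions. Extended
  nonnegative integrals make the terms meaningful before any of them is known to be finite.\<close>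

definition hardy_estimate ::
    "real \<Rightarrow> real \<Rightarrow> real \<Rightarrow> ('a::euclidean_space \<Rightarrow> real) \<Rightarrow> 'a set \<Rightarrow> ('a \<Rightarrow> real) \<Rightarrow> bool" where
  "hardy_estimate p \<kappa> \<gamma> W A \<phi> \<longleftrightarrow> (\<forall>c>0. ennreal \<kappa> * (\<integral>\<^sup>+x. ennreal (\<bar>\<phi> x\<bar> powr p) \<partial>sphere_measure \<gamma>)
      + ennreal (p - 1) * (\<integral>\<^sup>+x. ennreal (\<bar>\<phi> x\<bar> powr p * W x) * indicator A x \<partial>lborel)
    \<le> ennreal (c powr (1 - p)) * (\<integral>\<^sup>+x. ennreal (\<bar>radial_derivative \<phi> x\<bar> powr p) * indicator A x \<partial>lborel)
      + ennreal ((p - 1) * c) * (\<integral>\<^sup>+x. ennreal (\<bar>\<phi> x\<bar> powr p * W x) * indicator A x \<partial>lborel))"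

lemma hardy_assemble:
  fixes \<phi> W :: "'a::euclidean_space \<Rightarrow> real"
  assumes \<phi>: "\<phi> \<in> test_functions \<Omega>" and I[measurable]: "I \<in> sets borel" "I \<subseteq> {0<..}"
    and W[measurable]: "W \<in> borel_measurable borel" and \<gamma>: "\<gamma> > 0" and \<kappa>: "\<kappa> \<ge> 0"
    and ray: "\<And>\<omega> c. norm \<omega> = 1 \<Longrightarrow> c > 0 \<Longrightarrow>
      ennreal (\<kappa> * \<gamma> ^ (DIM('a) - 1) * \<bar>\<phi> (\<gamma> *\<^sub>R \<omega>)\<bar> powr p)
      + ennreal (p - 1) * ray_integral I (\<lambda>x. \<bar>\<phi> x\<bar> powr p * W x) \<omega>
      \<le> ennreal (c powr (1 - p)) * ray_integral I (\<lambda>x. \<bar>radial_derivative \<phi> x\<bar> powr p) \<omega>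
      + ennreal ((p - 1) * c) * ray_integral I (\<lambda>x. \<bar>\<phi> x\<bar> powr p * W x) \<omega>"
  shows "hardy_estimate p \<kappa> \<gamma> W {x. norm x \<in> I} \<phi>"
  unfolding hardy_estimate_def
proof (intro allI impI)
  fix c :: real assume c: "c > 0"
  let ?A = "{x::'a. norm x \<in> I}" and ?B = "ennreal (p - 1)" and ?C = "ennreal (c powr (1 - p))" and ?C' = "ennreal ((p - 1) * c)"
  have [measurable]: "\<phi> \<in> borel_measurable borel" "radial_derivative \<phi> \<in> borel_measurable borel"
    using test_functions_measurable[OF \<phi>] radial_derivative_measurable[OF \<phi>] by auto
  have 1: "(\<integral>\<^sup>+x. ennreal (\<bar>\<phi> x\<bar> powr p * W x) * indicator ?A x \<partial>lborel)
    = (\<integral>\<^sup>+\<omega>. ray_integral I (\<lambda>x. \<bar>\<phi> x\<bar> powr p * W x) \<omega> \<partial>sphere_measure 1)"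
    by (rule nn_integral_polar_radial_set[OF _ I]) measurable
  have 2: "(\<integral>\<^sup>+x. ennreal (\<bar>radial_derivative \<phi> x\<bar> powr p) * indicator ?A x \<partial>lborel)
    = (\<integral>\<^sup>+\<omega>. ray_integral I (\<lambda>x. \<bar>radial_derivative \<phi> x\<bar> powr p) \<omega> \<partial>sphere_measure 1)"
    by (rule nn_integral_polar_radial_set[OF _ I]) measurable
  have 3: "ennreal \<kappa> * (\<integral>\<^sup>+x. ennreal (\<bar>\<phi> x\<bar> powr p) \<partial>sphere_measure \<gamma>)
    = (\<integral>\<^sup>+\<omega>. ennreal (\<kappa> * \<gamma> ^ (DIM('a) - 1) * \<bar>\<phi> (\<gamma> *\<^sub>R \<omega>)\<bar> powr p) \<partial>sphere_measure 1)"
    using \<kappa> \<gamma> by (subst nn_integral_sphere_measure_unit)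
      (simp_all add: nn_integral_cmult[symmetric] ennreal_mult mult.assoc)
  have "(\<integral>\<^sup>+\<omega>. ennreal (\<kappa> * \<gamma> ^ (DIM('a) - 1) * \<bar>\<phi> (\<gamma> *\<^sub>R \<omega>)\<bar> powr p)
      + ?B * ray_integral I (\<lambda>x. \<bar>\<phi> x\<bar> powr p * W x) \<omega> \<partial>sphere_measure 1)
      \<le> (\<integral>\<^sup>+\<omega>. ?C * ray_integral I (\<lambda>x. \<bar>radial_derivative \<phi> x\<bar> powr p) \<omega>
      + ?C' * ray_integral I (\<lambda>x. \<bar>\<phi> x\<bar> powr p * W x) \<omega> \<partial>sphere_measure 1)"
    using AE_sphere_measure_norm[of 1, where 'a = 'a, OF zero_less_one]
  proof (intro nn_integral_mono_AE, eventually_elim)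
    case (elim \<omega>)
    show ?case by (rule ray[OF _ c]) (rule elim)
  qed
  then show "ennreal \<kappa> * (\<integral>\<^sup>+x. ennreal (\<bar>\<phi> x\<bar> powr p) \<partial>sphere_measure \<gamma>)
      + ?B * (\<integral>\<^sup>+x. ennreal (\<bar>\<phi> x\<bar> powr p * W x) * indicator ?A x \<partial>lborel)
    \<le> ?C * (\<integral>\<^sup>+x. ennreal (\<bar>radial_derivative \<phi> x\<bar> powr p) * indicator ?A x \<partial>lborel)
      + ?C' * (\<integral>\<^sup>+x. ennreal (\<bar>\<phi> x\<bar> powr p * W x) * indicator ?A x \<partial>lborel)"
    unfolding 1 2 3 by (simp add: nn_integral_add nn_integral_cmult)
qed

definition annulus_weight :: "real \<Rightarrow> real \<Rightarrow> real \<Rightarrow> 'a::euclidean_space \<Rightarrow> real" where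
  "annulus_weight p m r x = \<bar>m\<bar> powr p / (norm x powr ((real DIM('a) - 1) * (p / (p - 1))) *
        \<bar>norm x powr m - r powr m\<bar> powr p)"

definition exterior_weight :: "real \<Rightarrow> real \<Rightarrow> 'a::euclidean_space \<Rightarrow> real" where
  "exterior_weight p m x = \<bar>m\<bar> powr p / norm x powr p"

lemma weights_measurable[measurable]:
  "annulus_weight p m r \<in> borel_measurable borel" "exterior_weight p m \<in> borel_measurable borel"
  unfolding annulus_weight_def[abs_def] exterior_weight_def[abs_def] by measurable

lemma divide_powr_minus:
  fixes x M p :: real
  assumes "x \<ge> 0" "M \<ge> 0"
  shows "(x / M) powr (- p) = M powr p / x powr p"
  using assms by (simp add: powr_divide powr_minus divide_simps)

text \<open>The boundary term at \<open>s = \<gamma>\<close>. Both choices of \<open>\<tau>\<close> have the value \<open>\<gamma>\<^sup>m / |m|\<close> there, because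
  \<open>\<gamma>\<^sup>m = r\<^sup>m / 2\<close>, so that the two regions share the same constant.\<close>

lemma K0_factor:
  fixes p m \<gamma> :: real
  assumes "1 < p" "m < 0" "m * (p - 1) = p - real N" "0 < \<gamma>" "N > 0"
  shows "\<bar>m\<bar> powr (p - 1) * \<gamma> powr (1 - p) * \<gamma> ^ (N - 1) = (\<gamma> powr m / \<bar>m\<bar>) powr (1 - p)"
proof -
  have "(x / M) powr (1 - p) = x powr (1 - p) * M powr (p - 1)" if "x \<ge> 0" "M \<ge> 0" for x M :: real
    using that powr_minus_divide[of M "p - 1"] by (simp add: powr_divide)
  then have "(\<gamma> powr m / \<bar>m\<bar>) powr (1 - p) = \<gamma> powr (m * (1 - p)) * \<bar>m\<bar> powr (p - 1)"
    by (simp only: powr_ge_zero abs_ge_zero powr_powr)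
  also have "m * (1 - p) = (1 - p) + real (N - 1)" using assms by (simp add: algebra_simps of_nat_diff)
  also have "\<gamma> powr ((1 - p) + real (N - 1)) = \<gamma> powr (1 - p) * \<gamma> ^ (N - 1)"
    unfolding powr_add using assms(4) by (simp only: powr_realpow)
  finally show ?thesis by (simp add: mult_ac)
qed

lemma compact_subset_exterior_bounds:
  fixes C :: "'a::euclidean_space set"
  assumes "compact C" "C \<subseteq> exterior r" "r < \<gamma>"
  obtains a b where "r < a" "a < \<gamma>" "\<gamma> < b" "\<And>x. x \<in> C \<Longrightarrow> norm x \<in> {a<..<b}"
proof -
  obtain d where d: "d > r" "\<And>x. x \<in> C \<Longrightarrow> d \<le> norm x"
  proof (cases "C = {}")
    case False
    obtain y where y: "y \<in> C" "\<forall>x\<in>C. norm y \<le> norm x"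
      using continuous_attains_inf[OF assms(1) False, of norm] by (auto intro: continuous_intros)
    with assms(2) have "norm y > r" by (auto simp: exterior_def)
    with y show ?thesis by (intro that[of "norm y"]) auto
  qed (use that[of "r + 1"] in simp)
  obtain e where e: "\<And>x. x \<in> C \<Longrightarrow> norm x \<le> e" using compact_imp_bounded[OF assms(1)] by (auto simp: bounded_iff)
  show ?thesis
  proof (rule that)
    show "r < (r + min d \<gamma>) / 2" "(r + min d \<gamma>) / 2 < \<gamma>" "\<gamma> < max \<gamma> e + 1" using d(1) assms(3) by (auto simp: min_def)
    show "norm x \<in> {(r + min d \<gamma>) / 2<..<max \<gamma> e + 1}" if "x \<in> C" for x
      using d(1) d(2)[OF that] e[OF that] by (auto simp: min_def split: if_splits)
  qed
qed

lemma test_functions_exterior_support: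
  fixes \<phi> :: "'a::euclidean_space \<Rightarrow> real"
  assumes \<phi>: "\<phi> \<in> test_functions (exterior r)" and "r < \<gamma>"
  obtains a b where "r < a" "a < \<gamma>" "\<gamma> < b" "\<And>x. norm x \<le> a \<or> b \<le> norm x \<Longrightarrow> \<phi> x = 0 \<and> grad \<phi> x = 0"
proof -
  obtain K where K: "compact K" "K \<subseteq> exterior r" "\<And>x. x \<notin> K \<Longrightarrow> \<phi> x = 0" "\<And>x. x \<notin> K \<Longrightarrow> grad \<phi> x = 0"
    using test_functions_support[OF \<phi>] by metis
  obtain a b where ab: "r < a" "a < \<gamma>" "\<gamma> < b" "\<And>x. x \<in> K \<Longrightarrow> norm x \<in> {a<..<b}"
    using compact_subset_exterior_bounds[OF K(1,2) assms(2)] by metis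
  show ?thesis
  proof (rule that[OF ab(1-3)])
    fix x :: 'a assume "norm x \<le> a \<or> b \<le> norm x"
    then have "x \<notin> K" using ab(4)[of x] by auto
    then show "\<phi> x = 0 \<and> grad \<phi> x = 0" using K by blast
  qed
qed

lemma annulus_weight_ray:
  fixes \<omega> :: "'a::euclidean_space"
  assumes \<omega>: "norm \<omega> = 1" and s: "0 < r" "r < s" and p: "1 < p" and m: "m < 0" "m * (p - 1) = p - real DIM('a)"
  shows "s ^ (DIM('a) - 1) * annulus_weight p m r (s *\<^sub>R \<omega>) = \<bar>m\<bar> powr p * s powr (m - 1) / (r powr m - s powr m) powr p"
proof -
  have lt: "s powr m < r powr m" using s m(1) by (simp add: powr_less_mono2_neg)
  have e: "real (DIM('a) - 1) - (real DIM('a) - 1) * (p / (p - 1)) = m - 1"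
    using p m(2) by (simp add: field_simps of_nat_diff)
  have s0: "s > 0" using s by simp
  have "s ^ (DIM('a) - 1) = s powr real (DIM('a) - 1)" using s0 by (simp only: powr_realpow)
  then have "s ^ (DIM('a) - 1) * annulus_weight p m r (s *\<^sub>R \<omega>) = \<bar>m\<bar> powr p * (s powr real (DIM('a) - 1) / s powr ((real DIM('a) - 1) * (p / (p - 1)))) / (r powr m - s powr m) powr p"
    using lt s0 \<omega> by (simp add: annulus_weight_def)
  also have "\<dots> = \<bar>m\<bar> powr p * s powr (m - 1) / (r powr m - s powr m) powr p"
    unfolding powr_diff[symmetric] e ..
  finally show ?thesis .
qed

lemma exterior_weight_ray:
  fixes \<omega> :: "'a::euclidean_space"
  assumes \<omega>: "norm \<omega> = 1" and s: "0 < s" and m: "m * (p - 1) = p - real DIM('a)"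
  shows "s ^ (DIM('a) - 1) * exterior_weight p m (s *\<^sub>R \<omega>) = \<bar>m\<bar> powr p * s powr (m - 1) / (s powr m) powr p"
proof -
  have e: "real (DIM('a) - 1) - p = (m - 1) - m * p"
    using m by (simp add: algebra_simps of_nat_diff)
  have "s ^ (DIM('a) - 1) = s powr real (DIM('a) - 1)" using s by (simp only: powr_realpow)
  then have "s ^ (DIM('a) - 1) * exterior_weight p m (s *\<^sub>R \<omega>) = \<bar>m\<bar> powr p * (s powr real (DIM('a) - 1) / s powr p)"
    using s \<omega> by (simp add: exterior_weight_def)
  also have "\<dots> = \<bar>m\<bar> powr p * (s powr (m - 1) / s powr (m * p))"
    unfolding powr_diff[symmetric] e ..
  finally show ?thesis by (simp add: powr_powr)
qed

text \<open>Here \<open>\<tau> = (r\<^sup>m - s\<^sup>m) / |m|\<close> increases from \<open>0\<close> at \<open>s = r\<close>; the boundary term at the lower end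
  vanishes because \<open>\<phi>\<close> does.\<close>

lemma hardy_annulus:
  fixes \<phi> :: "'a::euclidean_space \<Rightarrow> real"
  assumes p: "1 < p" and r: "0 < r" "r < \<gamma>" and m: "m < 0" "m * (p - 1) = p - real DIM('a)"
    and \<gamma>: "\<gamma> powr m = r powr m / 2"
    and \<phi>: "\<phi> \<in> test_functions (exterior r)"
  shows "hardy_estimate p (\<bar>m\<bar> powr (p - 1) * \<gamma> powr (1 - p)) \<gamma> (annulus_weight p m r) {x. norm x \<in> {r<..<\<gamma>}} \<phi>"
proof (rule hardy_assemble[OF \<phi>])
  obtain a b where ab: "r < a" "a < \<gamma>" "\<And>x. norm x \<le> a \<Longrightarrow> \<phi> x = 0 \<and> grad \<phi> x = 0"
    using test_functions_exterior_support[OF \<phi> r(2)] by metis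
  define \<tau> where "\<tau> s = (r powr m - s powr m) / \<bar>m\<bar>" for s
  let ?W = "annulus_weight p m r"
  fix \<omega> :: 'a and c :: real assume \<omega>: "norm \<omega> = 1" and c: "c > 0"
  show "ennreal (\<bar>m\<bar> powr (p - 1) * \<gamma> powr (1 - p) * \<gamma> ^ (DIM('a) - 1) * \<bar>\<phi> (\<gamma> *\<^sub>R \<omega>)\<bar> powr p)
      + ennreal (p - 1) * ray_integral {r<..<\<gamma>} (\<lambda>x. \<bar>\<phi> x\<bar> powr p * ?W x) \<omega>
      \<le> ennreal (c powr (1 - p)) * ray_integral {r<..<\<gamma>} (\<lambda>x. \<bar>radial_derivative \<phi> x\<bar> powr p) \<omega>
      + ennreal ((p - 1) * c) * ray_integral {r<..<\<gamma>} (\<lambda>x. \<bar>\<phi> x\<bar> powr p * ?W x) \<omega>"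
  proof (rule hardy_on_ray[OF p c \<phi> \<omega>, where \<sigma> = 1 and \<tau> = \<tau> and m = m and a = a and b = \<gamma>])
    show "0 < a" "a \<le> \<gamma>" using ab r by auto
    show "m * (p - 1) = p - real DIM('a)" by (rule m)
    fix s assume s: "s \<in> {a..\<gamma>}"
    then have s0: "s > r" "s > 0" using ab r by auto
    show "(\<tau> has_real_derivative 1 * s powr (m - 1)) (at s)"
      unfolding \<tau>_def using s0 m(1) by (auto intro!: derivative_eq_intros simp: field_simps)
    have lt: "s powr m < r powr m" using s0 r m(1) by (simp add: powr_less_mono2_neg)
    then show "\<tau> s > 0" using m(1) unfolding \<tau>_def by (intro divide_pos_pos) auto
    have "s ^ (DIM('a) - 1) * ?W (s *\<^sub>R \<omega>) = \<bar>m\<bar> powr p * s powr (m - 1) / (r powr m - s powr m) powr p"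
      by (rule annulus_weight_ray[OF \<omega> r(1) s0(1) p m])
    also have "\<dots> = \<tau> s powr (- p) * s powr (m - 1)"
      using lt by (subst \<tau>_def, subst divide_powr_minus) simp_all
    finally show "s ^ (DIM('a) - 1) * ?W (s *\<^sub>R \<omega>) = \<tau> s powr (- p) * s powr (m - 1)" .
  next
    show "AE s in lborel. s \<in> {a..\<gamma>} \<longrightarrow> s \<in> {r<..<\<gamma>}"
      using AE_lborel_singleton[of \<gamma>] by eventually_elim (use ab in auto)
    show "\<phi> (s *\<^sub>R \<omega>) = 0 \<and> grad \<phi> (s *\<^sub>R \<omega>) = 0" if "s \<in> {r<..<\<gamma>}" "s \<notin> {a..\<gamma>}" for s
      using that ab r \<omega> by (intro ab(3)) auto
    have "\<tau> \<gamma> = \<gamma> powr m / \<bar>m\<bar>" using \<gamma> by (simp add: \<tau>_def)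
    moreover have "\<phi> (a *\<^sub>R \<omega>) = 0" using ab r \<omega> by simp
    ultimately show "\<bar>m\<bar> powr (p - 1) * \<gamma> powr (1 - p) * \<gamma> ^ (DIM('a) - 1) * \<bar>\<phi> (\<gamma> *\<^sub>R \<omega>)\<bar> powr p
      \<le> 1 * (\<bar>\<phi> (\<gamma> *\<^sub>R \<omega>)\<bar> powr p * \<tau> \<gamma> powr (1 - p) - \<bar>\<phi> (a *\<^sub>R \<omega>)\<bar> powr p * \<tau> a powr (1 - p))"
      using K0_factor[OF p m, of \<gamma>] r p by simp
  qed (use r in auto)
qed (use r in auto)

text \<open>Here \<open>\<tau> = s\<^sup>m / |m|\<close> decreases to \<open>0\<close> at infinity, which reverses the sign \<open>\<sigma>\<close> and makes the
  boundary term the one at the lower end.\<close>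

lemma hardy_exterior:
  fixes \<phi> :: "'a::euclidean_space \<Rightarrow> real"
  assumes p: "1 < p" and r: "0 < r" "r < \<gamma>" and m: "m < 0" "m * (p - 1) = p - real DIM('a)"
    and \<phi>: "\<phi> \<in> test_functions (exterior r)"
  shows "hardy_estimate p (\<bar>m\<bar> powr (p - 1) * \<gamma> powr (1 - p)) \<gamma> (exterior_weight p m) {x. norm x \<in> {\<gamma><..}} \<phi>"
proof (rule hardy_assemble[OF \<phi>])
  obtain a b where ab: "\<gamma> < b" "\<And>x. b \<le> norm x \<Longrightarrow> \<phi> x = 0 \<and> grad \<phi> x = 0"
    using test_functions_exterior_support[OF \<phi> r(2)] by metis
  define \<tau> where "\<tau> s = s powr m / \<bar>m\<bar>" for s
  let ?W = "exterior_weight p m"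
  fix \<omega> :: 'a and c :: real assume \<omega>: "norm \<omega> = 1" and c: "c > 0"
  show "ennreal (\<bar>m\<bar> powr (p - 1) * \<gamma> powr (1 - p) * \<gamma> ^ (DIM('a) - 1) * \<bar>\<phi> (\<gamma> *\<^sub>R \<omega>)\<bar> powr p)
      + ennreal (p - 1) * ray_integral {\<gamma><..} (\<lambda>x. \<bar>\<phi> x\<bar> powr p * ?W x) \<omega>
      \<le> ennreal (c powr (1 - p)) * ray_integral {\<gamma><..} (\<lambda>x. \<bar>radial_derivative \<phi> x\<bar> powr p) \<omega>
      + ennreal ((p - 1) * c) * ray_integral {\<gamma><..} (\<lambda>x. \<bar>\<phi> x\<bar> powr p * ?W x) \<omega>"
  proof (rule hardy_on_ray[OF p c \<phi> \<omega>, where \<sigma> = "-1" and \<tau> = \<tau> and m = m and a = \<gamma> and b = b])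
    show "0 < \<gamma>" "\<gamma> \<le> b" using ab r by auto
    show "m * (p - 1) = p - real DIM('a)" by (rule m)
    fix s assume s: "s \<in> {\<gamma>..b}"
    then have s0: "s > 0" using r by auto
    show "(\<tau> has_real_derivative -1 * s powr (m - 1)) (at s)"
      unfolding \<tau>_def using s0 m(1) by (auto intro!: derivative_eq_intros simp: field_simps)
    show "\<tau> s > 0" using m(1) s0 unfolding \<tau>_def by (intro divide_pos_pos) auto
    have "s ^ (DIM('a) - 1) * ?W (s *\<^sub>R \<omega>) = \<bar>m\<bar> powr p * s powr (m - 1) / (s powr m) powr p"
      by (rule exterior_weight_ray[OF \<omega> s0 m(2)])
    also have "\<dots> = \<tau> s powr (- p) * s powr (m - 1)"
      by (subst \<tau>_def, subst divide_powr_minus) simp_all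
    finally show "s ^ (DIM('a) - 1) * ?W (s *\<^sub>R \<omega>) = \<tau> s powr (- p) * s powr (m - 1)" .
  next
    show "AE s in lborel. s \<in> {\<gamma>..b} \<longrightarrow> s \<in> {\<gamma><..}"
      using AE_lborel_singleton[of \<gamma>] by eventually_elim auto
    show "\<phi> (s *\<^sub>R \<omega>) = 0 \<and> grad \<phi> (s *\<^sub>R \<omega>) = 0" if "s \<in> {\<gamma><..}" "s \<notin> {\<gamma>..b}" for s
      using that ab r \<omega> by (intro ab(2)) auto
    have "\<phi> (b *\<^sub>R \<omega>) = 0" using ab r \<omega> by simp
    then show "\<bar>m\<bar> powr (p - 1) * \<gamma> powr (1 - p) * \<gamma> ^ (DIM('a) - 1) * \<bar>\<phi> (\<gamma> *\<^sub>R \<omega>)\<bar> powr p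
      \<le> -1 * (\<bar>\<phi> (b *\<^sub>R \<omega>)\<bar> powr p * \<tau> b powr (1 - p) - \<bar>\<phi> (\<gamma> *\<^sub>R \<omega>)\<bar> powr p * \<tau> \<gamma> powr (1 - p))"
      using K0_factor[OF p m, of \<gamma>] r p by (simp add: \<tau>_def)
  qed (use r in auto)
qed (use r in auto)

section \<open>Convergence of p-th power integrals\<close>

lemma powr_convex_combination:
  fixes x y p \<theta> :: real
  assumes p: "p \<ge> 1" and xy: "x \<ge> 0" "y \<ge> 0" and \<theta>: "0 < \<theta>" "\<theta> < 1"
  shows "((1 - \<theta>) * x + \<theta> * y) powr p \<le> (1 - \<theta>) * x powr p + \<theta> * y powr p"
proof -
  have le: "t powr p \<le> t" if "0 < t" "t < 1" for t :: real
    using that p powr_mono'[of 1 p t] by simp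
  consider "x = 0" | "y = 0" | "x > 0" "y > 0" using xy by linarith
  then show ?thesis
  proof cases
    case 1
    then show ?thesis using xy \<theta> le[OF \<theta>] by (simp add: powr_mult mult_right_mono)
  next
    case 2
    then show ?thesis using xy \<theta> le[of "1 - \<theta>"] by (simp add: powr_mult mult_right_mono)
  next
    case 3
    then show ?thesis
      using convex_onD[OF powr_convex[OF p], of \<theta> x y] \<theta> by simp
  qed
qed

text \<open>Convexity of \<open>t\<^sup>p\<close>. Letting \<open>\<theta>\<close> tend to \<open>0\<close> it does the work of Minkowski's inequality.\<close>

lemma norm_powr_triangle:
  fixes a b :: "'b::real_normed_vector" and p \<theta> :: real
  assumes p: "p \<ge> 1" and \<theta>: "0 < \<theta>" "\<theta> < 1"
  shows "norm a powr p \<le> (1 - \<theta>) powr (1 - p) * norm b powr p + \<theta> powr (1 - p) * norm (a - b) powr p"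
proof -
  have "norm a \<le> norm b + norm (a - b)" using norm_triangle_ineq[of b "a - b"] by simp
  also have "\<dots> = (1 - \<theta>) * (norm b / (1 - \<theta>)) + \<theta> * (norm (a - b) / \<theta>)" using \<theta> by simp
  finally have "norm a powr p \<le> ((1 - \<theta>) * (norm b / (1 - \<theta>)) + \<theta> * (norm (a - b) / \<theta>)) powr p"
    using p by (intro powr_mono2) auto
  also have "\<dots> \<le> (1 - \<theta>) * (norm b / (1 - \<theta>)) powr p + \<theta> * (norm (a - b) / \<theta>) powr p"
    using p \<theta> by (intro powr_convex_combination) auto
  also have "\<dots> = (1 - \<theta>) powr (1 - p) * norm b powr p + \<theta> powr (1 - p) * norm (a - b) powr p"
    using \<theta> by (simp add: powr_divide powr_diff)
  finally show ?thesis .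
qed

lemma norm_powr_triangle_half:
  fixes a b :: "'b::real_normed_vector" and p :: real
  assumes p: "p \<ge> 1"
  shows "norm (a - b) powr p \<le> 2 powr (p - 1) * (norm a powr p + norm b powr p)"
proof -
  have "(1 / 2::real) powr (1 - p) = 2 powr (p - 1)" by (simp add: powr_divide powr_diff)
  then show ?thesis using norm_powr_triangle[OF p, of "1 / 2" "a - b" a] by (simp add: distrib_left)
qed

lemma integrable_powr_diff:
  fixes f g :: "'c \<Rightarrow> 'b::euclidean_space"
  assumes p: "p \<ge> 1" and [measurable]: "f \<in> borel_measurable M" "g \<in> borel_measurable M"
    and f: "integrable M (\<lambda>x. norm (f x) powr p)" and g: "integrable M (\<lambda>x. norm (g x) powr p)"
  shows "integrable M (\<lambda>x. norm (f x - g x) powr p)"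
proof (rule Bochner_Integration.integrable_bound)
  show "integrable M (\<lambda>x. 2 powr (p - 1) * (norm (f x) powr p + norm (g x) powr p))" using f g by simp
  show "AE x in M. norm (norm (f x - g x) powr p) \<le> norm (2 powr (p - 1) * (norm (f x) powr p + norm (g x) powr p))"
    using norm_powr_triangle_half[OF p] by (intro AE_I2) simp
qed measurable

lemma Lp_norm_tendsto:
  fixes f :: "'c \<Rightarrow> real" and F :: "nat \<Rightarrow> 'c \<Rightarrow> real"
  assumes p: "p \<ge> 1" and [measurable]: "f \<in> borel_measurable M" "\<And>k. F k \<in> borel_measurable M"
    and F: "\<And>k. integrable M (\<lambda>x. \<bar>F k x\<bar> powr p)"
    and D: "\<And>k. integrable M (\<lambda>x. \<bar>F k x - f x\<bar> powr p)"
    and lim: "(\<lambda>k. LINT x|M. \<bar>F k x - f x\<bar> powr p) \<longlonglongrightarrow> 0"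
  shows "integrable M (\<lambda>x. \<bar>f x\<bar> powr p)"
    "(\<lambda>k. LINT x|M. \<bar>F k x\<bar> powr p) \<longlonglongrightarrow> (LINT x|M. \<bar>f x\<bar> powr p)"
proof -
  show f: "integrable M (\<lambda>x. \<bar>f x\<bar> powr p)"
    using integrable_powr_diff[OF p, of "F 0" M "\<lambda>x. F 0 x - f x"] F[of 0] D[of 0] by simp
  define I where "I = (LINT x|M. \<bar>f x\<bar> powr p)"
  define J where "J k = (LINT x|M. \<bar>F k x\<bar> powr p)" for k
  define E where "E k = (LINT x|M. \<bar>F k x - f x\<bar> powr p)" for k
  have 1: "J k \<le> (1 - \<theta>) powr (1 - p) * I + \<theta> powr (1 - p) * E k"
    and 2: "I \<le> (1 - \<theta>) powr (1 - p) * J k + \<theta> powr (1 - p) * E k" if \<theta>: "0 < \<theta>" "\<theta> < 1" for \<theta> k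
  proof -
    have "J k \<le> (LINT x|M. (1 - \<theta>) powr (1 - p) * \<bar>f x\<bar> powr p + \<theta> powr (1 - p) * \<bar>F k x - f x\<bar> powr p)"
      unfolding J_def using F f D norm_powr_triangle[OF p \<theta>, of "F k _" "f _"] by (intro integral_mono) auto
    then show "J k \<le> (1 - \<theta>) powr (1 - p) * I + \<theta> powr (1 - p) * E k"
      using f D by (simp add: I_def E_def)
    have "I \<le> (LINT x|M. (1 - \<theta>) powr (1 - p) * \<bar>F k x\<bar> powr p + \<theta> powr (1 - p) * \<bar>F k x - f x\<bar> powr p)"
      unfolding I_def using F f D norm_powr_triangle[OF p \<theta>, of "f _" "F k _"]
      by (intro integral_mono) (auto simp: abs_minus_commute)
    then show "I \<le> (1 - \<theta>) powr (1 - p) * J k + \<theta> powr (1 - p) * E k"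
      using F D by (simp add: J_def E_def)
  qed
  have E: "(\<lambda>k. \<theta> powr (1 - p) * E k) \<longlonglongrightarrow> 0" for \<theta>
    using tendsto_mult_left[OF lim, of "\<theta> powr (1 - p)"] by (simp add: E_def)
  have \<theta>01: "\<forall>\<^sub>F \<theta> in at_right 0. 0 < \<theta> \<and> \<theta> < (1::real)"
    using eventually_at_right_real[of 0 "1::real"] by (auto elim: eventually_mono)
  have c: "((\<lambda>\<theta>. (1 - \<theta>) powr (1 - p)) \<longlongrightarrow> 1) (at_right 0)"
  proof -
    have "((\<lambda>\<theta>. (1 - \<theta>) powr (1 - p)) \<longlongrightarrow> (1 - 0) powr (1 - p)) (at_right 0)"
      by (intro tendsto_intros) auto
    then show ?thesis by simp
  qed
  have "J \<longlonglongrightarrow> I"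
  proof (rule order_tendstoI)
    fix y assume y: "I < y"
    have "((\<lambda>\<theta>. (1 - \<theta>) powr (1 - p) * I) \<longlongrightarrow> 1 * I) (at_right 0)"
      by (intro tendsto_mult c tendsto_const)
    then have "\<forall>\<^sub>F \<theta> in at_right 0. (1 - \<theta>) powr (1 - p) * I < y" using y by (intro order_tendstoD(2)) auto
    from eventually_happens[OF eventually_conj[OF this \<theta>01]]
    obtain \<theta> where \<theta>: "0 < \<theta>" "\<theta> < 1" "(1 - \<theta>) powr (1 - p) * I < y" by auto
    have "(\<lambda>k. (1 - \<theta>) powr (1 - p) * I + \<theta> powr (1 - p) * E k) \<longlonglongrightarrow> (1 - \<theta>) powr (1 - p) * I + 0"
      by (intro tendsto_add tendsto_const E)
    then have "\<forall>\<^sub>F k in sequentially. (1 - \<theta>) powr (1 - p) * I + \<theta> powr (1 - p) * E k < y"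
      using \<theta> by (intro order_tendstoD(2)) auto
    then show "\<forall>\<^sub>F k in sequentially. J k < y"
      by eventually_elim (use 1[OF \<theta>(1,2)] in \<open>rule le_less_trans\<close>)
  next
    fix y assume y: "y < I"
    have "((\<lambda>\<theta>. (1 - \<theta>) powr (1 - p) * y) \<longlongrightarrow> 1 * y) (at_right 0)"
      by (intro tendsto_mult c tendsto_const)
    then have "\<forall>\<^sub>F \<theta> in at_right 0. (1 - \<theta>) powr (1 - p) * y < I" using y by (intro order_tendstoD(2)) auto
    from eventually_happens[OF eventually_conj[OF this \<theta>01]]
    obtain \<theta> where \<theta>: "0 < \<theta>" "\<theta> < 1" "(1 - \<theta>) powr (1 - p) * y < I" by auto
    have "(\<lambda>k. (1 - \<theta>) powr (1 - p) * y + \<theta> powr (1 - p) * E k) \<longlonglongrightarrow> (1 - \<theta>) powr (1 - p) * y + 0"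
      by (intro tendsto_add tendsto_const E)
    then have "\<forall>\<^sub>F k in sequentially. (1 - \<theta>) powr (1 - p) * y + \<theta> powr (1 - p) * E k < I"
      using \<theta> by (intro order_tendstoD(2)) auto
    then show "\<forall>\<^sub>F k in sequentially. y < J k"
    proof eventually_elim
      case (elim k)
      with 2[OF \<theta>(1,2), of k] have "(1 - \<theta>) powr (1 - p) * y < (1 - \<theta>) powr (1 - p) * J k" by linarith
      then show ?case using \<theta> by (simp add: mult_less_cancel_left_pos)
    qed
  qed
  then show "(\<lambda>k. LINT x|M. \<bar>F k x\<bar> powr p) \<longlonglongrightarrow> (LINT x|M. \<bar>f x\<bar> powr p)"
    by (simp add: J_def[abs_def] I_def)
qed

section \<open>The Hardy inequality for Sobolev functions\<close>

text \<open>A family of inequalities that are linear in \<open>k\<^sub>0\<close>, \<open>k\<^sub>1\<close> and \<open>a\<close> is optimised over \<open>c\<close>.\<close>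

lemma hardy_summand_le:
  fixes p k0 k1 a :: real
  assumes p: "1 < p" and k: "0 \<le> k0" "0 \<le> k1" "0 \<le> a"
    and ineq: "\<And>c. c > 0 \<Longrightarrow> k0 + (p - 1) * k1 \<le> c powr (1 - p) * a + (p - 1) * c * k1"
  shows "(1 / p) powr p * hardy_summand p k0 k1 \<le> a"
proof (cases "k1 = 0")
  case False
  define S where "S = k0 + (p - 1) * k1"
  have k1: "k1 > 0" using False k by simp
  have S: "S > 0" using k1 p k by (simp add: S_def add_nonneg_pos)
  \<comment> \<open>the optimal constant in Young's inequality\<close>
  define c where "c = S / (p * k1)"
  have c: "c > 0" using S k1 p by (simp add: c_def)
  have "(p - 1) * c * k1 = (p - 1) / p * S" using k1 p by (simp add: c_def)
  then have "S \<le> c powr (1 - p) * a + (p - 1) / p * S" using ineq[OF c] by (simp add: S_def)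
  then have "S / p \<le> c powr (1 - p) * a" using p by (simp add: field_simps)
  then have "c powr (p - 1) * (S / p) \<le> c powr (p - 1) * (c powr (1 - p) * a)"
    by (intro mult_left_mono) auto
  also have "\<dots> = a" using c by (simp add: powr_diff)
  also have "c powr (p - 1) * (S / p) = (1 / p) powr p * (S powr p / k1 powr (p - 1))"
    using S k1 p by (simp add: c_def powr_divide powr_mult powr_diff)
  finally show ?thesis using False by (simp add: hardy_summand_def S_def)
qed (use k in \<open>simp add: hardy_summand_def\<close>)

text \<open>Membership in \<open>L_p\<close> only gives Lebesgue measurability on \<open>\<Omega>\<close>, whereas polar coordinates need Borel
  functions on the whole space; \<open>U\<close> and \<open>H\<close> replace \<open>u\<close> and its weak radial derivative, extended by zero.\<close>

definition radial_representative ::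
    "'a::euclidean_space set \<Rightarrow> ('a \<Rightarrow> real) \<Rightarrow> ('a \<Rightarrow> real) \<Rightarrow> ('a \<Rightarrow> real) \<Rightarrow> bool" where
  "radial_representative \<Omega> u U H \<longleftrightarrow> U \<in> borel_measurable borel \<and> H \<in> borel_measurable borel \<and>
     (AE x in lebesgue. U x = indicator \<Omega> x * u x) \<and>
     (AE x in lebesgue. H x = indicator \<Omega> x * ((x \<bullet> weak_gradient \<Omega> u x) / norm x))"

lemma borel_measurable_lebesgue_AE:
  fixes f g :: "'a::euclidean_space \<Rightarrow> 'b::topological_space"
  assumes g: "g \<in> borel_measurable lebesgue" and ae: "AE x in lebesgue. f x = g x"
  shows "f \<in> borel_measurable lebesgue"
proof (rule measurableI)
  fix S :: "'b set" assume S: "S \<in> sets borel"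
  obtain N where N: "N \<in> null_sets lebesgue" "{x. f x \<noteq> g x} \<subseteq> N"
  proof -
    from ae[unfolded eventually_ae_filter] obtain N where "N \<in> null_sets lebesgue" "{x \<in> space lebesgue. f x \<noteq> g x} \<subseteq> N"
      by blast
    with that show ?thesis by simp
  qed
  have "f -` S \<inter> N \<in> null_sets lebesgue"
    by (rule null_sets_completion_subset[OF Int_lower2 N(1)])
  moreover have "g -` S \<in> sets lebesgue" using measurable_sets[OF g S] by simp
  moreover have "f -` S = (g -` S - N) \<union> (f -` S \<inter> N)" using N(2) by auto
  ultimately have "f -` S \<in> sets lebesgue"
    using N(1) by (metis null_setsD2 sets.Diff sets.Un)
  then show "f -` S \<inter> space lebesgue \<in> sets lebesgue" by simp
qed simp

lemma L_p_AE:
  fixes f g :: "'a::euclidean_space \<Rightarrow> 'b::euclidean_space"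
  assumes g: "g \<in> L_p \<Omega> p" and ae: "AE x in lebesgue. x \<in> \<Omega> \<longrightarrow> f x = g x"
  shows "f \<in> L_p \<Omega> p"
    "(LINT x:\<Omega>|lebesgue. norm (f x) powr p) = (LINT x:\<Omega>|lebesgue. norm (g x) powr p)"
proof -
  have gm: "(\<lambda>x. indicator \<Omega> x *\<^sub>R g x) \<in> borel_measurable lebesgue"
    and gi: "integrable lebesgue (\<lambda>x. indicator \<Omega> x *\<^sub>R norm (g x) powr p)"
    using g by (auto simp: L_p_def set_borel_measurable_def set_integrable_def)
  have "AE x in lebesgue. indicator \<Omega> x *\<^sub>R f x = indicator \<Omega> x *\<^sub>R g x"
    using ae by eventually_elim (auto simp: indicator_def)
  then have fm: "(\<lambda>x. indicator \<Omega> x *\<^sub>R f x) \<in> borel_measurable lebesgue"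
    by (rule borel_measurable_lebesgue_AE[OF gm])
  have ae': "AE x in lebesgue. indicator \<Omega> x *\<^sub>R norm (f x) powr p = indicator \<Omega> x *\<^sub>R norm (g x) powr p"
    using ae by eventually_elim (auto simp: indicator_def)
  then have fp: "(\<lambda>x. indicator \<Omega> x *\<^sub>R norm (f x) powr p) \<in> borel_measurable lebesgue"
    by (rule borel_measurable_lebesgue_AE[OF borel_measurable_integrable[OF gi]])
  have "integrable lebesgue (\<lambda>x. indicator \<Omega> x *\<^sub>R norm (f x) powr p)"
    using integrable_cong_AE[OF fp borel_measurable_integrable[OF gi] ae'] gi by blast
  then show "f \<in> L_p \<Omega> p"
    using fm by (simp add: L_p_def set_borel_measurable_def set_integrable_def)
  show "(LINT x:\<Omega>|lebesgue. norm (f x) powr p) = (LINT x:\<Omega>|lebesgue. norm (g x) powr p)"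
    unfolding set_lebesgue_integral_def
    by (rule integral_cong_AE[OF fp borel_measurable_integrable[OF gi] ae'])
qed

lemma L_p_diff:
  fixes f g :: "'a::euclidean_space \<Rightarrow> 'b::euclidean_space"
  assumes p: "p \<ge> 1" and "f \<in> L_p \<Omega> p" "g \<in> L_p \<Omega> p"
  shows "(\<lambda>x. f x - g x) \<in> L_p \<Omega> p"
proof -
  have m: "(\<lambda>x. indicator \<Omega> x *\<^sub>R f x) \<in> borel_measurable lebesgue" "(\<lambda>x. indicator \<Omega> x *\<^sub>R g x) \<in> borel_measurable lebesgue"
    and i: "integrable lebesgue (\<lambda>x. indicator \<Omega> x *\<^sub>R norm (f x) powr p)" "integrable lebesgue (\<lambda>x. indicator \<Omega> x *\<^sub>R norm (g x) powr p)"
    using assms(2,3) by (auto simp: L_p_def set_borel_measurable_def set_integrable_def)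
  have eq: "indicator \<Omega> x *\<^sub>R norm (h x) powr p = norm (indicator \<Omega> x *\<^sub>R h x) powr p" for h :: "'a \<Rightarrow> 'b" and x
    using p by (auto simp: indicator_def)
  have d: "indicator \<Omega> x *\<^sub>R (f x - g x) = indicator \<Omega> x *\<^sub>R f x - indicator \<Omega> x *\<^sub>R g x" for x
    by (rule scaleR_diff_right)
  have "integrable lebesgue (\<lambda>x. norm (indicator \<Omega> x *\<^sub>R f x - indicator \<Omega> x *\<^sub>R g x) powr p)"
    using i unfolding eq by (intro integrable_powr_diff p m)
  moreover have "(\<lambda>x. indicator \<Omega> x *\<^sub>R f x - indicator \<Omega> x *\<^sub>R g x) \<in> borel_measurable lebesgue"
    by (intro borel_measurable_diff m)
  ultimately show ?thesis
    unfolding L_p_def set_borel_measurable_def set_integrable_def mem_Collect_eq eq d by blast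
qed

lemma L_p_compact_support:
  fixes f :: "'a::euclidean_space \<Rightarrow> 'b::euclidean_space"
  assumes \<Omega>: "open \<Omega>" and K: "compact K" "\<And>x. x \<notin> K \<Longrightarrow> f x = 0"
    and f[measurable]: "f \<in> borel_measurable borel" and B: "\<And>x. norm (f x) \<le> B" and p: "p > 0"
  shows "f \<in> L_p \<Omega> p"
proof -
  have [measurable]: "\<Omega> \<in> sets borel" using \<Omega> by simp
  have m: "(\<lambda>x. indicator \<Omega> x *\<^sub>R f x) \<in> borel_measurable borel" by measurable
  have m': "(\<lambda>x. indicator \<Omega> x *\<^sub>R norm (f x) powr p) \<in> borel_measurable borel" by measurable
  have "integrable lborel (\<lambda>x. indicator \<Omega> x *\<^sub>R norm (f x) powr p)"
  proof (rule integrable_on_compact_support[OF K(1) m'])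
    show "norm (indicator \<Omega> x *\<^sub>R norm (f x) powr p) \<le> B powr p" for x
      using B[of x] p by (auto simp: indicator_def intro!: powr_mono2)
  qed (use K(2) in simp)
  then have "integrable lebesgue (\<lambda>x. indicator \<Omega> x *\<^sub>R norm (f x) powr p)"
    using m' by (subst integrable_completion) auto
  moreover have "(\<lambda>x. indicator \<Omega> x *\<^sub>R f x) \<in> borel_measurable lebesgue"
    using m by (intro measurable_completion) simp
  ultimately show ?thesis by (simp add: L_p_def set_borel_measurable_def set_integrable_def)
qed

lemma test_functions_L_p:
  assumes "open \<Omega>" "\<phi> \<in> test_functions \<Omega>" "p > 0"
  shows "\<phi> \<in> L_p \<Omega> p" "grad \<phi> \<in> L_p \<Omega> p"
proof -
  obtain K where K: "compact K" "\<And>x. x \<notin> K \<Longrightarrow> \<phi> x = 0" "\<And>x. x \<notin> K \<Longrightarrow> grad \<phi> x = 0"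
    using test_functions_support[OF assms(2)] by metis
  obtain B where B: "\<And>x. \<bar>\<phi> x\<bar> \<le> B" "\<And>x. norm (grad \<phi> x) \<le> B"
    using test_functions_bounded[OF assms(2)] by metis
  show "\<phi> \<in> L_p \<Omega> p"
    by (rule L_p_compact_support[OF assms(1) K(1,2) test_functions_measurable(1)[OF assms(2)] _ assms(3)])
      (use B in auto)
  show "grad \<phi> \<in> L_p \<Omega> p"
    by (rule L_p_compact_support[OF assms(1) K(1,3) test_functions_measurable(2)[OF assms(2)] B(2) assms(3)])
qed

lemma W1p_weak_gradient:
  assumes "open \<Omega>" "u \<in> W1p \<Omega> p"
  shows "is_weak_gradient \<Omega> u (weak_gradient \<Omega> u)" "weak_gradient \<Omega> u \<in> L_p \<Omega> p" "u \<in> L_p \<Omega> p"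
proof -
  obtain g where g: "is_weak_gradient \<Omega> u g" "g \<in> L_p \<Omega> p" "u \<in> L_p \<Omega> p" using assms by (auto simp: W1p_def)
  show "is_weak_gradient \<Omega> u (weak_gradient \<Omega> u)"
    unfolding weak_gradient_def by (rule someI[of _ g]) (rule g)
  show "weak_gradient \<Omega> u \<in> L_p \<Omega> p"
    by (rule L_p_AE[OF g(2) weak_gradient_AE_eq[OF assms(1) g(1)]])
  show "u \<in> L_p \<Omega> p" by (rule g)
qed

text \<open>The norm refers to the weak gradient chosen for \<open>u - \<phi>\<close>. By uniqueness it is
  almost everywhere the difference of the gradients of \<open>u\<close> and of \<open>\<phi>\<close>.\<close>

lemma W1p_norm_tendsto_0D:
  assumes \<Omega>: "open \<Omega>" and u: "u \<in> W1p \<Omega> p" and p: "p > 1"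
    and \<phi>: "\<And>k. \<phi> k \<in> test_functions \<Omega>" and lim: "(\<lambda>k. W1p_norm \<Omega> p (\<lambda>x. u x - \<phi> k x)) \<longlonglongrightarrow> 0"
  shows "(\<lambda>k. LINT x:\<Omega>|lebesgue. \<bar>u x - \<phi> k x\<bar> powr p) \<longlonglongrightarrow> 0"
    "(\<lambda>k. LINT x:\<Omega>|lebesgue. norm (weak_gradient \<Omega> u x - grad (\<phi> k) x) powr p) \<longlonglongrightarrow> 0"
proof -
  define S where "S k = (LINT x:\<Omega>|lebesgue. \<bar>u x - \<phi> k x\<bar> powr p)" for k
  define T where "T k = (LINT x:\<Omega>|lebesgue. norm (weak_gradient \<Omega> u x - grad (\<phi> k) x) powr p)" for k
  have nn: "S k \<ge> 0" "T k \<ge> 0" for k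
    unfolding S_def T_def set_lebesgue_integral_def by (auto intro!: Bochner_Integration.integral_nonneg)
  have T: "(LINT x:\<Omega>|lebesgue. norm (weak_gradient \<Omega> (\<lambda>x. u x - \<phi> k x) x) powr p) = T k" for k
    unfolding T_def
  proof (rule L_p_AE)
    show "(\<lambda>x. weak_gradient \<Omega> u x - grad (\<phi> k) x) \<in> L_p \<Omega> p"
      using p by (intro L_p_diff W1p_weak_gradient[OF \<Omega> u] test_functions_L_p[OF \<Omega> \<phi>]) auto
    show "AE x in lebesgue. x \<in> \<Omega> \<longrightarrow> weak_gradient \<Omega> (\<lambda>x. u x - \<phi> k x) x = weak_gradient \<Omega> u x - grad (\<phi> k) x"
      by (intro weak_gradient_AE_eq \<Omega> is_weak_gradient_diff W1p_weak_gradient[OF \<Omega> u] is_weak_gradient_test_function \<phi>)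
  qed
  have "(\<lambda>k. W1p_norm \<Omega> p (\<lambda>x. u x - \<phi> k x) powr p) \<longlonglongrightarrow> 0 powr p"
    using p lim by (intro tendsto_powr') (auto simp: W1p_norm_def intro!: always_eventually)
  moreover have "W1p_norm \<Omega> p (\<lambda>x. u x - \<phi> k x) powr p = S k + T k" for k
    using nn[of k] p by (simp add: W1p_norm_def T S_def[symmetric] powr_powr)
  ultimately have lim0: "(\<lambda>k. S k + T k) \<longlonglongrightarrow> 0" by simp
  have "S \<longlonglongrightarrow> 0" "T \<longlonglongrightarrow> 0"
    by (rule tendsto_sandwich[OF _ _ tendsto_const lim0]; use nn in \<open>auto intro!: always_eventually\<close>)+
  then show "(\<lambda>k. LINT x:\<Omega>|lebesgue. \<bar>u x - \<phi> k x\<bar> powr p) \<longlonglongrightarrow> 0"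
    "(\<lambda>k. LINT x:\<Omega>|lebesgue. norm (weak_gradient \<Omega> u x - grad (\<phi> k) x) powr p) \<longlonglongrightarrow> 0"
    by (simp_all add: S_def[abs_def] T_def[abs_def])
qed

lemma radial_representative_exists:
  assumes "open \<Omega>" "u \<in> W1p \<Omega> p"
  obtains U H where "radial_representative \<Omega> u U H"
proof -
  let ?G = "\<lambda>x. indicator \<Omega> x *\<^sub>R weak_gradient \<Omega> u x"
  have "(\<lambda>x. indicator \<Omega> x * u x) \<in> borel_measurable lebesgue" and G: "?G \<in> borel_measurable lebesgue"
    using W1p_weak_gradient[OF assms] by (auto simp: L_p_def set_borel_measurable_def)
  then obtain U where U: "U \<in> borel_measurable borel" "AE x in lborel. indicator \<Omega> x * u x = U x"
    using completion_ex_borel_measurable_real by (metis measurable_lborel2)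
  have x: "(\<lambda>x::'a. x) \<in> borel_measurable lebesgue" by (rule measurable_completion) simp
  have nx: "(\<lambda>x::'a. norm x) \<in> borel_measurable lebesgue" by (rule measurable_completion) simp
  have "(\<lambda>x. (x \<bullet> ?G x) / norm x) \<in> borel_measurable lebesgue"
    by (intro borel_measurable_divide borel_measurable_inner G nx x)
  then obtain H where H: "H \<in> borel_measurable borel" "AE x in lborel. (x \<bullet> ?G x) / norm x = H x"
    using completion_ex_borel_measurable_real by (metis measurable_lborel2)
  have "AE x in lebesgue. U x = indicator \<Omega> x * u x"
    using AE_completion[OF U(2)] by eventually_elim simp
  moreover have "AE x in lebesgue. H x = indicator \<Omega> x * ((x \<bullet> weak_gradient \<Omega> u x) / norm x)"
    using AE_completion[OF H(2)] by eventually_elim simp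
  ultimately show ?thesis using that[of U H] U(1) H(1) by (simp add: radial_representative_def)
qed

lemma radial_representative_tendsto:
  assumes \<Omega>: "open \<Omega>" and u: "u \<in> W1p \<Omega> p" and p: "p > 1"
    and \<phi>: "\<And>k. \<phi> k \<in> test_functions \<Omega>" and lim: "(\<lambda>k. W1p_norm \<Omega> p (\<lambda>x. u x - \<phi> k x)) \<longlonglongrightarrow> 0"
    and rep: "radial_representative \<Omega> u U H"
  shows "\<And>k. integrable lborel (\<lambda>x. \<bar>\<phi> k x - U x\<bar> powr p)"
    "(\<lambda>k. LINT x|lborel. \<bar>\<phi> k x - U x\<bar> powr p) \<longlonglongrightarrow> 0"
    "\<And>k. integrable lborel (\<lambda>x. \<bar>radial_derivative (\<phi> k) x - H x\<bar> powr p)"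
    "(\<lambda>k. LINT x|lborel. \<bar>radial_derivative (\<phi> k) x - H x\<bar> powr p) \<longlonglongrightarrow> 0"
proof -
  have UH[measurable]: "U \<in> borel_measurable borel" "H \<in> borel_measurable borel"
    and ae: "AE x in lebesgue. U x = indicator \<Omega> x * u x"
      "AE x in lebesgue. H x = indicator \<Omega> x * ((x \<bullet> weak_gradient \<Omega> u x) / norm x)"
    using rep by (auto simp: radial_representative_def)
  have \<phi>m[measurable]: "\<phi> k \<in> borel_measurable borel" "radial_derivative (\<phi> k) \<in> borel_measurable borel" for k
    using test_functions_measurable[OF \<phi>] radial_derivative_measurable[OF \<phi>] by auto
  have out: "\<phi> k x = 0" "grad (\<phi> k) x = 0" if "x \<notin> \<Omega>" for k x
    using that test_functions_support[OF \<phi>[of k]] by (metis subsetD)+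
  have Lp: "(\<lambda>x. u x - \<phi> k x) \<in> L_p \<Omega> p" "(\<lambda>x. weak_gradient \<Omega> u x - grad (\<phi> k) x) \<in> L_p \<Omega> p" for k
    using p by (intro L_p_diff W1p_weak_gradient[OF \<Omega> u] test_functions_L_p[OF \<Omega> \<phi>]; simp)+
  have iS: "integrable lebesgue (\<lambda>x. indicator \<Omega> x *\<^sub>R \<bar>u x - \<phi> k x\<bar> powr p)"
    and iT: "integrable lebesgue (\<lambda>x. indicator \<Omega> x *\<^sub>R norm (weak_gradient \<Omega> u x - grad (\<phi> k) x) powr p)" for k
    using Lp[of k] by (auto simp: L_p_def set_integrable_def)
  have mS: "(\<lambda>x. \<bar>\<phi> k x - U x\<bar> powr p) \<in> borel_measurable lebesgue"
    and mT: "(\<lambda>x. \<bar>radial_derivative (\<phi> k) x - H x\<bar> powr p) \<in> borel_measurable lebesgue" for k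
    by (rule measurable_completion, measurable)+
  have aeS: "AE x in lebesgue. indicator \<Omega> x *\<^sub>R \<bar>u x - \<phi> k x\<bar> powr p = \<bar>\<phi> k x - U x\<bar> powr p" for k
    using ae(1) by eventually_elim (use out p in \<open>auto simp: indicator_def abs_minus_commute\<close>)
  have "integrable lebesgue (\<lambda>x. \<bar>\<phi> k x - U x\<bar> powr p)" for k
    using integrable_cong_AE[OF borel_measurable_integrable[OF iS] mS aeS] iS by blast
  then show "integrable lborel (\<lambda>x. \<bar>\<phi> k x - U x\<bar> powr p)" for k
    by (subst (asm) integrable_completion) auto
  have "(LINT x|lborel. \<bar>\<phi> k x - U x\<bar> powr p) = (LINT x:\<Omega>|lebesgue. \<bar>u x - \<phi> k x\<bar> powr p)" for k
    unfolding set_lebesgue_integral_def integral_cong_AE[OF borel_measurable_integrable[OF iS] mS aeS]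
    by (subst integral_completion) auto
  then show "(\<lambda>k. LINT x|lborel. \<bar>\<phi> k x - U x\<bar> powr p) \<longlonglongrightarrow> 0"
    using W1p_norm_tendsto_0D(1)[OF \<Omega> u p \<phi> lim] by simp
  have leT: "AE x in lebesgue. \<bar>radial_derivative (\<phi> k) x - H x\<bar> powr p \<le> indicator \<Omega> x *\<^sub>R norm (weak_gradient \<Omega> u x - grad (\<phi> k) x) powr p" for k
    using ae(2)
  proof eventually_elim
    case (elim x)
    show ?case
    proof (cases "x \<in> \<Omega>")
      case True
      have "\<bar>x \<bullet> (grad (\<phi> k) x - weak_gradient \<Omega> u x)\<bar> / norm x \<le> norm (grad (\<phi> k) x - weak_gradient \<Omega> u x)"
        using Cauchy_Schwarz_ineq2[of x "grad (\<phi> k) x - weak_gradient \<Omega> u x"]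
        by (cases "x = 0") (auto simp: field_simps)
      then have "\<bar>radial_derivative (\<phi> k) x - H x\<bar> \<le> norm (weak_gradient \<Omega> u x - grad (\<phi> k) x)"
        using True elim by (simp add: radial_derivative_def inner_diff_right diff_divide_distrib[symmetric] norm_minus_commute)
      then show ?thesis using True p by (auto intro!: powr_mono2)
    qed (use elim out p in \<open>auto simp: radial_derivative_def\<close>)
  qed
  have iT': "integrable lebesgue (\<lambda>x. \<bar>radial_derivative (\<phi> k) x - H x\<bar> powr p)" for k
    using iT[of k] mT
  proof (rule Bochner_Integration.integrable_bound)
    show "AE x in lebesgue. norm (\<bar>radial_derivative (\<phi> k) x - H x\<bar> powr p) \<le> norm (indicator \<Omega> x *\<^sub>R norm (weak_gradient \<Omega> u x - grad (\<phi> k) x) powr p)"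
      using leT[of k] by eventually_elim simp
  qed
  then show "integrable lborel (\<lambda>x. \<bar>radial_derivative (\<phi> k) x - H x\<bar> powr p)" for k
    by (subst (asm) integrable_completion) auto
  have le: "(LINT x|lborel. \<bar>radial_derivative (\<phi> k) x - H x\<bar> powr p) \<le> (LINT x:\<Omega>|lebesgue. norm (weak_gradient \<Omega> u x - grad (\<phi> k) x) powr p)" for k
  proof -
    have "(LINT x|lborel. \<bar>radial_derivative (\<phi> k) x - H x\<bar> powr p) = (LINT x|lebesgue. \<bar>radial_derivative (\<phi> k) x - H x\<bar> powr p)"
      by (subst integral_completion) auto
    also have "\<dots> \<le> (LINT x:\<Omega>|lebesgue. norm (weak_gradient \<Omega> u x - grad (\<phi> k) x) powr p)"
      unfolding set_lebesgue_integral_def by (rule integral_mono_AE[OF iT' iT leT])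
    finally show ?thesis .
  qed
  show "(\<lambda>k. LINT x|lborel. \<bar>radial_derivative (\<phi> k) x - H x\<bar> powr p) \<longlonglongrightarrow> 0"
    by (rule tendsto_sandwich[OF _ _ tendsto_const W1p_norm_tendsto_0D(2)[OF \<Omega> u p \<phi> lim]])
      (use le in \<open>auto intro!: always_eventually\<close>)
qed

lemma test_function_weighted_finite:
  fixes \<phi> W :: "'a::euclidean_space \<Rightarrow> real"
  assumes \<phi>: "\<phi> \<in> test_functions \<Omega>" and W: "W \<in> borel_measurable borel" "continuous_on \<Omega> W"
    and A: "A \<in> sets borel" and p: "p > 0"
  shows "integrable lborel (\<lambda>x. \<bar>\<phi> x\<bar> powr p * W x * indicator A x)"
proof -
  obtain K where K: "compact K" "K \<subseteq> \<Omega>" "\<And>x. x \<notin> K \<Longrightarrow> \<phi> x = 0"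
    using test_functions_support[OF \<phi>] by metis
  obtain B where B: "\<And>x. \<bar>\<phi> x\<bar> \<le> B" using test_functions_bounded[OF \<phi>] by metis
  obtain C where C: "C \<ge> 0" "\<And>x. x \<in> K \<Longrightarrow> norm (W x) \<le> C"
    using bounded_on_compact[OF continuous_on_subset[OF W(2) K(2)] K(1)] by metis
  have [measurable]: "\<phi> \<in> borel_measurable borel" "A \<in> sets borel" "W \<in> borel_measurable borel"
    using test_functions_measurable[OF \<phi>] A W by auto
  show ?thesis
  proof (rule integrable_on_compact_support[OF K(1)])
    show "(\<lambda>x. \<bar>\<phi> x\<bar> powr p * W x * indicator A x) \<in> borel_measurable borel" by measurable
    show "norm (\<bar>\<phi> x\<bar> powr p * W x * indicator A x) \<le> B powr p * C" if "x \<in> K" for x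
    proof -
      have "\<bar>\<phi> x\<bar> powr p * \<bar>W x\<bar> \<le> B powr p * C"
        using B[of x] C(2)[OF that] p by (intro mult_mono powr_mono2) auto
      moreover have "0 \<le> B powr p * C" using C by simp
      ultimately show ?thesis by (auto simp: abs_mult indicator_def)
    qed
  qed (use K in simp)
qed

lemma test_function_radial_integrable:
  fixes \<phi> :: "'a::euclidean_space \<Rightarrow> real"
  assumes \<phi>: "\<phi> \<in> test_functions \<Omega>" and A: "A \<in> sets borel" and p: "p > 0"
  shows "integrable lborel (\<lambda>x. \<bar>radial_derivative \<phi> x\<bar> powr p * indicator A x)"
proof -
  obtain K where K: "compact K" "\<And>x. x \<notin> K \<Longrightarrow> grad \<phi> x = 0"
    using test_functions_support[OF \<phi>] by metis
  obtain B where B: "\<And>x. norm (grad \<phi> x) \<le> B" using test_functions_bounded[OF \<phi>] by metis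
  have [measurable]: "radial_derivative \<phi> \<in> borel_measurable borel" "A \<in> sets borel"
    using radial_derivative_measurable[OF \<phi>] A by auto
  show ?thesis
  proof (rule integrable_on_compact_support[OF K(1)])
    show "(\<lambda>x. \<bar>radial_derivative \<phi> x\<bar> powr p * indicator A x) \<in> borel_measurable borel" by measurable
    show "norm (\<bar>radial_derivative \<phi> x\<bar> powr p * indicator A x) \<le> B powr p" for x
      using order_trans[OF abs_radial_derivative_le B, of x] p by (auto simp: indicator_def intro!: powr_mono2)
  qed (use K in \<open>simp add: radial_derivative_def\<close>)
qed

lemma test_function_sphere_integrable:
  fixes \<phi> :: "'a::euclidean_space \<Rightarrow> real"
  assumes \<phi>: "\<phi> \<in> test_functions \<Omega>" and p: "p > 0"
  shows "integrable (sphere_measure \<rho>) (\<lambda>x. \<bar>\<phi> x\<bar> powr p)"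
proof -
  obtain B where B: "\<And>x. \<bar>\<phi> x\<bar> \<le> B" using test_functions_bounded[OF \<phi>] by metis
  interpret finite_measure "sphere_measure \<rho> :: 'a measure" by (rule finite_measure_sphere_measure)
  have [measurable]: "\<phi> \<in> borel_measurable borel" using test_functions_measurable[OF \<phi>] by auto
  show ?thesis
    by (rule integrable_const_bound[where B = "B powr p"]) (use B p in \<open>auto intro!: powr_mono2 AE_I2\<close>)
qed

lemma nn_integral_eq_LINT_indicator:
  fixes f :: "'a \<Rightarrow> real"
  assumes "integrable M (\<lambda>x. f x * indicator A x)" "\<And>x. f x \<ge> 0"
  shows "(\<integral>\<^sup>+x. ennreal (f x) * indicator A x \<partial>M) = ennreal (LINT x|M. f x * indicator A x)"
proof -
  have "(\<integral>\<^sup>+x. ennreal (f x) * indicator A x \<partial>M) = (\<integral>\<^sup>+x. ennreal (f x * indicator A x) \<partial>M)"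
    by (intro nn_integral_cong) (auto simp: indicator_def)
  also have "\<dots> = ennreal (LINT x|M. f x * indicator A x)"
    using assms by (intro nn_integral_eq_integral) (auto simp: indicator_def)
  finally show ?thesis .
qed

text \<open>Convergence of the weighted term is the point. The estimate with \<open>c = 1/2\<close>, applied to
  differences of test functions, makes the approximating sequence Cauchy in the weighted space, and
  Fatou's lemma identifies the limit as \<open>U\<close>. The other two terms converge by assumption.\<close>

lemma hardy_limit:
  fixes u U H W g :: "'a::euclidean_space \<Rightarrow> real"
  assumes \<Omega>: "open \<Omega>" and u: "u \<in> W1p \<Omega> p" and p: "p > 1"
    and \<phi>: "\<And>k. \<phi> k \<in> test_functions \<Omega>" and lim: "(\<lambda>k. W1p_norm \<Omega> p (\<lambda>x. u x - \<phi> k x)) \<longlonglongrightarrow> 0"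
    and rep: "radial_representative \<Omega> u U H"
    and W: "W \<in> borel_measurable borel" "continuous_on \<Omega> W" "\<And>x. W x \<ge> 0" and A: "A \<in> sets borel"
    and \<kappa>: "\<kappa> \<ge> 0"
    and ineq: "\<And>\<psi>. \<psi> \<in> test_functions \<Omega> \<Longrightarrow> hardy_estimate p \<kappa> \<gamma> W A \<psi>"
    and g: "g \<in> borel_measurable borel" "integrable (sphere_measure \<gamma>) (\<lambda>x. \<bar>g x\<bar> powr p)"
      "(\<lambda>k. LINT x|sphere_measure \<gamma>. \<bar>g x - \<phi> k x\<bar> powr p) \<longlonglongrightarrow> 0"
  shows "integrable lborel (\<lambda>x. \<bar>U x\<bar> powr p * W x * indicator A x)"
    "integrable lborel (\<lambda>x. \<bar>H x\<bar> powr p * indicator A x)"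
    "\<And>c. c > 0 \<Longrightarrow> \<kappa> * (LINT x|sphere_measure \<gamma>. \<bar>g x\<bar> powr p) + (p - 1) * (LINT x|lborel. \<bar>U x\<bar> powr p * W x * indicator A x)
      \<le> c powr (1 - p) * (LINT x|lborel. \<bar>H x\<bar> powr p * indicator A x)
        + (p - 1) * c * (LINT x|lborel. \<bar>U x\<bar> powr p * W x * indicator A x)"
proof -
  note [measurable] = W(1) A g(1)
  have [measurable]: "U \<in> borel_measurable borel" "H \<in> borel_measurable borel"
    using rep by (auto simp: radial_representative_def)
  have \<phi>m[measurable]: "\<phi> k \<in> borel_measurable borel" "radial_derivative (\<phi> k) \<in> borel_measurable borel" for k
    using test_functions_measurable[OF \<phi>] radial_derivative_measurable[OF \<phi>] by auto
  note T = radial_representative_tendsto[OF \<Omega> u p \<phi> lim rep]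
  define S where "S \<psi> = (LINT x|sphere_measure \<gamma>. \<bar>\<psi> x\<bar> powr p)" for \<psi> :: "'a \<Rightarrow> real"
  define K where "K \<psi> = (LINT x|lborel. \<bar>\<psi> x\<bar> powr p * W x * indicator A x)" for \<psi> :: "'a \<Rightarrow> real"
  define D where "D \<psi> = (LINT x|lborel. \<bar>\<psi> x\<bar> powr p * indicator A x)" for \<psi> :: "'a \<Rightarrow> real"
  have p0: "p > 0" using p by simp
  have nn: "S \<psi> \<ge> 0" "K \<psi> \<ge> 0" "D \<psi> \<ge> 0" for \<psi>
    unfolding S_def K_def D_def using W(3) by (auto intro!: Bochner_Integration.integral_nonneg)
  have nnK: "(\<integral>\<^sup>+x. ennreal (\<bar>\<psi> x\<bar> powr p * W x) * indicator A x \<partial>lborel) = ennreal (K \<psi>)"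
    if "\<psi> \<in> test_functions \<Omega>" for \<psi>
    unfolding K_def using test_function_weighted_finite[OF that W(1,2) A p0] W(3)
    by (intro nn_integral_eq_LINT_indicator) auto
  have real_ineq: "\<kappa> * S \<psi> + (p - 1) * K \<psi> \<le> c powr (1 - p) * D (radial_derivative \<psi>) + (p - 1) * c * K \<psi>"
    if \<psi>: "\<psi> \<in> test_functions \<Omega>" and c: "c > 0" for \<psi> c
  proof -
    have 1: "(\<integral>\<^sup>+x. ennreal (\<bar>\<psi> x\<bar> powr p) \<partial>sphere_measure \<gamma>) = ennreal (S \<psi>)"
      unfolding S_def using test_function_sphere_integrable[OF \<psi> p0] by (intro nn_integral_eq_integral) auto
    have 2: "(\<integral>\<^sup>+x. ennreal (\<bar>radial_derivative \<psi> x\<bar> powr p) * indicator A x \<partial>lborel) = ennreal (D (radial_derivative \<psi>))"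
      unfolding D_def using test_function_radial_integrable[OF \<psi> A p0] by (intro nn_integral_eq_LINT_indicator) auto
    have "ennreal (\<kappa> * S \<psi> + (p - 1) * K \<psi>) \<le> ennreal (c powr (1 - p) * D (radial_derivative \<psi>) + (p - 1) * c * K \<psi>)"
      using ineq[OF \<psi>, unfolded hardy_estimate_def, rule_format, OF c] unfolding 1 2 nnK[OF \<psi>] using \<kappa> p c nn by (simp add: ennreal_plus ennreal_mult)
    then show ?thesis using p c nn by (subst (asm) ennreal_le_iff) auto
  qed
  define e where "e k = (LINT x|lborel. \<bar>radial_derivative (\<phi> k) x - H x\<bar> powr p)" for k
  have e0: "e \<longlonglongrightarrow> 0" unfolding e_def by (rule T(4))
  \<comment> \<open>half of the weighted term is absorbed for \<open>c = 1/2\<close>, which leaves \<open>2 / (p - 1) * (1/2) powr (1 - p)\<close>; the last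
      factor comes from the triangle inequality\<close>
  define C where "C = 2 / (p - 1) * 2 powr (p - 1) * 2 powr (p - 1)"
  have C0: "C \<ge> 0" using p by (simp add: C_def)
  have cauchy: "K (\<lambda>x. \<phi> k x - \<phi> l x) \<le> C * (e k + e l)" for k l
  proof -
    note d = test_functions_diff[OF \<phi>[of k] \<phi>[of l]]
    have rd: "radial_derivative (\<lambda>x. \<phi> k x - \<phi> l x) x = (radial_derivative (\<phi> k) x - H x) - (radial_derivative (\<phi> l) x - H x)" for x
      by (simp add: radial_derivative_def d(2) inner_diff_right diff_divide_distrib)
    have "(p - 1) * K (\<lambda>x. \<phi> k x - \<phi> l x) \<le> (1 / 2) powr (1 - p) * D (radial_derivative (\<lambda>x. \<phi> k x - \<phi> l x)) + (p - 1) * (1 / 2) * K (\<lambda>x. \<phi> k x - \<phi> l x)"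
      using real_ineq[OF d(1), of "1 / 2"] mult_nonneg_nonneg[OF \<kappa> nn(1)[of "\<lambda>x. \<phi> k x - \<phi> l x"]] by simp
    moreover have "(1 / 2::real) powr (1 - p) = 2 powr (p - 1)" by (simp add: powr_divide powr_diff)
    ultimately have "K (\<lambda>x. \<phi> k x - \<phi> l x) \<le> 2 / (p - 1) * 2 powr (p - 1) * D (radial_derivative (\<lambda>x. \<phi> k x - \<phi> l x))"
      using p by (simp add: field_simps)
    also have "\<dots> \<le> 2 / (p - 1) * 2 powr (p - 1) * (2 powr (p - 1) * (e k + e l))"
    proof (rule mult_left_mono)
      have "D (radial_derivative (\<lambda>x. \<phi> k x - \<phi> l x)) \<le> (LINT x|lborel. 2 powr (p - 1) * (\<bar>radial_derivative (\<phi> k) x - H x\<bar> powr p + \<bar>radial_derivative (\<phi> l) x - H x\<bar> powr p))"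
        unfolding D_def
      proof (rule integral_mono)
        show "integrable lborel (\<lambda>x. \<bar>radial_derivative (\<lambda>x. \<phi> k x - \<phi> l x) x\<bar> powr p * indicator A x)"
          by (rule test_function_radial_integrable[OF d(1) A p0])
        show "integrable lborel (\<lambda>x. 2 powr (p - 1) * (\<bar>radial_derivative (\<phi> k) x - H x\<bar> powr p + \<bar>radial_derivative (\<phi> l) x - H x\<bar> powr p))"
          using T(3) by simp
        show "\<bar>radial_derivative (\<lambda>x. \<phi> k x - \<phi> l x) x\<bar> powr p * indicator A x
            \<le> 2 powr (p - 1) * (\<bar>radial_derivative (\<phi> k) x - H x\<bar> powr p + \<bar>radial_derivative (\<phi> l) x - H x\<bar> powr p)" for x
          using norm_powr_triangle_half[of p "radial_derivative (\<phi> k) x - H x" "radial_derivative (\<phi> l) x - H x"] p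
          unfolding rd by (cases "x \<in> A") auto
      qed
      also have "\<dots> = 2 powr (p - 1) * (e k + e l)" using T(3) by (simp add: e_def)
      finally show "D (radial_derivative (\<lambda>x. \<phi> k x - \<phi> l x)) \<le> 2 powr (p - 1) * (e k + e l)" .
    qed (use p in simp)
    finally show ?thesis by (simp add: C_def mult.assoc)
  qed
  \<comment> \<open>a subsequence converging almost everywhere\<close>
  obtain s where s: "strict_mono (s :: nat \<Rightarrow> nat)" "AE x in lborel. (\<lambda>l. \<bar>\<phi> (s l) x - U x\<bar> powr p) \<longlonglongrightarrow> 0"
    using tendsto_L1_AE_subseq[of lborel "\<lambda>k x. \<bar>\<phi> k x - U x\<bar> powr p"] T(1,2) by auto
  have s': "AE x in lborel. (\<lambda>l. \<phi> (s l) x) \<longlonglongrightarrow> U x"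
    using s(2)
  proof eventually_elim
    case (elim x)
    then have "(\<lambda>l. (\<bar>\<phi> (s l) x - U x\<bar> powr p) powr (1 / p)) \<longlonglongrightarrow> 0 powr (1 / p)"
      using p by (intro tendsto_powr') auto
    then have "(\<lambda>l. \<bar>\<phi> (s l) x - U x\<bar>) \<longlonglongrightarrow> 0" using p by (simp add: powr_powr)
    then show ?case by (simp add: tendsto_rabs_zero_iff LIM_zero_iff)
  qed
  have fatou: "(\<integral>\<^sup>+x. ennreal (\<bar>\<phi> k x - U x\<bar> powr p * W x * indicator A x) \<partial>lborel) \<le> ennreal (C * e k)" for k
  proof -
    have "(\<integral>\<^sup>+x. ennreal (\<bar>\<phi> k x - U x\<bar> powr p * W x * indicator A x) \<partial>lborel)
      = (\<integral>\<^sup>+x. liminf (\<lambda>l. ennreal (\<bar>\<phi> k x - \<phi> (s l) x\<bar> powr p * W x * indicator A x)) \<partial>lborel)"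
      using s'
    proof (intro nn_integral_cong_AE, eventually_elim)
      case (elim x)
      then have "(\<lambda>l. \<bar>\<phi> k x - \<phi> (s l) x\<bar> powr p) \<longlonglongrightarrow> \<bar>\<phi> k x - U x\<bar> powr p"
        using p by (intro tendsto_powr' tendsto_intros) auto
      then have "(\<lambda>l. ennreal (\<bar>\<phi> k x - \<phi> (s l) x\<bar> powr p * W x * indicator A x)) \<longlonglongrightarrow> ennreal (\<bar>\<phi> k x - U x\<bar> powr p * W x * indicator A x)"
        by (intro tendsto_ennrealI tendsto_mult tendsto_const)
      from lim_imp_Liminf[OF _ this] show ?case by simp
    qed
    also have "\<dots> \<le> liminf (\<lambda>l. \<integral>\<^sup>+x. ennreal (\<bar>\<phi> k x - \<phi> (s l) x\<bar> powr p * W x * indicator A x) \<partial>lborel)"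
      by (rule nn_integral_liminf) measurable
    also have "\<dots> \<le> liminf (\<lambda>l. ennreal (C * (e k + e (s l))))"
    proof (intro Liminf_mono always_eventually allI)
      fix l
      have "(\<integral>\<^sup>+x. ennreal (\<bar>\<phi> k x - \<phi> (s l) x\<bar> powr p * W x * indicator A x) \<partial>lborel) = ennreal (K (\<lambda>x. \<phi> k x - \<phi> (s l) x))"
        unfolding K_def using W(3)
        by (intro nn_integral_eq_integral test_function_weighted_finite[OF test_functions_diff(1)[OF \<phi> \<phi>] W(1,2) A p0]) auto
      also have "\<dots> \<le> ennreal (C * (e k + e (s l)))" by (rule ennreal_leI[OF cauchy])
      finally show "(\<integral>\<^sup>+x. ennreal (\<bar>\<phi> k x - \<phi> (s l) x\<bar> powr p * W x * indicator A x) \<partial>lborel) \<le> ennreal (C * (e k + e (s l)))" .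
    qed
    also have "\<dots> = ennreal (C * (e k + 0))"
      using LIMSEQ_subseq_LIMSEQ[OF e0 s(1)]
      by (intro lim_imp_Liminf tendsto_ennrealI tendsto_mult tendsto_add tendsto_const) (auto simp: o_def)
    finally show ?thesis by simp
  qed
  let ?w = "\<lambda>x. (W x * indicator A x) powr (1 / p)"
  have w: "\<bar>?w x * y\<bar> powr p = \<bar>y\<bar> powr p * W x * indicator A x" for x y
    using p W(3)[of x] by (simp add: abs_mult powr_mult powr_powr mult_ac)
  have idW: "integrable lborel (\<lambda>x. \<bar>\<phi> k x - U x\<bar> powr p * W x * indicator A x)" for k
    using fatou[of k] W(3) by (intro integrableI_nonneg) (auto simp: top_unique less_top[symmetric] intro: le_less_trans)
  have dW: "(\<lambda>k. K (\<lambda>x. \<phi> k x - U x)) \<longlonglongrightarrow> 0"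
  proof (rule tendsto_sandwich[OF _ _ tendsto_const])
    show "\<forall>\<^sub>F k in sequentially. 0 \<le> K (\<lambda>x. \<phi> k x - U x)" using nn by simp
    have "K (\<lambda>x. \<phi> k x - U x) \<le> C * e k" for k
    proof -
      have "ennreal (K (\<lambda>x. \<phi> k x - U x)) = (\<integral>\<^sup>+x. ennreal (\<bar>\<phi> k x - U x\<bar> powr p * W x * indicator A x) \<partial>lborel)"
        unfolding K_def using W(3) by (intro nn_integral_eq_integral[symmetric] idW) auto
      then have "ennreal (K (\<lambda>x. \<phi> k x - U x)) \<le> ennreal (C * e k)" using fatou[of k] by simp
      moreover have "0 \<le> C * e k" using C0 by (simp add: e_def)
      ultimately show ?thesis by (simp add: ennreal_le_iff)
    qed
    then show "\<forall>\<^sub>F k in sequentially. K (\<lambda>x. \<phi> k x - U x) \<le> C * e k" by simp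
    show "(\<lambda>k. C * e k) \<longlonglongrightarrow> 0" using tendsto_mult_left[OF e0, of C] by simp
  qed
  have p1: "p \<ge> 1" using p by simp
  have KP: "(\<lambda>x. ?w x * U x) \<in> borel_measurable lborel" "\<And>k. (\<lambda>x. ?w x * \<phi> k x) \<in> borel_measurable lborel"
    "\<And>k. integrable lborel (\<lambda>x. \<bar>?w x * \<phi> k x\<bar> powr p)"
    "\<And>k. integrable lborel (\<lambda>x. \<bar>?w x * \<phi> k x - ?w x * U x\<bar> powr p)"
    "(\<lambda>k. LINT x|lborel. \<bar>?w x * \<phi> k x - ?w x * U x\<bar> powr p) \<longlonglongrightarrow> 0"
    unfolding right_diff_distrib[symmetric] w
    using test_function_weighted_finite[OF \<phi> W(1,2) A p0] idW dW by (simp_all add: K_def)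
  note KL = Lp_norm_tendsto[OF p1 KP]
  show "integrable lborel (\<lambda>x. \<bar>U x\<bar> powr p * W x * indicator A x)" using KL(1) unfolding w .
  have K_lim: "(\<lambda>k. K (\<phi> k)) \<longlonglongrightarrow> K U" using KL(2) unfolding w K_def .
  have ind: "\<bar>indicator A x * y\<bar> powr p = \<bar>y\<bar> powr p * indicator A x" for x :: 'a and y :: real
    using p by (auto simp: indicator_def)
  have idH: "integrable lborel (\<lambda>x. \<bar>radial_derivative (\<phi> k) x - H x\<bar> powr p * indicator A x)" for k
    using integrable_mult_indicator[OF _ T(3), of A k] by (simp add: mult.commute)
  have dH: "(\<lambda>k. D (\<lambda>x. radial_derivative (\<phi> k) x - H x)) \<longlonglongrightarrow> 0"
  proof (rule tendsto_sandwich[OF _ _ tendsto_const e0])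
    show "\<forall>\<^sub>F k in sequentially. 0 \<le> D (\<lambda>x. radial_derivative (\<phi> k) x - H x)" using nn by simp
    have "D (\<lambda>x. radial_derivative (\<phi> k) x - H x) \<le> e k" for k
      unfolding D_def e_def by (intro integral_mono idH T(3)) (auto simp: indicator_def)
    then show "\<forall>\<^sub>F k in sequentially. D (\<lambda>x. radial_derivative (\<phi> k) x - H x) \<le> e k" by simp
  qed
  have DP: "(\<lambda>x. indicator A x * H x) \<in> borel_measurable lborel"
    "\<And>k. (\<lambda>x. indicator A x * radial_derivative (\<phi> k) x) \<in> borel_measurable lborel"
    "\<And>k. integrable lborel (\<lambda>x. \<bar>indicator A x * radial_derivative (\<phi> k) x\<bar> powr p)"
    "\<And>k. integrable lborel (\<lambda>x. \<bar>indicator A x * radial_derivative (\<phi> k) x - indicator A x * H x\<bar> powr p)"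
    "(\<lambda>k. LINT x|lborel. \<bar>indicator A x * radial_derivative (\<phi> k) x - indicator A x * H x\<bar> powr p) \<longlonglongrightarrow> 0"
    unfolding right_diff_distrib[symmetric] ind
    using test_function_radial_integrable[OF \<phi> A p0] idH dH by (simp_all add: D_def)
  note DL = Lp_norm_tendsto[OF p1 DP]
  show "integrable lborel (\<lambda>x. \<bar>H x\<bar> powr p * indicator A x)" using DL(1) unfolding ind .
  have D_lim: "(\<lambda>k. D (radial_derivative (\<phi> k))) \<longlonglongrightarrow> D H" using DL(2) unfolding ind D_def .
  have "integrable (sphere_measure \<gamma>) (\<lambda>x. \<bar>\<phi> k x - g x\<bar> powr p)" for k
    using integrable_powr_diff[of p "\<phi> k" "sphere_measure \<gamma>" g] p g test_function_sphere_integrable[OF \<phi> p0] by simp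
  then have S_lim: "(\<lambda>k. S (\<phi> k)) \<longlonglongrightarrow> S g"
    unfolding S_def using p g test_function_sphere_integrable[OF \<phi> p0]
    by (intro Lp_norm_tendsto(2)[where p = p]) (simp_all add: abs_minus_commute)
  fix c :: real assume c: "c > 0"
  have "\<kappa> * S g + (p - 1) * K U \<le> c powr (1 - p) * D H + (p - 1) * c * K U"
  proof (rule LIMSEQ_le)
    show "(\<lambda>k. \<kappa> * S (\<phi> k) + (p - 1) * K (\<phi> k)) \<longlonglongrightarrow> \<kappa> * S g + (p - 1) * K U"
      by (intro tendsto_intros S_lim K_lim)
    show "(\<lambda>k. c powr (1 - p) * D (radial_derivative (\<phi> k)) + (p - 1) * c * K (\<phi> k)) \<longlonglongrightarrow> c powr (1 - p) * D H + (p - 1) * c * K U"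
      by (intro tendsto_add tendsto_mult_left D_lim K_lim)
    show "\<exists>N. \<forall>k\<ge>N. \<kappa> * S (\<phi> k) + (p - 1) * K (\<phi> k) \<le> c powr (1 - p) * D (radial_derivative (\<phi> k)) + (p - 1) * c * K (\<phi> k)"
      using real_ineq[OF \<phi> c] by blast
  qed
  then show "\<kappa> * (LINT x|sphere_measure \<gamma>. \<bar>g x\<bar> powr p) + (p - 1) * (LINT x|lborel. \<bar>U x\<bar> powr p * W x * indicator A x)
      \<le> c powr (1 - p) * (LINT x|lborel. \<bar>H x\<bar> powr p * indicator A x)
        + (p - 1) * c * (LINT x|lborel. \<bar>U x\<bar> powr p * W x * indicator A x)"
    unfolding S_def K_def D_def .
qed

section \<open>Traces on spheres\<close>

lemma tangent_powr:
  fixes x a p :: real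
  assumes "p > 1" "x \<ge> 0" "a \<ge> 0"
  shows "a powr p + p * a powr (p - 1) * (x - a) \<le> x powr p"
proof -
  have "a powr (p - 1) * a = a powr p"
    using assms by (cases "a = 0") (simp_all add: powr_diff)
  then have "a powr p + p * a powr (p - 1) * (x - a) = p * x * a powr (p - 1) - (p - 1) * a powr p"
    by (simp add: right_diff_distrib left_diff_distrib mult_ac)
  then show ?thesis using young_weighted[of x a 1 p] assms by simp
qed

text \<open>Jensen's inequality for \<open>|f| / w\<close> and the measure with density \<open>w\<close> of total mass \<open>V\<close>; it follows by
  integrating \<open>tangent_powr\<close> at the mean value \<open>a\<close>.\<close>

lemma jensen_powr:
  fixes f w :: "real \<Rightarrow> real"
  assumes p: "p > 1" and [measurable]: "f \<in> borel_measurable borel" "w \<in> borel_measurable borel" "S \<in> sets borel"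
    and w: "\<And>s. s \<in> S \<Longrightarrow> w s > 0" "set_integrable lborel S w" "(LINT s:S|lborel. w s) = V" "V > 0"
    and f: "set_integrable lborel S (\<lambda>s. \<bar>f s\<bar> powr p * w s powr (1 - p))"
  shows "set_integrable lborel S f"
    "\<bar>LINT s:S|lborel. f s\<bar> powr p \<le> V powr (p - 1) * (LINT s:S|lborel. \<bar>f s\<bar> powr p * w s powr (1 - p))"
proof -
  have eq: "(\<bar>f s\<bar> / w s) powr p * w s = \<bar>f s\<bar> powr p * w s powr (1 - p)" if "s \<in> S" for s
    using w(1)[OF that] by (simp add: powr_divide powr_diff)
  have b: "\<bar>f s\<bar> \<le> w s + \<bar>f s\<bar> powr p * w s powr (1 - p)" if s: "s \<in> S" for s
  proof -
    have "\<bar>f s\<bar> / w s \<le> 1 + (\<bar>f s\<bar> / w s) powr p"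
    proof (cases "\<bar>f s\<bar> / w s \<le> 1")
      case False
      define t where "t = \<bar>f s\<bar> / w s"
      have "t > 1" using False by (simp add: t_def)
      then have "t \<le> 1 + t powr p" using p powr_mono[of 1 p t] by simp
      then show ?thesis by (simp add: t_def)
    next
      case True
      moreover have "0 \<le> (\<bar>f s\<bar> / w s) powr p" by simp
      ultimately show ?thesis by linarith
    qed
    then have "\<bar>f s\<bar> / w s * w s \<le> (1 + (\<bar>f s\<bar> / w s) powr p) * w s" using w(1)[OF s] by (intro mult_right_mono) auto
    then show ?thesis using w(1)[OF s] eq[OF s] by (simp add: distrib_right)
  qed
  have wf: "set_integrable lborel S (\<lambda>s. w s + \<bar>f s\<bar> powr p * w s powr (1 - p))" using w(2) f by (rule set_integral_add(1))
  show fi: "set_integrable lborel S f"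
    by (rule set_integrable_bound[OF wf]) (auto simp: set_borel_measurable_def intro!: AE_I2 order_trans[OF b])
  then have fi': "set_integrable lborel S (\<lambda>s. \<bar>f s\<bar>)" by (rule set_integrable_abs)
  define a where "a = (LINT s:S|lborel. \<bar>f s\<bar>) / V"
  have a0: "a \<ge> 0" unfolding a_def set_lebesgue_integral_def using w(4)
    by (auto intro!: divide_nonneg_pos Bochner_Integration.integral_nonneg)
  have "a powr p * V = (LINT s:S|lborel. (a powr p - p * a powr (p - 1) * a) * w s + p * a powr (p - 1) * \<bar>f s\<bar>)"
    using w(2-4) fi' by (simp add: set_integral_add a_def algebra_simps)
  also have "\<dots> \<le> (LINT s:S|lborel. \<bar>f s\<bar> powr p * w s powr (1 - p))"
  proof (rule set_integral_mono[OF _ f])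
    show "set_integrable lborel S (\<lambda>s. (a powr p - p * a powr (p - 1) * a) * w s + p * a powr (p - 1) * \<bar>f s\<bar>)"
      using w(2) fi' by (intro set_integral_add(1) set_integrable_mult_right) auto
    fix s assume s: "s \<in> S"
    have "(a powr p + p * a powr (p - 1) * (\<bar>f s\<bar> / w s - a)) * w s \<le> (\<bar>f s\<bar> / w s) powr p * w s"
      using w(1)[OF s] by (intro mult_right_mono tangent_powr p a0) auto
    moreover have "(a powr p + p * a powr (p - 1) * (\<bar>f s\<bar> / w s - a)) * w s = (a powr p - p * a powr (p - 1) * a) * w s + p * a powr (p - 1) * \<bar>f s\<bar>"
      using w(1)[OF s] by (simp add: algebra_simps)
    ultimately show "(a powr p - p * a powr (p - 1) * a) * w s + p * a powr (p - 1) * \<bar>f s\<bar> \<le> \<bar>f s\<bar> powr p * w s powr (1 - p)"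
      using eq[OF s] by simp
  qed
  finally have 1: "V powr (p - 1) * (a powr p * V) \<le> V powr (p - 1) * (LINT s:S|lborel. \<bar>f s\<bar> powr p * w s powr (1 - p))"
    by (intro mult_left_mono) auto
  have "\<bar>LINT s:S|lborel. f s\<bar> \<le> (LINT s:S|lborel. \<bar>f s\<bar>)"
    using set_integral_norm_bound[OF fi] by simp
  then have "\<bar>LINT s:S|lborel. f s\<bar> \<le> a * V" using w(4) by (simp add: a_def)
  then have "\<bar>LINT s:S|lborel. f s\<bar> powr p \<le> (a * V) powr p" using p by (intro powr_mono2) auto
  also have "\<dots> = V powr (p - 1) * (a powr p * V)" using a0 w(4) by (simp add: powr_mult powr_diff)
  finally show "\<bar>LINT s:S|lborel. f s\<bar> powr p \<le> V powr (p - 1) * (LINT s:S|lborel. \<bar>f s\<bar> powr p * w s powr (1 - p))"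
    using 1 by simp
qed

lemma integral_powr_greaterThan:
  fixes a q :: real
  assumes a: "a > 0" and q: "q < 0"
  shows "set_integrable lborel {a<..} (\<lambda>s. s powr (q - 1))"
    "(LINT s:{a<..}|lborel. s powr (q - 1)) = a powr q / \<bar>q\<bar>"
proof -
  have e: "einterval (ereal a) \<infinity> = {a<..}" by (auto simp: einterval_def)
  have lim0: "(((\<lambda>s. s powr q / q) \<circ> real_of_ereal) \<longlongrightarrow> a powr q / q) (at_right (ereal a))"
    using a q by (auto simp: ereal_tendsto_simps intro!: tendsto_eq_intros)
  have lim1: "(((\<lambda>s. s powr q / q) \<circ> real_of_ereal) \<longlongrightarrow> 0) (at_left \<infinity>)"
    using q by (auto simp: ereal_tendsto_simps intro!: tendsto_divide_zero tendsto_neg_powr filterlim_ident)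
  note I = interval_integral_FTC_nonneg[of "ereal a" \<infinity> "\<lambda>s. s powr q / q" "\<lambda>s. s powr (q - 1)", OF _ _ _ _ lim0 lim1]
  show "set_integrable lborel {a<..} (\<lambda>s. s powr (q - 1))"
    unfolding e[symmetric] using a q by (intro I(1)) (auto intro!: derivative_eq_intros continuous_intros)
  have "(LBINT s=ereal a..\<infinity>. s powr (q - 1)) = 0 - a powr q / q"
    using a q by (intro I(2)) (auto intro!: derivative_eq_intros continuous_intros)
  then show "(LINT s:{a<..}|lborel. s powr (q - 1)) = a powr q / \<bar>q\<bar>"
    using q by (simp add: interval_lebesgue_integral_def e)
qed

text \<open>A test function vanishes at infinity, so its value on the sphere of radius \<open>\<rho>\<close> is recovered
  from its radial derivative \<open>H\<close> along the outward ray. For a Sobolev function the same formula gives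
  the trace explicitly, without completeness of \<open>L\<^sup>p\<close> of the sphere.\<close>

definition ray_trace :: "real \<Rightarrow> ('a::euclidean_space \<Rightarrow> real) \<Rightarrow> 'a \<Rightarrow> real" where
  "ray_trace \<rho> H x = - (LINT s:{\<rho><..}|lborel. H ((s / norm x) *\<^sub>R x))"

lemma ray_trace_measurable:
  assumes [measurable]: "H \<in> borel_measurable borel"
  shows "ray_trace \<rho> H \<in> borel_measurable borel"
  unfolding ray_trace_def[abs_def] set_lebesgue_integral_def by measurable

lemma test_function_ray_integral:
  fixes \<phi> :: "'a::euclidean_space \<Rightarrow> real"
  assumes \<phi>: "\<phi> \<in> test_functions (exterior r)" and \<rho>: "r < \<rho>" "0 < \<rho>" and \<omega>: "norm \<omega> = 1"
  shows "set_integrable lborel {\<rho><..} (\<lambda>s. radial_derivative \<phi> (s *\<^sub>R \<omega>))"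
    "(LINT s:{\<rho><..}|lborel. radial_derivative \<phi> (s *\<^sub>R \<omega>)) = - \<phi> (\<rho> *\<^sub>R \<omega>)"
proof -
  obtain b where b: "\<rho> < b" "\<And>x. b \<le> norm x \<Longrightarrow> \<phi> x = 0 \<and> grad \<phi> x = 0"
    using test_functions_exterior_support[OF \<phi> \<rho>(1)] by metis
  let ?f = "\<lambda>s. grad \<phi> (s *\<^sub>R \<omega>) \<bullet> \<omega>"
  have [measurable]: "radial_derivative \<phi> \<in> borel_measurable borel" "grad \<phi> \<in> borel_measurable borel"
    using radial_derivative_measurable[OF \<phi>] test_functions_measurable[OF \<phi>] by auto
  have i: "integrable lborel (\<lambda>s. indicator {\<rho>..b} s *\<^sub>R ?f s)"
    using borel_integrable_atLeastAtMost'[OF continuous_on_test_function_ray[OF \<phi>, of "{\<rho>..b}" \<omega>]]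
    by (simp add: set_integrable_def)
  have v: "(LINT s|lborel. indicator {\<rho>..b} s *\<^sub>R ?f s) = \<phi> (b *\<^sub>R \<omega>) - \<phi> (\<rho> *\<^sub>R \<omega>)"
    using b(1) DERIV_test_function_ray[OF \<phi>, of \<omega>] continuous_on_test_function_ray[OF \<phi>, of "{\<rho>..b}" \<omega>]
    by (intro integral_FTC_atLeastAtMost)
      (auto simp: has_real_derivative_iff_has_vector_derivative[symmetric] intro: has_field_derivative_at_within)
  have ae: "AE s in lborel. indicator {\<rho><..} s *\<^sub>R radial_derivative \<phi> (s *\<^sub>R \<omega>) = indicator {\<rho>..b} s *\<^sub>R ?f s"
    using AE_lborel_singleton[of \<rho>]
  proof eventually_elim
    case (elim s)
    consider "s < \<rho>" | "\<rho> < s" "s \<le> b" | "b < s" using elim by linarith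
    then show ?case
    proof cases
      case 2
      then show ?thesis using \<rho> by (simp add: radial_derivative_scaleR[OF \<omega>])
    next
      case 3
      then have "grad \<phi> (s *\<^sub>R \<omega>) = 0" using b(1) \<rho> \<omega> by (intro b(2)[THEN conjunct2]) simp
      then show ?thesis using 3 by (simp add: radial_derivative_def)
    qed simp
  qed
  have m1: "(\<lambda>s. indicator {\<rho><..} s *\<^sub>R radial_derivative \<phi> (s *\<^sub>R \<omega>)) \<in> borel_measurable lborel" by measurable
  have m2: "(\<lambda>s. indicator {\<rho>..b} s *\<^sub>R ?f s) \<in> borel_measurable lborel" by measurable
  show "set_integrable lborel {\<rho><..} (\<lambda>s. radial_derivative \<phi> (s *\<^sub>R \<omega>))"
    using integrable_cong_AE[OF m1 m2 ae] i by (simp add: set_integrable_def)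
  have "\<phi> (b *\<^sub>R \<omega>) = 0" using b \<rho> \<omega> by simp
  then show "(LINT s:{\<rho><..}|lborel. radial_derivative \<phi> (s *\<^sub>R \<omega>)) = - \<phi> (\<rho> *\<^sub>R \<omega>)"
    using v integral_cong_AE[OF m1 m2 ae] by (simp add: set_lebesgue_integral_def)
qed

text \<open>On each ray the left-hand side is \<open>|\<integral> (\<partial>\<^sub>r\<phi> - H) ds|\<^sup>p\<close>, and Jensen's inequality with the weight \<open>s\<^bsup>m-1\<^esup>\<close>,
  which has finite mass at infinity as \<open>m < 0\<close>, produces the weight \<open>s\<^bsup>n-1\<^esup>\<close> of polar coordinates.\<close>

lemma ray_trace_estimate:
  fixes \<phi> H :: "'a::euclidean_space \<Rightarrow> real"
  assumes p: "1 < p" and m: "m < 0" "m * (p - 1) = p - real DIM('a)"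
    and \<phi>: "\<phi> \<in> test_functions (exterior r)" and \<rho>: "r < \<rho>" "0 < \<rho>" and H: "H \<in> borel_measurable borel"
  defines "C \<equiv> \<rho> ^ (DIM('a) - 1) * (\<rho> powr m / \<bar>m\<bar>) powr (p - 1)"
  shows "(\<integral>\<^sup>+x. ennreal (\<bar>ray_trace \<rho> H x - \<phi> x\<bar> powr p) \<partial>sphere_measure \<rho>)
    \<le> ennreal C * (\<integral>\<^sup>+x. ennreal (\<bar>radial_derivative \<phi> x - H x\<bar> powr p) \<partial>lborel)"
proof -
  note [measurable] = H ray_trace_measurable[OF H] test_functions_measurable[OF \<phi>] radial_derivative_measurable[OF \<phi>]
  let ?V = "\<rho> powr m / \<bar>m\<bar>"
  let ?N = "ray_integral {\<rho><..} (\<lambda>x. \<bar>radial_derivative \<phi> x - H x\<bar> powr p)"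
  have V: "?V > 0" using m \<rho> by (intro divide_pos_pos) auto
  have ray: "ennreal (\<bar>ray_trace \<rho> H (\<rho> *\<^sub>R \<omega>) - \<phi> (\<rho> *\<^sub>R \<omega>)\<bar> powr p) \<le> ennreal (?V powr (p - 1)) * ?N \<omega>"
    if \<omega>: "norm \<omega> = 1" for \<omega>
  proof (cases "?N \<omega> = \<infinity>")
    case True
    \<comment> \<open>on such rays \<open>H\<close> need not be integrable and \<open>ray_trace\<close> has a default value, but the bound is trivial\<close>
    have "?V powr (p - 1) > 0" using m \<rho> by simp
    then have "ennreal (?V powr (p - 1)) \<noteq> 0" by (simp add: ennreal_eq_0_iff)
    then show ?thesis unfolding True by (simp add: ennreal_mult_top del: powr_gt_zero)
  next
    case False
    let ?f = "\<lambda>s. radial_derivative \<phi> (s *\<^sub>R \<omega>) - H (s *\<^sub>R \<omega>)" and ?w = "\<lambda>s. s powr (m - 1)"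
    have wn: "?w s powr (1 - p) = s ^ (DIM('a) - 1)" if "s \<in> {\<rho><..}" for s
    proof -
      have "s > 0" using that \<rho> by simp
      moreover have "(m - 1) * (1 - p) = real (DIM('a) - 1)" using m by (simp add: algebra_simps of_nat_diff)
      ultimately show ?thesis unfolding powr_powr by (simp only: powr_realpow)
    qed
    have N: "?N \<omega> = (\<integral>\<^sup>+s. ennreal (indicator {\<rho><..} s *\<^sub>R (\<bar>?f s\<bar> powr p * ?w s powr (1 - p))) \<partial>lborel)"
      unfolding ray_integral_def using \<rho>
      by (intro nn_integral_cong) (auto simp: indicator_def wn ennreal_mult mult.commute)
    have fi: "set_integrable lborel {\<rho><..} (\<lambda>s. \<bar>?f s\<bar> powr p * ?w s powr (1 - p))"
      unfolding set_integrable_def using False unfolding N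
      by (intro integrableI_nonneg) (auto simp: less_top)
    note J = jensen_powr[OF p, of ?f ?w "{\<rho><..}" ?V, OF _ _ _ _ integral_powr_greaterThan[OF \<rho>(2) m(1)] V fi]
    have f: "set_integrable lborel {\<rho><..} ?f" using \<rho> by (intro J(1)) auto
    note t = test_function_ray_integral[OF \<phi> \<rho> \<omega>]
    have Hi: "set_integrable lborel {\<rho><..} (\<lambda>s. H (s *\<^sub>R \<omega>))"
      using set_integral_diff(1)[OF t(1) f] by simp
    have "ray_trace \<rho> H (\<rho> *\<^sub>R \<omega>) = - (LINT s:{\<rho><..}|lborel. H (s *\<^sub>R \<omega>))"
      using \<omega> \<rho> by (simp add: ray_trace_def)
    then have "ray_trace \<rho> H (\<rho> *\<^sub>R \<omega>) - \<phi> (\<rho> *\<^sub>R \<omega>) = (LINT s:{\<rho><..}|lborel. ?f s)"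
      using t(2) by (simp add: set_integral_diff(2)[OF t(1) Hi])
    then have "\<bar>ray_trace \<rho> H (\<rho> *\<^sub>R \<omega>) - \<phi> (\<rho> *\<^sub>R \<omega>)\<bar> powr p
      \<le> ?V powr (p - 1) * (LINT s:{\<rho><..}|lborel. \<bar>?f s\<bar> powr p * ?w s powr (1 - p))"
      using J(2) \<rho> by simp
    moreover have "?N \<omega> = ennreal (LINT s:{\<rho><..}|lborel. \<bar>?f s\<bar> powr p * ?w s powr (1 - p))"
      unfolding N set_lebesgue_integral_def using fi
      by (intro nn_integral_eq_integral) (auto simp: set_integrable_def indicator_def)
    ultimately show ?thesis by (simp add: ennreal_leI flip: ennreal_mult')
  qed
  have "(\<integral>\<^sup>+x. ennreal (\<bar>ray_trace \<rho> H x - \<phi> x\<bar> powr p) \<partial>sphere_measure \<rho>)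
    = ennreal (\<rho> ^ (DIM('a) - 1)) * (\<integral>\<^sup>+\<omega>. ennreal (\<bar>ray_trace \<rho> H (\<rho> *\<^sub>R \<omega>) - \<phi> (\<rho> *\<^sub>R \<omega>)\<bar> powr p) \<partial>sphere_measure 1)"
    by (rule nn_integral_sphere_measure_unit[OF _ \<rho>(2)]) measurable
  also have "\<dots> \<le> ennreal (\<rho> ^ (DIM('a) - 1)) * (\<integral>\<^sup>+\<omega>. ennreal (?V powr (p - 1)) * ?N \<omega> \<partial>sphere_measure 1)"
    using AE_sphere_measure_norm[of 1, where 'a = 'a, OF zero_less_one]
  proof (intro mult_left_mono nn_integral_mono_AE, eventually_elim)
    case (elim \<omega>)
    show ?case by (rule ray) (rule elim)
  qed simp
  also have "\<dots> = ennreal C * (\<integral>\<^sup>+\<omega>. ?N \<omega> \<partial>sphere_measure 1)"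
    using \<rho> V by (simp add: nn_integral_cmult C_def ennreal_mult mult.assoc)
  also have "(\<integral>\<^sup>+\<omega>. ?N \<omega> \<partial>sphere_measure 1)
    = (\<integral>\<^sup>+x. ennreal (\<bar>radial_derivative \<phi> x - H x\<bar> powr p) * indicator {x. norm x \<in> {\<rho><..}} x \<partial>lborel)"
    using \<rho> by (intro nn_integral_polar_radial_set[symmetric]) auto
  also have "\<dots> \<le> (\<integral>\<^sup>+x. ennreal (\<bar>radial_derivative \<phi> x - H x\<bar> powr p) \<partial>lborel)"
    by (intro nn_integral_mono) (auto simp: indicator_def)
  finally show ?thesis by (simp add: mult_left_mono)
qed

lemma ray_trace_tendsto:
  fixes u U H :: "'a::euclidean_space \<Rightarrow> real"
  assumes p: "1 < p" and m: "m < 0" "m * (p - 1) = p - real DIM('a)" and \<rho>: "r < \<rho>" "0 < \<rho>"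
    and u: "u \<in> W1p (exterior r) p" and rep: "radial_representative (exterior r) u U H"
    and \<phi>: "\<And>k. \<phi> k \<in> test_functions (exterior r)" and lim: "(\<lambda>k. W1p_norm (exterior r) p (\<lambda>x. u x - \<phi> k x)) \<longlonglongrightarrow> 0"
  shows "\<And>k. integrable (sphere_measure \<rho>) (\<lambda>x. \<bar>ray_trace \<rho> H x - \<phi> k x\<bar> powr p)"
    "(\<lambda>k. LINT x|sphere_measure \<rho>. \<bar>ray_trace \<rho> H x - \<phi> k x\<bar> powr p) \<longlonglongrightarrow> 0"
proof -
  have \<Omega>: "open (exterior r :: 'a set)" by (auto simp: exterior_def)
  have H: "H \<in> borel_measurable borel" using rep by (simp add: radial_representative_def)
  note [measurable] = H ray_trace_measurable[OF H] test_functions_measurable(1)[OF \<phi>]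
  note T = radial_representative_tendsto[OF \<Omega> u p \<phi> lim rep]
  define C where "C = \<rho> ^ (DIM('a) - 1) * (\<rho> powr m / \<bar>m\<bar>) powr (p - 1)"
  have C: "C \<ge> 0" using \<rho> by (simp add: C_def)
  define e where "e k = (LINT x|lborel. \<bar>radial_derivative (\<phi> k) x - H x\<bar> powr p)" for k
  have e: "e k \<ge> 0" for k unfolding e_def by (intro Bochner_Integration.integral_nonneg) simp
  have le: "(\<integral>\<^sup>+x. ennreal (\<bar>ray_trace \<rho> H x - \<phi> k x\<bar> powr p) \<partial>sphere_measure \<rho>) \<le> ennreal (C * e k)" for k
  proof -
    have "(\<integral>\<^sup>+x. ennreal (\<bar>radial_derivative (\<phi> k) x - H x\<bar> powr p) \<partial>lborel) = ennreal (e k)"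
      unfolding e_def using T(3) by (intro nn_integral_eq_integral) auto
    then show ?thesis
      using ray_trace_estimate[OF p m \<phi> \<rho> H, of k] C e[of k] by (simp add: C_def ennreal_mult)
  qed
  show i: "integrable (sphere_measure \<rho>) (\<lambda>x. \<bar>ray_trace \<rho> H x - \<phi> k x\<bar> powr p)" for k
    using le[of k] by (intro integrableI_nonneg) (auto intro: le_less_trans)
  have le2: "(LINT x|sphere_measure \<rho>. \<bar>ray_trace \<rho> H x - \<phi> k x\<bar> powr p) \<le> C * e k" for k
  proof -
    have "ennreal (LINT x|sphere_measure \<rho>. \<bar>ray_trace \<rho> H x - \<phi> k x\<bar> powr p) \<le> ennreal (C * e k)"
      using le[of k] by (subst nn_integral_eq_integral[symmetric, OF i]) auto
    then show ?thesis using C e[of k] by (subst (asm) ennreal_le_iff) auto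
  qed
  have lim2: "(\<lambda>k. C * e k) \<longlonglongrightarrow> 0"
    using tendsto_mult_left[OF T(4), of C] by (simp add: e_def)
  have nn: "0 \<le> (LINT x|sphere_measure \<rho>. \<bar>ray_trace \<rho> H x - \<phi> k x\<bar> powr p)" for k
    by (intro Bochner_Integration.integral_nonneg) simp
  show "(\<lambda>k. LINT x|sphere_measure \<rho>. \<bar>ray_trace \<rho> H x - \<phi> k x\<bar> powr p) \<longlonglongrightarrow> 0"
  proof (rule tendsto_sandwich[OF _ _ tendsto_const lim2])
    show "\<forall>\<^sub>F k in sequentially. 0 \<le> (LINT x|sphere_measure \<rho>. \<bar>ray_trace \<rho> H x - \<phi> k x\<bar> powr p)"
      by (intro always_eventually allI nn)
    show "\<forall>\<^sub>F k in sequentially. (LINT x|sphere_measure \<rho>. \<bar>ray_trace \<rho> H x - \<phi> k x\<bar> powr p) \<le> C * e k"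
      by (intro always_eventually allI le2)
  qed
qed

lemma is_sphere_trace_ray_trace:
  fixes u U H :: "'a::euclidean_space \<Rightarrow> real"
  assumes p: "1 < p" and m: "m < 0" "m * (p - 1) = p - real DIM('a)" and \<rho>: "r < \<rho>" "0 < \<rho>"
    and u: "u \<in> W1p_0 (exterior r) p" and rep: "radial_representative (exterior r) u U H"
  shows "is_sphere_trace (exterior r) p \<rho> u (ray_trace \<rho> H)"
proof -
  have u1: "u \<in> W1p (exterior r) p" using u by (simp add: W1p_0_def)
  obtain \<phi> where \<phi>: "\<And>k. \<phi> k \<in> test_functions (exterior r)" "(\<lambda>k. W1p_norm (exterior r) p (\<lambda>x. u x - \<phi> k x)) \<longlonglongrightarrow> 0"
    using u by (auto simp: W1p_0_def)
  have H: "H \<in> borel_measurable borel" using rep by (simp add: radial_representative_def)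
  note [measurable] = H ray_trace_measurable[OF H] test_functions_measurable(1)[OF \<phi>(1)]
  note R = ray_trace_tendsto[OF p m \<rho> u1 rep \<phi>]
  have "integrable (sphere_measure \<rho>) (\<lambda>x. \<bar>ray_trace \<rho> H x\<bar> powr p)"
    using p R(1)[of 0] test_function_sphere_integrable[OF \<phi>(1)[of 0], of p \<rho>]
      integrable_powr_diff[of p "\<lambda>x. ray_trace \<rho> H x - \<phi> 0 x" "sphere_measure \<rho>" "\<lambda>x. - \<phi> 0 x"] by simp
  then show ?thesis
    unfolding is_sphere_trace_def using R(2) \<phi> ray_trace_measurable[OF H] by blast
qed

text \<open>The sequence that comes with the trace \<open>g\<close> also converges to \<open>ray_trace \<rho> H\<close>, which does not depend on it.\<close>

lemma sphere_trace_AE_eq_ray_trace: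
  fixes u U H g :: "'a::euclidean_space \<Rightarrow> real"
  assumes p: "1 < p" and m: "m < 0" "m * (p - 1) = p - real DIM('a)" and \<rho>: "r < \<rho>" "0 < \<rho>"
    and u: "u \<in> W1p (exterior r) p" and rep: "radial_representative (exterior r) u U H"
    and g: "is_sphere_trace (exterior r) p \<rho> u g"
  shows "AE x in sphere_measure \<rho>. g x = ray_trace \<rho> H x"
proof -
  obtain \<phi> where \<phi>: "\<And>k. \<phi> k \<in> test_functions (exterior r)" "(\<lambda>k. W1p_norm (exterior r) p (\<lambda>x. u x - \<phi> k x)) \<longlonglongrightarrow> 0"
    and lim: "(\<lambda>k. LINT x|sphere_measure \<rho>. \<bar>g x - \<phi> k x\<bar> powr p) \<longlonglongrightarrow> 0"
    and gm[measurable]: "g \<in> borel_measurable borel" and gi: "integrable (sphere_measure \<rho>) (\<lambda>x. \<bar>g x\<bar> powr p)"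
    using g by (auto simp: is_sphere_trace_def)
  have H: "H \<in> borel_measurable borel" using rep by (simp add: radial_representative_def)
  note [measurable] = H ray_trace_measurable[OF H] test_functions_measurable(1)[OF \<phi>(1)]
  note R = ray_trace_tendsto[OF p m \<rho> u rep \<phi>]
  have p1: "p \<ge> 1" using p by simp
  have gi': "integrable (sphere_measure \<rho>) (\<lambda>x. \<bar>g x - \<phi> k x\<bar> powr p)" for k
    using integrable_powr_diff[OF p1, of g "sphere_measure \<rho>" "\<phi> k"] gi test_function_sphere_integrable[OF \<phi>(1)[of k], of p \<rho>] p
    by simp
  have i: "integrable (sphere_measure \<rho>) (\<lambda>x. \<bar>(g x - \<phi> 0 x) - (ray_trace \<rho> H x - \<phi> 0 x)\<bar> powr p)"
    using integrable_powr_diff[OF p1, of "\<lambda>x. g x - \<phi> 0 x" "sphere_measure \<rho>" "\<lambda>x. ray_trace \<rho> H x - \<phi> 0 x"] gi'[of 0] R(1)[of 0]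
    by simp
  define I where "I = (LINT x|sphere_measure \<rho>. \<bar>g x - ray_trace \<rho> H x\<bar> powr p)"
  have "I \<le> 2 powr (p - 1) * ((LINT x|sphere_measure \<rho>. \<bar>g x - \<phi> k x\<bar> powr p) + (LINT x|sphere_measure \<rho>. \<bar>ray_trace \<rho> H x - \<phi> k x\<bar> powr p))" for k
  proof -
    have "I \<le> (LINT x|sphere_measure \<rho>. 2 powr (p - 1) * (\<bar>g x - \<phi> k x\<bar> powr p + \<bar>ray_trace \<rho> H x - \<phi> k x\<bar> powr p))"
      unfolding I_def
    proof (rule integral_mono)
      show "integrable (sphere_measure \<rho>) (\<lambda>x. \<bar>g x - ray_trace \<rho> H x\<bar> powr p)" using i by simp
      show "integrable (sphere_measure \<rho>) (\<lambda>x. 2 powr (p - 1) * (\<bar>g x - \<phi> k x\<bar> powr p + \<bar>ray_trace \<rho> H x - \<phi> k x\<bar> powr p))"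
        using gi' R(1) by simp
      show "\<bar>g x - ray_trace \<rho> H x\<bar> powr p \<le> 2 powr (p - 1) * (\<bar>g x - \<phi> k x\<bar> powr p + \<bar>ray_trace \<rho> H x - \<phi> k x\<bar> powr p)" for x
        using norm_powr_triangle_half[OF p1, of "g x - \<phi> k x" "ray_trace \<rho> H x - \<phi> k x"] by simp
    qed
    then show ?thesis using gi' R(1) by simp
  qed
  note le = this
  have "(\<lambda>k. 2 powr (p - 1) * ((LINT x|sphere_measure \<rho>. \<bar>g x - \<phi> k x\<bar> powr p) + (LINT x|sphere_measure \<rho>. \<bar>ray_trace \<rho> H x - \<phi> k x\<bar> powr p))) \<longlonglongrightarrow> 2 powr (p - 1) * (0 + 0)"
    by (intro tendsto_mult_left tendsto_add lim R(2))
  from LIMSEQ_le_const[OF this, of I] le have "I \<le> 2 powr (p - 1) * (0 + 0)" by blast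
  then have "I \<le> 0" by simp
  moreover have "I \<ge> 0" unfolding I_def by (intro Bochner_Integration.integral_nonneg) simp
  ultimately have "I = 0" by simp
  then have "AE x in sphere_measure \<rho>. \<bar>g x - ray_trace \<rho> H x\<bar> powr p = 0"
    unfolding I_def using i by (subst (asm) integral_nonneg_eq_0_iff_AE) auto
  then show ?thesis by eventually_elim simp
qed

section \<open>The inequality\<close>

lemma set_lebesgue_integral_borel_version:
  fixes f F :: "'a::euclidean_space \<Rightarrow> real"
  assumes F: "F \<in> borel_measurable borel" and ae: "AE x in lebesgue. indicator S x *\<^sub>R f x = F x"
  shows "set_integrable lebesgue S f \<longleftrightarrow> integrable lborel F"
    "(LINT x:S|lebesgue. f x) = (LINT x|lborel. F x)"
proof -
  have Fl: "F \<in> borel_measurable lebesgue" using F by (simp add: measurable_completion)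
  have fl: "(\<lambda>x. indicator S x *\<^sub>R f x) \<in> borel_measurable lebesgue"
    by (rule borel_measurable_lebesgue_AE[OF Fl ae])
  have "integrable lebesgue F \<longleftrightarrow> integrable lborel F" using F by (intro integrable_completion) simp
  then show "set_integrable lebesgue S f \<longleftrightarrow> integrable lborel F"
    unfolding set_integrable_def using integrable_cong_AE[OF fl Fl ae] by simp
  have "(LINT x|lebesgue. F x) = (LINT x|lborel. F x)" using F by (intro integral_completion) simp
  then show "(LINT x:S|lebesgue. f x) = (LINT x|lborel. F x)"
    unfolding set_lebesgue_integral_def using integral_cong_AE[OF fl Fl ae] by simp
qed

lemma AE_lebesgue_norm_neq: "AE x::'a::euclidean_space in lebesgue. norm x \<noteq> \<rho>"
proof -
  have "AE x::'a in lebesgue. x \<notin> sphere 0 \<rho>"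
    using negligible_sphere[of "0::'a" \<rho>] by (intro AE_not_in) (simp add: negligible_iff_null_sets)
  then show ?thesis by eventually_elim (simp add: dist_norm)
qed

lemma open_exterior: "open (exterior r)"
  by (auto simp: exterior_def)

lemma continuous_on_weights:
  assumes "0 < r" "m < 0"
  shows "continuous_on (exterior r) (annulus_weight p m r :: 'a::euclidean_space \<Rightarrow> real)"
    "continuous_on (exterior r) (exterior_weight p m :: 'a::euclidean_space \<Rightarrow> real)"
proof -
  have x: "norm x \<noteq> 0" "\<bar>norm x powr m - r powr m\<bar> \<noteq> 0" if "x \<in> exterior r" for x :: 'a
  proof -
    have "r < norm x" using that by (simp add: exterior_def)
    then show "norm x \<noteq> 0" "\<bar>norm x powr m - r powr m\<bar> \<noteq> 0"
      using assms powr_less_mono2_neg[of m r "norm x"] by auto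
  qed
  show "continuous_on (exterior r) (annulus_weight p m r :: 'a \<Rightarrow> real)"
    unfolding annulus_weight_def
    by (intro continuous_on_divide continuous_on_mult continuous_on_powr continuous_on_rabs continuous_on_diff continuous_on_norm continuous_on_const continuous_on_id)
      (use x in auto)
  show "continuous_on (exterior r) (exterior_weight p m :: 'a \<Rightarrow> real)"
    unfolding exterior_weight_def
    by (intro continuous_on_divide continuous_on_powr continuous_on_norm continuous_on_const continuous_on_id)
      (use x in auto)
qed

lemma weights_nonneg: "0 \<le> annulus_weight p m r x" "0 \<le> exterior_weight p m x"
  by (simp_all add: annulus_weight_def exterior_weight_def)

lemma hardy_terms_representative:
  fixes u U H :: "'a::euclidean_space \<Rightarrow> real"
  assumes r: "0 < r" "r < \<gamma>" and m: "m \<noteq> 0" and p: "p > 0" and rep: "radial_representative (exterior r) u U H"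
  defines "A1 \<equiv> {x::'a. norm x \<in> {r<..<\<gamma>}}" and "A2 \<equiv> {x::'a. norm x \<in> {\<gamma><..}}"
  shows "K11 p m r \<gamma> u = (LINT x|lborel. \<bar>U x\<bar> powr p * annulus_weight p m r x * indicator A1 x)"
    "K12 p m \<gamma> u = (LINT x|lborel. \<bar>U x\<bar> powr p * exterior_weight p m x * indicator A2 x)"
    "hardy_lhs p r u = (LINT x|lborel. \<bar>H x\<bar> powr p * indicator A1 x + \<bar>H x\<bar> powr p * indicator A2 x)"
    "integrable lborel (\<lambda>x. \<bar>U x\<bar> powr p * annulus_weight p m r x * indicator A1 x)
      \<Longrightarrow> set_integrable lebesgue (ball 0 \<gamma> - ball 0 r) (K11_integrand p m r u)"
    "integrable lborel (\<lambda>x. \<bar>U x\<bar> powr p * exterior_weight p m x * indicator A2 x)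
      \<Longrightarrow> set_integrable lebesgue (exterior \<gamma>) (K12_integrand p u)"
    "set_integrable lebesgue (ball 0 \<gamma> - ball 0 r) (K11_integrand p m r u)
      \<Longrightarrow> integrable lborel (\<lambda>x. \<bar>U x\<bar> powr p * annulus_weight p m r x * indicator A1 x)"
    "set_integrable lebesgue (exterior \<gamma>) (K12_integrand p u)
      \<Longrightarrow> integrable lborel (\<lambda>x. \<bar>U x\<bar> powr p * exterior_weight p m x * indicator A2 x)"
proof -
  have [measurable]: "U \<in> borel_measurable borel" "H \<in> borel_measurable borel"
    and aeU: "AE x in lebesgue. U x = indicator (exterior r) x * u x"
    and aeH: "AE x in lebesgue. H x = indicator (exterior r) x * ((x \<bullet> weak_gradient (exterior r) u x) / norm x)"
    using rep by (auto simp: radial_representative_def)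
  have [measurable]: "A1 \<in> sets borel" "A2 \<in> sets borel" unfolding A1_def A2_def by measurable
  have mp: "\<bar>m\<bar> powr p > 0" using m by simp
  let ?F1 = "\<lambda>x. \<bar>U x\<bar> powr p * annulus_weight p m r x * indicator A1 x"
  let ?F2 = "\<lambda>x. \<bar>U x\<bar> powr p * exterior_weight p m x * indicator A2 x"
  have m1: "(\<lambda>x. ?F1 x / \<bar>m\<bar> powr p) \<in> borel_measurable borel" by measurable
  have m2: "(\<lambda>x. ?F2 x / \<bar>m\<bar> powr p) \<in> borel_measurable borel" by measurable
  have ae1: "AE x in lebesgue. indicator (ball 0 \<gamma> - ball 0 r) x *\<^sub>R K11_integrand p m r u x = ?F1 x / \<bar>m\<bar> powr p"
    using aeU AE_lebesgue_norm_neq[of r]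
    by eventually_elim (use mp in \<open>auto simp: indicator_def A1_def exterior_def K11_integrand_def annulus_weight_def\<close>)
  have ae2: "AE x in lebesgue. indicator (exterior \<gamma>) x *\<^sub>R K12_integrand p u x = ?F2 x / \<bar>m\<bar> powr p"
    using aeU
    by eventually_elim (use mp r in \<open>auto simp: indicator_def A2_def exterior_def K12_integrand_def exterior_weight_def\<close>)
  note B1 = set_lebesgue_integral_borel_version[OF m1 ae1] and B2 = set_lebesgue_integral_borel_version[OF m2 ae2]
  show "K11 p m r \<gamma> u = (LINT x|lborel. ?F1 x)" "K12 p m \<gamma> u = (LINT x|lborel. ?F2 x)"
    using mp unfolding K11_def K12_def B1(2) B2(2) by simp_all
  show "set_integrable lebesgue (ball 0 \<gamma> - ball 0 r) (K11_integrand p m r u)" if "integrable lborel ?F1"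
    unfolding B1(1) using that by (rule integrable_divide)
  show "set_integrable lebesgue (exterior \<gamma>) (K12_integrand p u)" if "integrable lborel ?F2"
    unfolding B2(1) using that by (rule integrable_divide)
  show "integrable lborel ?F1" if "set_integrable lebesgue (ball 0 \<gamma> - ball 0 r) (K11_integrand p m r u)"
    using integrable_mult_left[OF that[unfolded B1(1)], of "\<bar>m\<bar> powr p"] mp by (simp add: mult.assoc)
  show "integrable lborel ?F2" if "set_integrable lebesgue (exterior \<gamma>) (K12_integrand p u)"
    using integrable_mult_left[OF that[unfolded B2(1)], of "\<bar>m\<bar> powr p"] mp by (simp add: mult.assoc)
  have m3: "(\<lambda>x. \<bar>H x\<bar> powr p * indicator A1 x + \<bar>H x\<bar> powr p * indicator A2 x) \<in> borel_measurable borel"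
    by measurable
  have ae3: "AE x in lebesgue. indicator (exterior r) x *\<^sub>R \<bar>(x \<bullet> weak_gradient (exterior r) u x) / norm x\<bar> powr p
    = \<bar>H x\<bar> powr p * indicator A1 x + \<bar>H x\<bar> powr p * indicator A2 x"
    using aeH AE_lebesgue_norm_neq[of \<gamma>]
    by eventually_elim (use r p in \<open>auto simp: indicator_def A1_def A2_def exterior_def\<close>)
  show "hardy_lhs p r u = (LINT x|lborel. \<bar>H x\<bar> powr p * indicator A1 x + \<bar>H x\<bar> powr p * indicator A2 x)"
    unfolding hardy_lhs_def by (rule set_lebesgue_integral_borel_version(2)[OF m3 ae3])
qed

text \<open>The limit is taken along the sequence that comes with the trace chosen by \<open>sphere_trace\<close>, so that one
  sequence serves the boundary term and the two integrals.\<close>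

lemma hardy_inequality_exterior:
  fixes u :: "'a::euclidean_space \<Rightarrow> real"
  assumes p: "1 < p" and r: "0 < r" "r < \<gamma>" and m: "m < 0" "m * (p - 1) = p - real DIM('a)"
    and \<gamma>: "\<gamma> powr m = r powr m / 2" and u: "u \<in> W1p_0 (exterior r) p"
  shows "set_integrable lebesgue (ball 0 \<gamma> - ball 0 r) (K11_integrand p m r u)"
    "set_integrable lebesgue (exterior \<gamma>) (K12_integrand p u)"
    "hardy_rhs p m r \<gamma> u \<le> hardy_lhs p r u"
proof -
  have u1: "u \<in> W1p (exterior r) p" using u by (simp add: W1p_0_def)
  obtain U H where rep: "radial_representative (exterior r) u U H"
    using radial_representative_exists[OF open_exterior u1] by blast
  have \<gamma>0: "0 < \<gamma>" and p0: "p > 0" and m0: "m \<noteq> 0" using r p m by auto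
  define g where "g = sphere_trace (exterior r) p \<gamma> u"
  have "is_sphere_trace (exterior r) p \<gamma> u g"
    unfolding g_def sphere_trace_def
    by (rule someI[of _ "ray_trace \<gamma> H"]) (rule is_sphere_trace_ray_trace[OF p m r(2) \<gamma>0 u rep])
  then obtain \<phi> where g: "g \<in> borel_measurable borel" "integrable (sphere_measure \<gamma>) (\<lambda>x. \<bar>g x\<bar> powr p)"
      "(\<lambda>k. LINT x|sphere_measure \<gamma>. \<bar>g x - \<phi> k x\<bar> powr p) \<longlonglongrightarrow> 0"
    and \<phi>: "\<And>k. \<phi> k \<in> test_functions (exterior r)" "(\<lambda>k. W1p_norm (exterior r) p (\<lambda>x. u x - \<phi> k x)) \<longlonglongrightarrow> 0"
    by (auto simp: is_sphere_trace_def)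
  let ?A1 = "{x::'a. norm x \<in> {r<..<\<gamma>}}" and ?A2 = "{x::'a. norm x \<in> {\<gamma><..}}"
  let ?\<kappa> = "\<bar>m\<bar> powr (p - 1) * \<gamma> powr (1 - p)"
  have A: "?A1 \<in> sets borel" "?A2 \<in> sets borel" by measurable
  have \<kappa>: "?\<kappa> \<ge> 0" by simp
  note L1 = hardy_limit[OF open_exterior u1 p \<phi> rep weights_measurable(1) continuous_on_weights(1)[OF r(1) m(1)]
      weights_nonneg(1) A(1) \<kappa> hardy_annulus[OF p r m \<gamma>] g]
  note L2 = hardy_limit[OF open_exterior u1 p \<phi> rep weights_measurable(2) continuous_on_weights(2)[OF r(1) m(1)]
      weights_nonneg(2) A(2) \<kappa> hardy_exterior[OF p r m] g]
  note R = hardy_terms_representative[OF r m0 p0 rep]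
  show "set_integrable lebesgue (ball 0 \<gamma> - ball 0 r) (K11_integrand p m r u)" by (rule R(4)[OF L1(1)])
  show "set_integrable lebesgue (exterior \<gamma>) (K12_integrand p u)" by (rule R(5)[OF L2(1)])
  have K0: "K0 p m r \<gamma> u = ?\<kappa> * (LINT x|sphere_measure \<gamma>. \<bar>g x\<bar> powr p)"
    by (simp add: K0_def sphere_integral_def g_def)
  have K0n: "0 \<le> K0 p m r \<gamma> u" unfolding K0 by (intro mult_nonneg_nonneg Bochner_Integration.integral_nonneg) auto
  have K1n: "0 \<le> K11 p m r \<gamma> u" "0 \<le> K12 p m \<gamma> u"
    unfolding R(1,2) by (intro Bochner_Integration.integral_nonneg; simp add: weights_nonneg)+
  have Dn: "0 \<le> (LINT x|lborel. \<bar>H x\<bar> powr p * indicator ?A1 x)" "0 \<le> (LINT x|lborel. \<bar>H x\<bar> powr p * indicator ?A2 x)"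
    by (intro Bochner_Integration.integral_nonneg; simp)+
  have "(1 / p) powr p * hardy_summand p (K0 p m r \<gamma> u) (K11 p m r \<gamma> u) \<le> (LINT x|lborel. \<bar>H x\<bar> powr p * indicator ?A1 x)"
    by (rule hardy_summand_le[OF p K0n K1n(1) Dn(1)]) (unfold K0 R(1), rule L1(3))
  moreover have "(1 / p) powr p * hardy_summand p (K0 p m r \<gamma> u) (K12 p m \<gamma> u) \<le> (LINT x|lborel. \<bar>H x\<bar> powr p * indicator ?A2 x)"
    by (rule hardy_summand_le[OF p K0n K1n(2) Dn(2)]) (unfold K0 R(2), rule L2(3))
  moreover have "hardy_lhs p r u = (LINT x|lborel. \<bar>H x\<bar> powr p * indicator ?A1 x) + (LINT x|lborel. \<bar>H x\<bar> powr p * indicator ?A2 x)"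
    unfolding R(3) by (rule Bochner_Integration.integral_add[OF L1(2) L2(2)])
  ultimately show "hardy_rhs p m r \<gamma> u \<le> hardy_lhs p r u"
    by (simp add: hardy_rhs_def distrib_left)
qed

section \<open>The extremal functions\<close>

definition beta_profile :: "real \<Rightarrow> real \<Rightarrow> real \<Rightarrow> real \<Rightarrow> real \<Rightarrow> real" where
  "beta_profile m r \<gamma> \<beta> s = (if s < \<gamma> then (r powr m - s powr m) powr \<beta> else s powr (m * \<beta>))"

definition beta_slope :: "real \<Rightarrow> real \<Rightarrow> real \<Rightarrow> real \<Rightarrow> real \<Rightarrow> real" where
  "beta_slope m r \<gamma> \<beta> s =
     (if s < \<gamma> then - (m * \<beta>) * (r powr m - s powr m) powr (\<beta> - 1) * s powr (m - 1)
      else m * \<beta> * s powr (m * \<beta> - 1))"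

lemma u_beta_eq_profile: "r < norm x \<Longrightarrow> u_beta m r \<gamma> \<beta> x = beta_profile m r \<gamma> \<beta> (norm x)"
  by (auto simp: u_beta_def beta_profile_def)

lemma beta_slope_measurable[measurable]: "beta_slope m r \<gamma> \<beta> \<in> borel_measurable borel"
  unfolding beta_slope_def[abs_def] by measurable

lemma DERIV_inner_profile:
  assumes "0 < r" "r < s" "m < 0"
  shows "((\<lambda>s. (r powr m - s powr m) powr \<beta>) has_real_derivative
    - (m * \<beta>) * (r powr m - s powr m) powr (\<beta> - 1) * s powr (m - 1)) (at s)"
proof -
  have "s powr m < r powr m" using assms by (simp add: powr_less_mono2_neg)
  then show ?thesis using assms by (auto intro!: derivative_eq_intros)
qed

lemma DERIV_outer_profile:
  assumes "0 < s"
  shows "((\<lambda>s. s powr (m * \<beta>)) has_real_derivative m * \<beta> * s powr (m * \<beta> - 1)) (at s)"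
  using assms by (auto intro!: derivative_eq_intros)

lemma DERIV_beta_profile:
  assumes "0 < r" "r < s" "m < 0" "s \<noteq> \<gamma>"
  shows "(beta_profile m r \<gamma> \<beta> has_real_derivative beta_slope m r \<gamma> \<beta> s) (at s)"
proof (cases "s < \<gamma>")
  case True
  have "((\<lambda>s. (r powr m - s powr m) powr \<beta>) has_real_derivative beta_slope m r \<gamma> \<beta> s) (at s)"
    using DERIV_inner_profile[OF assms(1-3), of \<beta>] True by (simp add: beta_slope_def)
  then show ?thesis
    by (rule DERIV_cong_ev[THEN iffD1, rotated -1, OF _ refl _ refl])
      (use True in \<open>auto intro!: eventually_nhds_in_open[of "{..<\<gamma>}", THEN eventually_mono] simp: beta_profile_def\<close>)
next
  case False
  then have s: "s > \<gamma>" using assms(4) by simp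
  have "((\<lambda>s. s powr (m * \<beta>)) has_real_derivative beta_slope m r \<gamma> \<beta> s) (at s)"
    using DERIV_outer_profile[of s m \<beta>] assms s by (simp add: beta_slope_def)
  then show ?thesis
    by (rule DERIV_cong_ev[THEN iffD1, rotated -1, OF _ refl _ refl])
      (use s in \<open>auto intro!: eventually_nhds_in_open[of "{\<gamma><..}", THEN eventually_mono] simp: beta_profile_def\<close>)
qed

lemma lipschitz_of_continuous_derivative:
  fixes f f' :: "real \<Rightarrow> real"
  assumes "\<And>s. s \<in> {a..b} \<Longrightarrow> (f has_real_derivative f' s) (at s)" "continuous_on {a..b} f'"
  shows "\<exists>L. L-lipschitz_on {a..b} f \<and> (\<forall>s\<in>{a..b}. \<bar>f' s\<bar> \<le> L)"
proof -
  obtain B where B: "B \<ge> 0" "\<And>s. s \<in> {a..b} \<Longrightarrow> norm (f' s) \<le> B"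
    using bounded_on_compact[OF assms(2) compact_Icc] by metis
  have "B-lipschitz_on {a..b} f"
  proof (rule bounded_derivative_imp_lipschitz)
    show "(f has_derivative (\<lambda>h. f' s * h)) (at s within {a..b})" if "s \<in> {a..b}" for s
      using assms(1)[OF that] by (simp add: has_field_derivative_def has_derivative_at_withinI)
    show "onorm (\<lambda>h. f' s * h) \<le> B" if "s \<in> {a..b}" for s
      using B(2)[OF that] by (intro onorm_le) (auto simp: abs_mult intro!: mult_right_mono)
  qed (use B in auto)
  then show ?thesis using B by auto
qed

lemma beta_profile_lipschitz:
  assumes r: "0 < r" "r < a" "a < \<gamma>" "\<gamma> < b" and m: "m < 0" and \<gamma>: "\<gamma> powr m = r powr m / 2"
  obtains L where "L-lipschitz_on {a..b} (beta_profile m r \<gamma> \<beta>)" "\<And>s. s \<in> {a..b} \<Longrightarrow> \<bar>beta_slope m r \<gamma> \<beta> s\<bar> \<le> L"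
proof -
  let ?f = "\<lambda>s. (r powr m - s powr m) powr \<beta>" and ?g = "\<lambda>s. s powr (m * \<beta>)"
  have ne: "r powr m - s powr m \<noteq> 0" if "s \<in> {a..\<gamma>}" for s
    using powr_less_mono2_neg[of m r s] that r m by auto
  have "\<exists>L. L-lipschitz_on {a..\<gamma>} ?f
      \<and> (\<forall>s\<in>{a..\<gamma>}. \<bar>- (m * \<beta>) * (r powr m - s powr m) powr (\<beta> - 1) * s powr (m - 1)\<bar> \<le> L)"
  proof (rule lipschitz_of_continuous_derivative[of a \<gamma> ?f "\<lambda>s. - (m * \<beta>) * (r powr m - s powr m) powr (\<beta> - 1) * s powr (m - 1)"])
    show "(?f has_real_derivative - (m * \<beta>) * (r powr m - s powr m) powr (\<beta> - 1) * s powr (m - 1)) (at s)" if "s \<in> {a..\<gamma>}" for s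
      using that r m by (intro DERIV_inner_profile) auto
    show "continuous_on {a..\<gamma>} (\<lambda>s. - (m * \<beta>) * (r powr m - s powr m) powr (\<beta> - 1) * s powr (m - 1))"
      using r ne by (intro continuous_on_mult continuous_on_powr continuous_on_diff continuous_on_const continuous_on_id) auto
  qed
  then obtain L1 where L1: "L1-lipschitz_on {a..\<gamma>} ?f"
      "\<And>s. s \<in> {a..\<gamma>} \<Longrightarrow> \<bar>- (m * \<beta>) * (r powr m - s powr m) powr (\<beta> - 1) * s powr (m - 1)\<bar> \<le> L1"
    by blast
  have "\<exists>L. L-lipschitz_on {\<gamma>..b} ?g \<and> (\<forall>s\<in>{\<gamma>..b}. \<bar>m * \<beta> * s powr (m * \<beta> - 1)\<bar> \<le> L)"
  proof (rule lipschitz_of_continuous_derivative[of \<gamma> b ?g "\<lambda>s. m * \<beta> * s powr (m * \<beta> - 1)"])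
    show "(?g has_real_derivative m * \<beta> * s powr (m * \<beta> - 1)) (at s)" if "s \<in> {\<gamma>..b}" for s
      using that r by (intro DERIV_outer_profile) auto
    show "continuous_on {\<gamma>..b} (\<lambda>s. m * \<beta> * s powr (m * \<beta> - 1))"
      using r by (intro continuous_on_mult continuous_on_powr continuous_on_const continuous_on_id) auto
  qed
  then obtain L2 where L2: "L2-lipschitz_on {\<gamma>..b} ?g"
      "\<And>s. s \<in> {\<gamma>..b} \<Longrightarrow> \<bar>m * \<beta> * s powr (m * \<beta> - 1)\<bar> \<le> L2"
    by blast
  have "r powr m - \<gamma> powr m = \<gamma> powr m" using \<gamma> by simp
  then have glue: "?f \<gamma> = ?g \<gamma>" by (simp add: powr_powr)
  then have "(max L1 L2)-lipschitz_on {a..b} (\<lambda>s. if s \<le> \<gamma> then ?f s else ?g s)"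
    by (intro lipschitz_on_concat_max L1 L2)
  moreover have "(\<lambda>s. if s \<le> \<gamma> then ?f s else ?g s) = beta_profile m r \<gamma> \<beta>"
    using glue by (auto simp: beta_profile_def fun_eq_iff)
  ultimately have "(max L1 L2)-lipschitz_on {a..b} (beta_profile m r \<gamma> \<beta>)" by (simp only:)
  moreover have "\<bar>beta_slope m r \<gamma> \<beta> s\<bar> \<le> max L1 L2" if "s \<in> {a..b}" for s
    using that L1(2)[of s] L2(2)[of s] by (cases "s < \<gamma>") (auto simp: beta_slope_def le_max_iff_disj)
  ultimately show ?thesis using that by blast
qed

text \<open>The two branches of the profile agree at \<open>\<gamma>\<close> because \<open>r\<^sup>m - \<gamma>\<^sup>m = \<gamma>\<^sup>m\<close>, so the profile is locally
  Lipschitz; it is differentiable off the sphere of radius \<open>\<gamma>\<close>, a null set.\<close>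

lemma is_weak_gradient_u_beta:
  assumes r: "0 < r" "r < \<gamma>" and m: "m < 0" and \<gamma>: "\<gamma> powr m = r powr m / 2"
  shows "is_weak_gradient (exterior r) (u_beta m r \<gamma> \<beta> :: 'a::euclidean_space \<Rightarrow> real)
    (\<lambda>x. (beta_slope m r \<gamma> \<beta> (norm x) / norm x) *\<^sub>R x)"
proof (rule is_weak_gradient_of_locally_lipschitz[OF open_exterior])
  fix C :: "'a set" assume C: "compact C" "C \<subseteq> exterior r"
  obtain a b where ab: "r < a" "a < \<gamma>" "\<gamma> < b" "\<And>x. x \<in> C \<Longrightarrow> norm x \<in> {a..b}"
    using compact_subset_exterior_bounds[OF C r(2)] by (metis greaterThanLessThan_subseteq_atLeastAtMost_iff order_refl subsetD)
  obtain L where L: "L-lipschitz_on {a..b} (beta_profile m r \<gamma> \<beta>)" "\<And>s. s \<in> {a..b} \<Longrightarrow> \<bar>beta_slope m r \<gamma> \<beta> s\<bar> \<le> L"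
    using beta_profile_lipschitz[OF r(1) ab(1-3) m \<gamma>] by metis
  have "L-lipschitz_on C (u_beta m r \<gamma> \<beta> :: 'a \<Rightarrow> real)"
  proof (rule lipschitz_onI)
    fix x y assume xy: "x \<in> C" "y \<in> C"
    then have "r < norm x" "r < norm y" using C(2) by (auto simp: exterior_def)
    then have "dist (u_beta m r \<gamma> \<beta> x) (u_beta m r \<gamma> \<beta> y) = dist (beta_profile m r \<gamma> \<beta> (norm x)) (beta_profile m r \<gamma> \<beta> (norm y))"
      by (simp add: u_beta_eq_profile)
    also have "\<dots> \<le> L * dist (norm x) (norm y)" by (intro lipschitz_onD[OF L(1)] ab(4) xy)
    also have "\<dots> \<le> L * dist x y"
      using lipschitz_on_nonneg[OF L(1)] norm_triangle_ineq3[of x y]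
      by (intro mult_left_mono) (auto simp: dist_norm)
    finally show "dist (u_beta m r \<gamma> \<beta> x) (u_beta m r \<gamma> \<beta> y) \<le> L * dist x y" .
  qed (rule lipschitz_on_nonneg[OF L(1)])
  then show "\<exists>L. L-lipschitz_on C (u_beta m r \<gamma> \<beta> :: 'a \<Rightarrow> real)" by blast
  have "norm ((beta_slope m r \<gamma> \<beta> (norm x) / norm x) *\<^sub>R x) \<le> L" if "x \<in> C" for x
    using L(2)[OF ab(4)[OF that]] by (cases "x = 0") auto
  then show "\<exists>B. \<forall>x\<in>C. norm ((beta_slope m r \<gamma> \<beta> (norm x) / norm x) *\<^sub>R x) \<le> B" by blast
next
  show "(\<lambda>x::'a. (beta_slope m r \<gamma> \<beta> (norm x) / norm x) *\<^sub>R x) \<in> borel_measurable borel" by measurable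
  have "AE x::'a in lborel. norm x \<noteq> \<gamma>" using AE_lebesgue_norm_neq[of \<gamma>] by (simp add: AE_completion_iff)
  then show "AE x::'a in lborel. x \<in> exterior r \<longrightarrow>
    (u_beta m r \<gamma> \<beta> has_derivative (\<lambda>h. ((beta_slope m r \<gamma> \<beta> (norm x) / norm x) *\<^sub>R x) \<bullet> h)) (at x)"
  proof eventually_elim
    case (elim x)
    show ?case
    proof
      assume x: "x \<in> exterior r"
      then have nx: "r < norm x" by (simp add: exterior_def)
      then have "x \<noteq> 0" using r by auto
      have "(norm has_derivative (\<lambda>h. h \<bullet> sgn x)) (at x)" using \<open>x \<noteq> 0\<close> by (rule has_derivative_norm)
      from DERIV_compose_FDERIV[OF DERIV_beta_profile[OF r(1) nx m elim] this]
      have "((\<lambda>x. beta_profile m r \<gamma> \<beta> (norm x)) has_derivative (\<lambda>h. (h \<bullet> sgn x) * beta_slope m r \<gamma> \<beta> (norm x))) (at x)" .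
      moreover have "(\<lambda>h. (h \<bullet> sgn x) * beta_slope m r \<gamma> \<beta> (norm x)) = (\<lambda>h. ((beta_slope m r \<gamma> \<beta> (norm x) / norm x) *\<^sub>R x) \<bullet> h)"
        by (simp add: fun_eq_iff sgn_div_norm inner_commute divide_inverse mult_ac)
      ultimately have "((\<lambda>x. beta_profile m r \<gamma> \<beta> (norm x)) has_derivative (\<lambda>h. ((beta_slope m r \<gamma> \<beta> (norm x) / norm x) *\<^sub>R x) \<bullet> h)) (at x)"
        by simp
      then show "(u_beta m r \<gamma> \<beta> has_derivative (\<lambda>h. ((beta_slope m r \<gamma> \<beta> (norm x) / norm x) *\<^sub>R x) \<bullet> h)) (at x)"
        by (rule has_derivative_transform_within_open[OF _ open_exterior x])
          (simp add: u_beta_eq_profile exterior_def)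
    qed
  qed
qed

lemma radial_representative_u_beta:
  assumes r: "0 < r" "r < \<gamma>" and m: "m < 0" and \<gamma>: "\<gamma> powr m = r powr m / 2"
  shows "radial_representative (exterior r) (u_beta m r \<gamma> \<beta> :: 'a::euclidean_space \<Rightarrow> real)
    (\<lambda>x. indicator (exterior r) x * beta_profile m r \<gamma> \<beta> (norm x)) (\<lambda>x. indicator (exterior r) x * beta_slope m r \<gamma> \<beta> (norm x))"
  unfolding radial_representative_def
proof (intro conjI)
  have [measurable]: "exterior r \<in> sets (borel :: 'a measure)" by (rule borel_open[OF open_exterior])
  have [measurable]: "beta_profile m r \<gamma> \<beta> \<in> borel_measurable borel"
    unfolding beta_profile_def[abs_def] by measurable
  show "(\<lambda>x::'a. indicator (exterior r) x * beta_profile m r \<gamma> \<beta> (norm x)) \<in> borel_measurable borel" by measurable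
  show "(\<lambda>x::'a. indicator (exterior r) x * beta_slope m r \<gamma> \<beta> (norm x)) \<in> borel_measurable borel" by measurable
  show "AE x::'a in lebesgue. indicator (exterior r) x * beta_profile m r \<gamma> \<beta> (norm x) = indicator (exterior r) x * u_beta m r \<gamma> \<beta> x"
  proof (intro AE_I2)
    fix x :: 'a
    show "indicator (exterior r) x * beta_profile m r \<gamma> \<beta> (norm x) = indicator (exterior r) x * u_beta m r \<gamma> \<beta> x"
      by (cases "x \<in> exterior r") (simp_all add: u_beta_eq_profile exterior_def)
  qed
  show "AE x::'a in lebesgue. indicator (exterior r) x * beta_slope m r \<gamma> \<beta> (norm x)
    = indicator (exterior r) x * ((x \<bullet> weak_gradient (exterior r) (u_beta m r \<gamma> \<beta>) x) / norm x)"
    using weak_gradient_AE_eq[OF open_exterior is_weak_gradient_u_beta[OF r m \<gamma>, of \<beta>]]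
  proof eventually_elim
    case (elim x)
    show ?case
    proof (cases "x \<in> exterior r")
      case True
      then have "norm x \<noteq> 0" using r by (auto simp: exterior_def)
      with True elim show ?thesis by (simp add: power2_norm_eq_inner[symmetric] power2_eq_square)
    qed simp
  qed
qed

lemma LINT_radial:
  fixes f :: "'a::euclidean_space \<Rightarrow> real"
  assumes f: "f \<in> borel_measurable borel" "\<And>x. f x \<ge> 0" and I: "I \<in> sets borel" "I \<subseteq> {0<..}"
    and F: "\<And>\<omega> s. norm \<omega> = 1 \<Longrightarrow> s \<in> I \<Longrightarrow> s ^ (DIM('a) - 1) * f (s *\<^sub>R \<omega>) = F s"
    and Fi: "set_integrable lborel I F"
  shows "(LINT x|lborel. f x * indicator {x. norm x \<in> I} x) = measure (sphere_measure 1 :: 'a measure) UNIV * (LINT s:I|lborel. F s)"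
proof -
  note [measurable] = f(1) I(1)
  interpret finite_measure "sphere_measure 1 :: 'a measure" by (rule finite_measure_sphere_measure)
  obtain \<omega>0 :: 'a where \<omega>0: "norm \<omega>0 = 1" using vector_choose_size[of 1] by auto
  have Fn: "0 \<le> F s" if "s \<in> I" for s
    using F[OF \<omega>0 that, symmetric] f(2)[of "s *\<^sub>R \<omega>0"] that I(2) by auto
  have [measurable]: "{x::'a. norm x \<in> I} \<in> sets borel" by measurable
  have "(\<integral>\<^sup>+x. ennreal (f x * indicator {x. norm x \<in> I} x) \<partial>lborel) = (\<integral>\<^sup>+x. ennreal (f x) * indicator {x. norm x \<in> I} x \<partial>lborel)"
    by (intro nn_integral_cong) (auto simp: indicator_def)
  also have "\<dots> = (\<integral>\<^sup>+\<omega>. ray_integral I f \<omega> \<partial>sphere_measure 1)"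
    by (rule nn_integral_polar_radial_set[OF _ I]) measurable
  also have "\<dots> = (\<integral>\<^sup>+\<omega>. ennreal (LINT s:I|lborel. F s) \<partial>(sphere_measure 1 :: 'a measure))"
    using AE_sphere_measure_norm[of 1, where 'a = 'a, OF zero_less_one]
  proof (intro nn_integral_cong_AE, eventually_elim)
    case (elim \<omega>)
    have "ray_integral I f \<omega> = (\<integral>\<^sup>+s. ennreal (F s) * indicator I s \<partial>lborel)"
      unfolding ray_integral_def
    proof (intro nn_integral_cong)
      fix s
      show "ennreal (s ^ (DIM('a) - 1)) * ennreal (f (s *\<^sub>R \<omega>)) * indicator I s = ennreal (F s) * indicator I s"
      proof (cases "s \<in> I")
        case True
        then have "0 \<le> s ^ (DIM('a) - 1)" using I(2) by auto
        then show ?thesis using True F[OF elim(2) True] f(2) by (simp flip: ennreal_mult)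
      qed simp
    qed
    also have "\<dots> = ennreal (LINT s:I|lborel. F s)" by (rule set_nn_integral_eq_LINT[OF Fi Fn])
    finally show ?case .
  qed
  also have "\<dots> = ennreal (LINT s:I|lborel. F s) * emeasure (sphere_measure 1 :: 'a measure) UNIV" by simp
  finally have "enn2real (\<integral>\<^sup>+x. ennreal (f x * indicator {x. norm x \<in> I} x) \<partial>lborel)
    = (LINT s:I|lborel. F s) * measure (sphere_measure 1 :: 'a measure) UNIV"
    using Fn by (simp add: enn2real_mult measure_def set_lebesgue_integral_def)
      (intro disjI2 enn2real_ennreal Bochner_Integration.integral_nonneg; auto simp: indicator_def)
  moreover have "(LINT x|lborel. f x * indicator {x. norm x \<in> I} x) = enn2real (\<integral>\<^sup>+x. ennreal (f x * indicator {x. norm x \<in> I} x) \<partial>lborel)"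
    using f(2) by (intro integral_eq_nn_integral) (auto simp: indicator_def)
  ultimately show ?thesis by simp
qed

lemma integral_inner_profile:
  fixes r \<gamma> m \<alpha> :: real
  assumes r: "0 < r" "r < \<gamma>" and m: "m < 0" and \<alpha>: "\<alpha> > 0"
  shows "set_integrable lborel {r<..<\<gamma>} (\<lambda>s. (r powr m - s powr m) powr (\<alpha> - 1) * s powr (m - 1))"
    "(LINT s:{r<..<\<gamma>}|lborel. (r powr m - s powr m) powr (\<alpha> - 1) * s powr (m - 1)) = (r powr m - \<gamma> powr m) powr \<alpha> / (\<bar>m\<bar> * \<alpha>)"
proof -
  have e: "einterval (ereal r) (ereal \<gamma>) = {r<..<\<gamma>}" by (auto simp: einterval_def)
  let ?F = "\<lambda>s. (r powr m - s powr m) powr \<alpha> / (\<bar>m\<bar> * \<alpha>)"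
  have pos: "s powr m < r powr m" if "r < s" for s using that r m by (simp add: powr_less_mono2_neg)
  have D: "(?F has_real_derivative (r powr m - s powr m) powr (\<alpha> - 1) * s powr (m - 1)) (at s)" if "r < s" for s
    using DERIV_cdivide[OF DERIV_inner_profile[OF r(1) that m, of \<alpha>], of "\<bar>m\<bar> * \<alpha>"] m \<alpha> by simp
  have C: "isCont (\<lambda>s. (r powr m - s powr m) powr (\<alpha> - 1) * s powr (m - 1)) s" if "r < s" for s
    using that r pos[OF that] by (intro continuous_intros) auto
  have lim0: "((?F \<circ> real_of_ereal) \<longlongrightarrow> 0) (at_right (ereal r))"
  proof -
    have "((\<lambda>s. (r powr m - s powr m) powr \<alpha>) \<longlongrightarrow> 0 powr \<alpha>) (at_right r)"
    proof (rule tendsto_powr')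
      show "((\<lambda>s. r powr m - s powr m) \<longlongrightarrow> 0) (at_right r)"
        using r by (auto intro!: tendsto_eq_intros)
      show "0 \<noteq> (0::real) \<or> 0 < \<alpha> \<and> (\<forall>\<^sub>F s in at_right r. 0 \<le> r powr m - s powr m)"
        using \<alpha> pos by (auto intro!: eventually_mono[OF eventually_at_right_less] less_imp_le)
    qed (rule tendsto_const)
    then have "(?F \<longlongrightarrow> 0) (at_right r)" by (intro tendsto_divide_zero) simp
    then show ?thesis by (simp add: ereal_tendsto_simps)
  qed
  have lim1: "((?F \<circ> real_of_ereal) \<longlongrightarrow> ?F \<gamma>) (at_left (ereal \<gamma>))"
    using DERIV_isCont[OF D[OF r(2)]] by (simp add: ereal_tendsto_simps isCont_def filterlim_at_split)
  have nn: "AE s in lborel. ereal r < ereal s \<longrightarrow> ereal s < ereal \<gamma> \<longrightarrow> 0 \<le> (r powr m - s powr m) powr (\<alpha> - 1) * s powr (m - 1)"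
    by (intro AE_I2) simp
  note I = interval_integral_FTC_nonneg[OF _ D C nn lim0 lim1]
  show "set_integrable lborel {r<..<\<gamma>} (\<lambda>s. (r powr m - s powr m) powr (\<alpha> - 1) * s powr (m - 1))"
    unfolding e[symmetric] using r by (intro I(1)) auto
  have "(LBINT s=ereal r..ereal \<gamma>. (r powr m - s powr m) powr (\<alpha> - 1) * s powr (m - 1)) = ?F \<gamma> - 0"
    using r by (intro I(2)) auto
  then show "(LINT s:{r<..<\<gamma>}|lborel. (r powr m - s powr m) powr (\<alpha> - 1) * s powr (m - 1)) = (r powr m - \<gamma> powr m) powr \<alpha> / (\<bar>m\<bar> * \<alpha>)"
    using r by (simp add: interval_lebesgue_integral_def e)
qed

text \<open>Equality holds because \<open>u\<^sub>\<beta>\<close> makes Young's inequality an equality at every point: on both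
  regions \<open>|\<partial>\<^sub>r u\<^sub>\<beta>|\<^sup>p\<close> is \<open>\<beta>\<^sup>p\<close> times the weighted \<open>|u\<^sub>\<beta>|\<^sup>p\<close>.\<close>

lemma beta_slope_powr_annulus:
  fixes x :: "'a::euclidean_space"
  assumes p: "1 < p" and m: "m < 0" "m * (p - 1) = p - real DIM('a)" and r: "0 < r" "r < norm x" "norm x < \<gamma>" and \<beta>: "\<beta> > 0"
  shows "\<bar>beta_slope m r \<gamma> \<beta> (norm x)\<bar> powr p = \<beta> powr p * (\<bar>beta_profile m r \<gamma> \<beta> (norm x)\<bar> powr p * annulus_weight p m r x)"
proof -
  define s where "s = norm x"
  define t where "t = r powr m - s powr m"
  have t: "t > 0" using r m by (simp add: t_def s_def powr_less_mono2_neg)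
  have x: "x \<noteq> 0" using r by auto
  have e: "(m - 1) * p = - ((real DIM('a) - 1) * (p / (p - 1)))"
  proof -
    have "m - 1 = - ((real DIM('a) - 1) / (p - 1))" using p m(2) by (simp add: field_simps)
    then show ?thesis by simp
  qed
  have "\<bar>beta_slope m r \<gamma> \<beta> (norm x)\<bar> = \<bar>m\<bar> * \<beta> * t powr (\<beta> - 1) * s powr (m - 1)"
    using r \<beta> by (simp add: beta_slope_def abs_mult t_def s_def)
  then have "\<bar>beta_slope m r \<gamma> \<beta> (norm x)\<bar> powr p = \<bar>m\<bar> powr p * \<beta> powr p * t powr ((\<beta> - 1) * p) * s powr ((m - 1) * p)"
    using \<beta> by (simp add: powr_mult powr_powr)
  also have "\<dots> = \<bar>m\<bar> powr p * \<beta> powr p * (t powr (\<beta> * p) / t powr p) * (1 / s powr ((real DIM('a) - 1) * (p / (p - 1))))"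
    unfolding e by (simp add: powr_minus_divide powr_diff left_diff_distrib)
  also have "\<dots> = \<beta> powr p * (\<bar>beta_profile m r \<gamma> \<beta> (norm x)\<bar> powr p * annulus_weight p m r x)"
    using r t x by (simp add: beta_profile_def annulus_weight_def powr_powr t_def s_def mult_ac)
  finally show ?thesis .
qed

lemma beta_slope_powr_exterior:
  fixes x :: "'a::euclidean_space"
  assumes m: "m < 0" and r: "0 < \<gamma>" "\<gamma> < norm x" and \<beta>: "\<beta> > 0"
  shows "\<bar>beta_slope m r \<gamma> \<beta> (norm x)\<bar> powr p = \<beta> powr p * (\<bar>beta_profile m r \<gamma> \<beta> (norm x)\<bar> powr p * exterior_weight p m x)"
proof -
  define s where "s = norm x"
  have x: "x \<noteq> 0" using r by auto
  have "\<bar>beta_slope m r \<gamma> \<beta> (norm x)\<bar> = \<bar>m\<bar> * \<beta> * s powr (m * \<beta> - 1)"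
    using r \<beta> by (simp add: beta_slope_def abs_mult s_def)
  then have "\<bar>beta_slope m r \<gamma> \<beta> (norm x)\<bar> powr p = \<bar>m\<bar> powr p * \<beta> powr p * s powr (m * \<beta> * p - p)"
    using \<beta> by (simp add: powr_mult powr_powr left_diff_distrib)
  also have "\<dots> = \<beta> powr p * (\<bar>beta_profile m r \<gamma> \<beta> (norm x)\<bar> powr p * exterior_weight p m x)"
    using r x by (simp add: beta_profile_def exterior_weight_def powr_powr powr_diff s_def)
  finally show ?thesis .
qed

lemma K11_u_beta:
  fixes p m r \<gamma> \<beta> :: real
  assumes p: "1 < p" and r: "0 < r" "r < \<gamma>" and m: "m < 0" "m * (p - 1) = p - real DIM('a)"
    and \<gamma>: "\<gamma> powr m = r powr m / 2" and \<beta>: "\<beta> * p - p + 1 > 0"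
  shows "K11 p m r \<gamma> (u_beta m r \<gamma> \<beta> :: 'a::euclidean_space \<Rightarrow> real)
    = measure (sphere_measure 1 :: 'a measure) UNIV * (\<bar>m\<bar> powr (p - 1) * (\<gamma> powr m) powr (\<beta> * p - p + 1) / (\<beta> * p - p + 1))"
proof -
  let ?\<alpha> = "\<beta> * p - p + 1"
  have p0: "p > 0" and m0: "m \<noteq> 0" using p m by auto
  let ?U = "\<lambda>x::'a. indicator (exterior r) x * beta_profile m r \<gamma> \<beta> (norm x)"
  have [measurable]: "?U \<in> borel_measurable borel"
    using radial_representative_u_beta[OF r m(1) \<gamma>, of \<beta>, where 'a = 'a] by (simp add: radial_representative_def)
  note I = integral_inner_profile[OF r m(1) \<beta>]
  have "K11 p m r \<gamma> (u_beta m r \<gamma> \<beta> :: 'a \<Rightarrow> real)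
    = (LINT x|lborel. (\<bar>?U x\<bar> powr p * annulus_weight p m r x) * indicator {x. norm x \<in> {r<..<\<gamma>}} x)"
    by (rule hardy_terms_representative(1)[OF r m0 p0 radial_representative_u_beta[OF r m(1) \<gamma>]])
  also have "\<dots> = measure (sphere_measure 1 :: 'a measure) UNIV
    * (LINT s:{r<..<\<gamma>}|lborel. \<bar>m\<bar> powr p * ((r powr m - s powr m) powr (?\<alpha> - 1) * s powr (m - 1)))"
  proof (rule LINT_radial)
    show "(\<lambda>x. \<bar>?U x\<bar> powr p * annulus_weight p m r x) \<in> borel_measurable borel" by measurable
    fix \<omega> :: 'a and s assume \<omega>: "norm \<omega> = 1" and s: "s \<in> {r<..<\<gamma>}"
    then have t: "r powr m - s powr m > 0" using r m by (simp add: powr_less_mono2_neg)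
    have U: "?U (s *\<^sub>R \<omega>) = (r powr m - s powr m) powr \<beta>"
      using s r \<omega> by (simp add: beta_profile_def exterior_def)
    have "s ^ (DIM('a) - 1) * (\<bar>?U (s *\<^sub>R \<omega>)\<bar> powr p * annulus_weight p m r (s *\<^sub>R \<omega>))
      = \<bar>?U (s *\<^sub>R \<omega>)\<bar> powr p * (s ^ (DIM('a) - 1) * annulus_weight p m r (s *\<^sub>R \<omega>))"
      by (simp only: mult_ac)
    also have "\<dots> = (r powr m - s powr m) powr (\<beta> * p) * (\<bar>m\<bar> powr p * s powr (m - 1) / (r powr m - s powr m) powr p)"
      using s r \<omega> annulus_weight_ray[OF \<omega> r(1) _ p m, of s] unfolding U by (simp add: powr_powr)
    also have "\<dots> = \<bar>m\<bar> powr p * ((r powr m - s powr m) powr (?\<alpha> - 1) * s powr (m - 1))"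
      by (simp add: powr_diff mult_ac)
    finally show "s ^ (DIM('a) - 1) * (\<bar>?U (s *\<^sub>R \<omega>)\<bar> powr p * annulus_weight p m r (s *\<^sub>R \<omega>))
      = \<bar>m\<bar> powr p * ((r powr m - s powr m) powr (?\<alpha> - 1) * s powr (m - 1))" .
  next
    show "set_integrable lborel {r<..<\<gamma>} (\<lambda>s. \<bar>m\<bar> powr p * ((r powr m - s powr m) powr (?\<alpha> - 1) * s powr (m - 1)))"
      using I(1) by (intro set_integrable_mult_right) auto
  qed (use r in \<open>auto simp: weights_nonneg\<close>)
  also have "(LINT s:{r<..<\<gamma>}|lborel. \<bar>m\<bar> powr p * ((r powr m - s powr m) powr (?\<alpha> - 1) * s powr (m - 1)))
    = \<bar>m\<bar> powr p * ((r powr m - \<gamma> powr m) powr ?\<alpha> / (\<bar>m\<bar> * ?\<alpha>))"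
    unfolding I(2)[symmetric] by (rule set_integral_mult_right)
  also have "\<dots> = \<bar>m\<bar> powr (p - 1) * (\<gamma> powr m) powr ?\<alpha> / ?\<alpha>"
  proof -
    have "r powr m - \<gamma> powr m = \<gamma> powr m" using \<gamma> by simp
    moreover have "\<bar>m\<bar> powr (p - 1) = \<bar>m\<bar> powr p / \<bar>m\<bar>" using m by (simp add: powr_diff)
    ultimately show ?thesis by simp
  qed
  finally show ?thesis .
qed

lemma K12_u_beta:
  fixes p m r \<gamma> \<beta> :: real
  assumes p: "1 < p" and r: "0 < r" "r < \<gamma>" and m: "m < 0" "m * (p - 1) = p - real DIM('a)"
    and \<gamma>: "\<gamma> powr m = r powr m / 2" and \<beta>: "\<beta> * p - p + 1 > 0"
  shows "K12 p m \<gamma> (u_beta m r \<gamma> \<beta> :: 'a::euclidean_space \<Rightarrow> real)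
    = measure (sphere_measure 1 :: 'a measure) UNIV * (\<bar>m\<bar> powr (p - 1) * (\<gamma> powr m) powr (\<beta> * p - p + 1) / (\<beta> * p - p + 1))"
proof -
  let ?\<alpha> = "\<beta> * p - p + 1"
  have p0: "p > 0" and m0: "m \<noteq> 0" and \<gamma>0: "\<gamma> > 0" using p m r by auto
  let ?U = "\<lambda>x::'a. indicator (exterior r) x * beta_profile m r \<gamma> \<beta> (norm x)"
  have [measurable]: "?U \<in> borel_measurable borel"
    using radial_representative_u_beta[OF r m(1) \<gamma>, of \<beta>, where 'a = 'a] by (simp add: radial_representative_def)
  have q: "m * ?\<alpha> < 0" using m \<beta> by (simp add: mult_neg_pos)
  note I = integral_powr_greaterThan[OF \<gamma>0 q]
  have "K12 p m \<gamma> (u_beta m r \<gamma> \<beta> :: 'a \<Rightarrow> real)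
    = (LINT x|lborel. (\<bar>?U x\<bar> powr p * exterior_weight p m x) * indicator {x. norm x \<in> {\<gamma><..}} x)"
    by (rule hardy_terms_representative(2)[OF r m0 p0 radial_representative_u_beta[OF r m(1) \<gamma>]])
  also have "\<dots> = measure (sphere_measure 1 :: 'a measure) UNIV
    * (LINT s:{\<gamma><..}|lborel. \<bar>m\<bar> powr p * s powr (m * ?\<alpha> - 1))"
  proof (rule LINT_radial)
    show "(\<lambda>x. \<bar>?U x\<bar> powr p * exterior_weight p m x) \<in> borel_measurable borel" by measurable
    fix \<omega> :: 'a and s assume \<omega>: "norm \<omega> = 1" and s: "s \<in> {\<gamma><..}"
    have U: "?U (s *\<^sub>R \<omega>) = s powr (m * \<beta>)"
      using s r \<omega> by (simp add: beta_profile_def exterior_def)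
    have "s ^ (DIM('a) - 1) * (\<bar>?U (s *\<^sub>R \<omega>)\<bar> powr p * exterior_weight p m (s *\<^sub>R \<omega>))
      = \<bar>?U (s *\<^sub>R \<omega>)\<bar> powr p * (s ^ (DIM('a) - 1) * exterior_weight p m (s *\<^sub>R \<omega>))"
      by (simp only: mult_ac)
    also have "\<dots> = s powr (m * \<beta> * p) * (\<bar>m\<bar> powr p * s powr (m - 1) / s powr (m * p))"
      using s r \<omega> exterior_weight_ray[OF \<omega> _ m(2), of s] unfolding U by (simp add: powr_powr)
    also have "\<dots> = \<bar>m\<bar> powr p * (s powr (m * \<beta> * p) * s powr (m - 1) / s powr (m * p))" by simp
    also have "\<dots> = \<bar>m\<bar> powr p * s powr (m * \<beta> * p + (m - 1) - m * p)"
      unfolding powr_add powr_diff ..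
    also have "m * \<beta> * p + (m - 1) - m * p = m * ?\<alpha> - 1" by (simp add: algebra_simps)
    finally show "s ^ (DIM('a) - 1) * (\<bar>?U (s *\<^sub>R \<omega>)\<bar> powr p * exterior_weight p m (s *\<^sub>R \<omega>))
      = \<bar>m\<bar> powr p * s powr (m * ?\<alpha> - 1)" .
  next
    show "set_integrable lborel {\<gamma><..} (\<lambda>s. \<bar>m\<bar> powr p * s powr (m * ?\<alpha> - 1))"
      using I(1) by (intro set_integrable_mult_right) auto
  qed (use r in \<open>auto simp: weights_nonneg\<close>)
  also have "(LINT s:{\<gamma><..}|lborel. \<bar>m\<bar> powr p * s powr (m * ?\<alpha> - 1)) = \<bar>m\<bar> powr p * (\<gamma> powr (m * ?\<alpha>) / \<bar>m * ?\<alpha>\<bar>)"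
    unfolding I(2)[symmetric] by (rule set_integral_mult_right)
  also have "\<dots> = \<bar>m\<bar> powr (p - 1) * (\<gamma> powr m) powr ?\<alpha> / ?\<alpha>"
  proof -
    have "\<bar>m * ?\<alpha>\<bar> = \<bar>m\<bar> * ?\<alpha>" using \<beta> by (simp add: abs_mult)
    moreover have "\<bar>m\<bar> powr (p - 1) = \<bar>m\<bar> powr p / \<bar>m\<bar>" using m by (simp add: powr_diff)
    ultimately show ?thesis by (simp add: powr_powr)
  qed
  finally show ?thesis .
qed

text \<open>By uniqueness the trace is given by the ray formula, which integrates the outer branch of the slope
  to \<open>\<gamma>\<^bsup>m\<beta>\<^esup>\<close>.\<close>

lemma K0_u_beta:
  fixes p m r \<gamma> \<beta> :: real
  assumes p: "1 < p" and r: "0 < r" "r < \<gamma>" and m: "m < 0" "m * (p - 1) = p - real DIM('a)"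
    and \<gamma>: "\<gamma> powr m = r powr m / 2" and \<beta>: "\<beta> > 0"
    and u: "(u_beta m r \<gamma> \<beta> :: 'a::euclidean_space \<Rightarrow> real) \<in> W1p_0 (exterior r) p"
  shows "K0 p m r \<gamma> (u_beta m r \<gamma> \<beta> :: 'a \<Rightarrow> real)
    = measure (sphere_measure 1 :: 'a measure) UNIV * (\<bar>m\<bar> powr (p - 1) * (\<gamma> powr m) powr (\<beta> * p - p + 1))"
proof -
  have \<gamma>0: "0 < \<gamma>" using r by simp
  let ?u = "u_beta m r \<gamma> \<beta> :: 'a \<Rightarrow> real"
  let ?H = "\<lambda>x::'a. indicator (exterior r) x * beta_slope m r \<gamma> \<beta> (norm x)"
  note rep = radial_representative_u_beta[OF r m(1) \<gamma>, of \<beta>, where 'a = 'a]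
  have u1: "?u \<in> W1p (exterior r) p" using u by (simp add: W1p_0_def)
  let ?g = "sphere_trace (exterior r) p \<gamma> ?u"
  have tr: "is_sphere_trace (exterior r) p \<gamma> ?u ?g"
    unfolding sphere_trace_def
    by (rule someI[of _ "ray_trace \<gamma> ?H"]) (rule is_sphere_trace_ray_trace[OF p m r(2) \<gamma>0 u rep])
  have mb: "m * \<beta> < 0" using m \<beta> by (simp add: mult_neg_pos)
  have T: "ray_trace \<gamma> ?H x = \<gamma> powr (m * \<beta>)" if x: "norm x = \<gamma>" for x
  proof -
    have "(LINT s:{\<gamma><..}|lborel. ?H ((s / norm x) *\<^sub>R x)) = (LINT s:{\<gamma><..}|lborel. (m * \<beta>) * s powr (m * \<beta> - 1))"
      using r x by (intro set_lebesgue_integral_cong) (auto simp: beta_slope_def exterior_def)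
    also have "\<dots> = (m * \<beta>) * (\<gamma> powr (m * \<beta>) / \<bar>m * \<beta>\<bar>)"
      unfolding integral_powr_greaterThan(2)[OF \<gamma>0 mb, symmetric] by (rule set_integral_mult_right)
    also have "\<dots> = - (\<gamma> powr (m * \<beta>))" using mb m \<beta> by simp
    finally show ?thesis by (simp add: ray_trace_def)
  qed
  have "AE x in sphere_measure \<gamma>. \<bar>?g x\<bar> powr p = \<gamma> powr (m * \<beta> * p)"
    using sphere_trace_AE_eq_ray_trace[OF p m r(2) \<gamma>0 u1 rep tr] AE_sphere_measure_norm[OF \<gamma>0, where 'a = 'a]
    by eventually_elim (simp add: T powr_powr)
  moreover have "?g \<in> borel_measurable borel" using tr by (simp add: is_sphere_trace_def)
  ultimately have "sphere_integral p r \<gamma> ?u = (LINT x|(sphere_measure \<gamma> :: 'a measure). \<gamma> powr (m * \<beta> * p))"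
    unfolding sphere_integral_def by (intro integral_cong_AE) auto
  also have "\<dots> = measure (sphere_measure \<gamma> :: 'a measure) UNIV * \<gamma> powr (m * \<beta> * p)" by simp
  also have "measure (sphere_measure \<gamma> :: 'a measure) UNIV = \<gamma> ^ (DIM('a) - 1) * measure (sphere_measure 1 :: 'a measure) UNIV"
    using nn_integral_sphere_measure_unit[of "\<lambda>x::'a. 1" \<gamma>] \<gamma>0 by (simp add: measure_def enn2real_mult)
  finally have "K0 p m r \<gamma> ?u = measure (sphere_measure 1 :: 'a measure) UNIV
    * ((\<bar>m\<bar> powr (p - 1) * \<gamma> powr (1 - p) * \<gamma> ^ (DIM('a) - 1)) * \<gamma> powr (m * \<beta> * p))"
    by (simp add: K0_def)
  also have "(\<bar>m\<bar> powr (p - 1) * \<gamma> powr (1 - p) * \<gamma> ^ (DIM('a) - 1)) * \<gamma> powr (m * \<beta> * p)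
    = \<bar>m\<bar> powr (p - 1) * (\<gamma> powr ((1 - p) + real (DIM('a) - 1) + m * \<beta> * p))"
    unfolding powr_add powr_realpow[OF \<gamma>0] by (simp only: mult_ac)
  also have "(1 - p) + real (DIM('a) - 1) + m * \<beta> * p = m * (\<beta> * p - p + 1)"
    using m(2) by (simp add: algebra_simps of_nat_diff)
  finally show ?thesis by (simp add: powr_powr)
qed

text \<open>Both regions have the same weighted integral \<open>K\<close>, with \<open>K\<^sub>0 = (\<beta> p - p + 1) K\<close>, so each numerator is
  \<open>(\<beta> p K)\<^sup>p\<close> and each side of the inequality equals \<open>2 \<beta>\<^sup>p K\<close>.\<close>

lemma hardy_equality_u_beta:
  fixes p m r \<gamma> \<beta> :: real
  assumes p: "1 < p" and r: "0 < r" "r < \<gamma>" and m: "m < 0" "m * (p - 1) = p - real DIM('a)"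
    and \<gamma>: "\<gamma> powr m = r powr m / 2" and \<beta>: "\<beta> * p - p + 1 > 0"
    and u: "(u_beta m r \<gamma> \<beta> :: 'a::euclidean_space \<Rightarrow> real) \<in> W1p_0 (exterior r) p"
  shows "hardy_lhs p r (u_beta m r \<gamma> \<beta> :: 'a \<Rightarrow> real) = hardy_rhs p m r \<gamma> (u_beta m r \<gamma> \<beta> :: 'a \<Rightarrow> real)"
proof -
  let ?u = "u_beta m r \<gamma> \<beta> :: 'a \<Rightarrow> real"
  let ?U = "\<lambda>x::'a. indicator (exterior r) x * beta_profile m r \<gamma> \<beta> (norm x)"
  let ?H = "\<lambda>x::'a. indicator (exterior r) x * beta_slope m r \<gamma> \<beta> (norm x)"
  let ?A1 = "{x::'a. norm x \<in> {r<..<\<gamma>}}" and ?A2 = "{x::'a. norm x \<in> {\<gamma><..}}"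
  let ?\<alpha> = "\<beta> * p - p + 1"
  have \<gamma>0: "0 < \<gamma>" and p0: "p > 0" and m0: "m \<noteq> 0" using r p m by auto
  have "\<beta> * p > 0" using \<beta> p by linarith
  then have \<beta>0: "\<beta> > 0" using p0 by (simp add: zero_less_mult_iff)
  note rep = radial_representative_u_beta[OF r m(1) \<gamma>, of \<beta>, where 'a = 'a]
  note R = hardy_terms_representative[OF r m0 p0 rep]
  have u1: "?u \<in> W1p (exterior r) p" using u by (simp add: W1p_0_def)
  define K where "K = K11 p m r \<gamma> ?u"
  have K2: "K12 p m \<gamma> ?u = K" unfolding K_def K11_u_beta[OF p r m \<gamma> \<beta>] K12_u_beta[OF p r m \<gamma> \<beta>] ..
  have K0: "K0 p m r \<gamma> ?u = ?\<alpha> * K"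
    unfolding K_def K11_u_beta[OF p r m \<gamma> \<beta>] K0_u_beta[OF p r m \<gamma> \<beta>0 u] using \<beta> by simp
  have Kn: "K \<ge> 0" unfolding K_def K11_u_beta[OF p r m \<gamma> \<beta>] using \<beta> by simp
  have "hardy_lhs p r ?u = (LINT x|lborel. \<beta> powr p * (\<bar>?U x\<bar> powr p * annulus_weight p m r x * indicator ?A1 x)
      + \<beta> powr p * (\<bar>?U x\<bar> powr p * exterior_weight p m x * indicator ?A2 x))"
    unfolding R(3)
  proof (rule Bochner_Integration.integral_cong[OF refl])
    fix x :: 'a
    have 1: "\<bar>?H x\<bar> powr p * indicator ?A1 x = \<beta> powr p * (\<bar>?U x\<bar> powr p * annulus_weight p m r x * indicator ?A1 x)"
      using beta_slope_powr_annulus[OF p m r(1) _ _ \<beta>0, of x \<gamma>] by (auto simp: indicator_def exterior_def)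
    have 2: "\<bar>?H x\<bar> powr p * indicator ?A2 x = \<beta> powr p * (\<bar>?U x\<bar> powr p * exterior_weight p m x * indicator ?A2 x)"
      using beta_slope_powr_exterior[OF m(1) \<gamma>0 _ \<beta>0, of x r p] r by (auto simp: indicator_def exterior_def)
    from 1 2 show "\<bar>?H x\<bar> powr p * indicator ?A1 x + \<bar>?H x\<bar> powr p * indicator ?A2 x
      = \<beta> powr p * (\<bar>?U x\<bar> powr p * annulus_weight p m r x * indicator ?A1 x)
      + \<beta> powr p * (\<bar>?U x\<bar> powr p * exterior_weight p m x * indicator ?A2 x)" by (rule arg_cong2[where f = "(+)"])
  qed
  also have "\<dots> = \<beta> powr p * K11 p m r \<gamma> ?u + \<beta> powr p * K12 p m \<gamma> ?u"
    unfolding R(1,2)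
    using R(6,7) hardy_inequality_exterior(1,2)[OF p r m \<gamma> u] by simp
  also have "\<dots> = 2 * (\<beta> powr p * K)" by (simp add: K2 K_def)
  also have "\<dots> = hardy_rhs p m r \<gamma> ?u"
  proof (cases "K = 0")
    case False
    have "?\<alpha> * K + (p - 1) * K = \<beta> * p * K" by (simp add: algebra_simps)
    then have "hardy_summand p (?\<alpha> * K) K = (\<beta> * p * K) powr p / K powr (p - 1)"
      using False by (simp add: hardy_summand_def)
    also have "\<dots> = \<beta> powr p * p powr p * K"
      using False Kn p0 \<beta>0 by (simp add: powr_mult powr_diff)
    finally have "(1 / p) powr p * hardy_summand p (?\<alpha> * K) K = \<beta> powr p * K"
      using p0 by (simp add: powr_divide)
    then show ?thesis by (simp add: hardy_rhs_def K0 K2 K_def[symmetric] distrib_left)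
  qed (simp add: hardy_rhs_def K0 K2 K_def[symmetric] hardy_summand_def)
  finally show ?thesis .
qed

theorem proposition4p1:
  fixes n :: nat and p p' m r \<gamma> :: real
  assumes "n = CARD('n::finite)" and "2 \<le> n"
    and "1 < p" and "p < real n" and "0 < r"
    and "p' = p / (p - 1)"
    and "m = (p - real n) / (p - 1)"
    and "\<gamma> = 2 powr (1 / \<bar>m\<bar>) * r"
  shows "(\<forall>u \<in> (M_space p m r :: (real ^ 'n \<Rightarrow> real) set).
            set_integrable lebesgue (ball 0 \<gamma> - ball 0 r) (K11_integrand p m r u) \<and>
            set_integrable lebesgue (exterior \<gamma>) (K12_integrand p u) \<and>
            hardy_lhs p r u \<ge> hardy_rhs p m r \<gamma> u) \<and>
         (\<forall>\<beta>. \<beta> > 1 / p' \<and> (u_beta m r \<gamma> \<beta> :: real ^ 'n \<Rightarrow> real) \<in> M_space p m r \<longrightarrow>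
            hardy_lhs p r (u_beta m r \<gamma> \<beta> :: real ^ 'n \<Rightarrow> real) =
            hardy_rhs p m r \<gamma> (u_beta m r \<gamma> \<beta> :: real ^ 'n \<Rightarrow> real))"
proof -
  have dim: "real DIM(real ^ 'n) = real n" using assms(1) by simp
  note E = hardy_exponents[OF assms(3,4,5,7,8)]
  have m: "m * (p - 1) = p - real DIM(real ^ 'n)" using E(2) unfolding dim .
  have r: "0 < r" "r < \<gamma>" using assms(5) E(3) by auto
  have \<beta>: "\<beta> * p - p + 1 > 0" if "\<beta> > 1 / p'" for \<beta>
    using that assms(3,6) by (simp add: field_simps)
  have W0: "u \<in> W1p_0 (exterior r) p" if "u \<in> M_space p m r" for u :: "real ^ 'n \<Rightarrow> real"
    using that by (simp add: M_space_def)
  show ?thesis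
    using hardy_inequality_exterior[OF assms(3) r E(1) m E(4) W0]
      hardy_equality_u_beta[OF assms(3) r E(1) m E(4) \<beta> W0]
    by blast
qed

end
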